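(* Let $G=(G,\tau_G)$ be a unitarizable group, let $\tau\in\overline{\mathcal T}_u(G)$, and put $$\mathrm B^\tau(G)=P(\tau)\cdot\mathrm B(G)\quad\text{and}\quad\mathrm I(\tau)=(I-P(\tau))\cdot\mathrm B(G).$$ Then $$\mathrm B^\tau(G)=\{u\in\mathrm B(G):u\text{ is }\tau\text{-continuous}\},$$ $$\mathrm I(\tau)=\{\langle\pi(\cdot)\xi,\eta\rangle:\pi\text{ admits no }\tau\text{-continuous subrepresentations}\}.$$ Moreover, there is a decomposition $$\mathrm B(G)=\mathrm B^\tau(G)\oplus_{\ell^1}\mathrm I(\tau)$$ into a closed translation-invariant subalgebra $\mathrm B^\tau(G)$ and a closed translation-invariant ideal $\mathrm I(\tau)$.
   Context: For a group topology $\tau$ on $G$, $\mathrm P^\tau(G)$ is the set of $\tau$-continuous positive definite functions on $G$. $\mathcal T_u(G)=\{\tau\subseteq\tau_G:\tau\text{ is a group topology with }\tau=\sigma(G,\mathrm P^\tau(G))\}$, where $\sigma$ denotes the initial topology; $(G,\tau_G)$ (Hausdorff) is unitarizable if $\tau_G\in\mathcal T_u(G)$. With $\pi_u$ on $\mathcal H_u$ the Gelfand-Naimark-Segal representation of $u$, let $\varpi_\tau=\bigoplus_{u\in\mathrm P^\tau(G)}\pi_u$, $\varpi=\varpi_{\tau_G}$ on $\mathcal H_G=\ell^2\text{-}\bigoplus_{u\in\mathrm P^{\tau_G}(G)}\mathcal H_u$ (the universal unitary representation), and $G^\varpi=\overline{\varpi(G)}^{wo}\subseteq\mathcal B(\mathcal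 H_G)$, $G^{\varpi_\tau}=\overline{\varpi_\tau(G)}^{wo}$, which are compact semitopological semigroups. $\mathrm{ZE}(G^\varpi)=\{p\in G^\varpi:p^2=p,\ \varpi(s)p=p\varpi(s)\text{ for all }s\in G\}$, ordered by $p_1\le p_2$ iff $p_1p_2=p_1$. For $p\in\mathrm{ZE}(G^\varpi)$, $T_u(p)=\sigma(G,\{s\mapsto p\varpi(s)\})$ with $G^\varpi$ carrying the weak operator topology, and $\overline{\mathcal T}_u(G)=T_u(\mathrm{ZE}(G^\varpi))$. For $\tau\in\mathcal T_u(G)$, $P(\tau)\in\mathrm{ZE}(G^\varpi)$ is the minimal idempotent of the closed semigroup $\tilde\varpi_\tau^{-1}(\{I\})$, where $\tilde\varpi_\tau:G^\varpi\to G^{\varpi_\tau}$ is the unique continuous extension of $\varpi_\tau$ (so $\tilde\varpi_\tau\circ\varpi=\varpi_\tau$). On $\overline{\mathcal T}_u(G)$, $P$ is the inverse of $T_u$. The Fourier-Stieltjes algebra is $\mathrm B(G)=\mathrm{span}\,\mathrm P^{\tau_G}(G)$, i.e. the algebra of all matrix coefficients $\langle\pi(\cdot)\xi,\eta\rangle$ of continuous unitary representations $\pi$ of $G$. With $\mathrm W^*(G)=\varpi(G)''$, each continuous unitary representation $\pi$ has a unique normal extension $\pi'':\mathrm W^*(G)\to\pi(G)''$, and $\mathrm B(G)$ is given the norm as predual of $\mathrm W^*(G)$ under $\langle u,T\rangle=\langle\pi''(T)\xi,\eta\rangle$ for $u=\langle\pi(\cdot)\xi,\eta\rangle$; it is a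 Banach algebra. For a central projection $Z\in\mathrm W^*(G)$, $Z\cdot\langle\pi(\cdot)\xi,\eta\rangle=\langle\pi(\cdot)\pi''(Z)\xi,\eta\rangle$. In the description of $\mathrm I(\tau)$, $\pi$ ranges over continuous unitary representations of $G$ and $\xi,\eta$ over its space; "subrepresentation" means non-zero subrepresentation. $\oplus_{\ell^1}$ means a direct sum in which $\|u+v\|=\|u\|+\|v\|$ for $u,v$ in the respective summands. *)

theory Defs
  imports "HOL-Analysis.Analysis" "HOL-Library.Poly_Mapping"
begin

section \<open>Complex Hilbert spaces\<close>

text \<open>The inner product is linear in the first argument.\<close>

class complex_hilbert = banach +
  fixes scaleC :: "complex \<Rightarrow> 'a \<Rightarrow> 'a" (infixr \<open>*\<^sub>C\<close> 75)
    and cinner :: "'a \<Rightarrow> 'a \<Rightarrow> complex"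
  assumes scaleC_of_real: "complex_of_real r *\<^sub>C x = r *\<^sub>R x"
    and scaleC_add_right: "a *\<^sub>C (x + y) = a *\<^sub>C x + a *\<^sub>C y"
    and scaleC_add_left: "(a + b) *\<^sub>C x = a *\<^sub>C x + b *\<^sub>C x"
    and scaleC_scaleC: "a *\<^sub>C b *\<^sub>C x = (a * b) *\<^sub>C x"
    and cinner_add_left: "cinner (x + y) z = cinner x z + cinner y z"
    and cinner_scaleC_left: "cinner (a *\<^sub>C x) y = a * cinner x y"
    and cinner_commute: "cinner x y = cnj (cinner y x)"
    and cinner_self: "cinner x x = complex_of_real ((norm x)\<^sup>2)"

section \<open>Positive definite functions and the Gelfand-Naimark-Segal spaces\<close>

text \<open>Groups are types of class \<open>group_add\<close>. This class does not assume commutativity: the product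
  $st$ is written \<open>s + t\<close>, the inverse $t^{-1}$ is \<open>- t\<close> and the unit is \<open>0\<close>.\<close>

definition pos_def :: "('g::group_add \<Rightarrow> complex) \<Rightarrow> bool" where
  "pos_def u \<longleftrightarrow> (\<forall>F c. finite F \<longrightarrow>
     (\<Sum>s\<in>F. \<Sum>t\<in>F. c s * cnj (c t) * u (- t + s)) \<in> \<real>\<^sub>\<ge>\<^sub>0)"

text \<open>For a positive definite \<open>u\<close> the Gelfand-Naimark-Segal space $\mathcal{H}_u$ is the Hausdorff
  completion of the free complex vector space on \<open>G\<close>, with
  $\langle\delta_s,\delta_t\rangle_u = u(t^{-1}s)$. All these spaces are constructed at once: \<open>'g pd_free\<close> is the free complex vector space on the pairs
  \<open>(u, s)\<close>, pairs with different \<open>u\<close> being orthogonal (and pairs with \<open>u\<close> not positive definite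
  null), and \<open>'g gns_total\<close> below, its Hausdorff completion, is the $\ell^2$-direct sum of the
  $\mathcal{H}_u$ over all positive definite \<open>u\<close>, continuous or not.\<close>

type_synonym 'g pd_free = "(('g \<Rightarrow> complex) \<times> 'g) \<Rightarrow>\<^sub>0 complex"

definition pd_kernel :: "('g::group_add \<Rightarrow> complex) \<times> 'g \<Rightarrow> ('g \<Rightarrow> complex) \<times> 'g \<Rightarrow> complex" where
  "pd_kernel a b = (if fst a = fst b \<and> pos_def (fst a) then fst a (- snd b + snd a) else 0)"

definition pd_form :: "'g::group_add pd_free \<Rightarrow> 'g pd_free \<Rightarrow> complex" where
  "pd_form f g = (\<Sum>a\<in>Poly_Mapping.keys f. \<Sum>b\<in>Poly_Mapping.keys g.
      Poly_Mapping.lookup f a * cnj (Poly_Mapping.lookup g b) * pd_kernel a b)"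

definition pd_norm :: "'g::group_add pd_free \<Rightarrow> real" where
  "pd_norm f = sqrt (Re (pd_form f f))"

definition pd_scale :: "complex \<Rightarrow> 'g pd_free \<Rightarrow> 'g pd_free" where
  "pd_scale c f = Poly_Mapping.map ((*) c) f"

lemma lookup_pd_scale [simp]: "Poly_Mapping.lookup (pd_scale c f) a = c * Poly_Mapping.lookup f a"
  by (simp add: pd_scale_def Poly_Mapping.map.rep_eq when_def)

lemma keys_pd_scale: "Poly_Mapping.keys (pd_scale c f) \<subseteq> Poly_Mapping.keys f"
  by (auto simp: in_keys_iff)

lemma pd_form_superset:
  assumes "finite A" "finite B" "Poly_Mapping.keys f \<subseteq> A" "Poly_Mapping.keys g \<subseteq> B"
  shows "pd_form f g = (\<Sum>a\<in>A. \<Sum>b\<in>B.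
      Poly_Mapping.lookup f a * cnj (Poly_Mapping.lookup g b) * pd_kernel a b)"
proof -
  have "pd_form f g = (\<Sum>a\<in>Poly_Mapping.keys f. \<Sum>b\<in>B.
      Poly_Mapping.lookup f a * cnj (Poly_Mapping.lookup g b) * pd_kernel a b)"
    unfolding pd_form_def
    by (intro sum.cong refl sum.mono_neutral_left) (use assms in \<open>auto simp: in_keys_iff\<close>)
  also have "\<dots> = (\<Sum>a\<in>A. \<Sum>b\<in>B.
      Poly_Mapping.lookup f a * cnj (Poly_Mapping.lookup g b) * pd_kernel a b)"
    by (intro sum.mono_neutral_left) (use assms in \<open>auto simp: in_keys_iff\<close>)
  finally show ?thesis .
qed

lemma pd_form_add_left: "pd_form (f + g) h = pd_form f h + pd_form g h"
proof -
  let ?A = "Poly_Mapping.keys f \<union> Poly_Mapping.keys g"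
  have *: "Poly_Mapping.keys (f + g) \<subseteq> ?A" by (rule keys_add)
  show ?thesis
    by (simp add: * pd_form_superset[of ?A "Poly_Mapping.keys h"] lookup_add algebra_simps sum.distrib)
qed

lemma pd_form_add_right: "pd_form h (f + g) = pd_form h f + pd_form h g"
proof -
  let ?A = "Poly_Mapping.keys f \<union> Poly_Mapping.keys g"
  have *: "Poly_Mapping.keys (f + g) \<subseteq> ?A" by (rule keys_add)
  show ?thesis
    by (simp add: * pd_form_superset[of "Poly_Mapping.keys h" ?A] lookup_add algebra_simps sum.distrib)
qed

lemma pd_form_scale_left: "pd_form (pd_scale c f) h = c * pd_form f h"
  by (simp add: pd_form_superset[of "Poly_Mapping.keys f" "Poly_Mapping.keys h"] keys_pd_scale
      sum_distrib_left mult.assoc)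

lemma pd_form_scale_right: "pd_form h (pd_scale c f) = cnj c * pd_form h f"
  by (simp add: pd_form_superset[of "Poly_Mapping.keys h" "Poly_Mapping.keys f"] keys_pd_scale
      sum_distrib_left mult_ac)

lemma sum_in_nonneg_Reals:
  assumes "finite B" "\<And>u. h u \<in> \<real>\<^sub>\<ge>\<^sub>0"
  shows "(\<Sum>u\<in>B. h u) \<in> (\<real>\<^sub>\<ge>\<^sub>0 :: complex set)"
  using assms(1) by induction (simp_all add: assms(2))

lemma pd_form_nonneg: "pd_form f f \<in> \<real>\<^sub>\<ge>\<^sub>0"
proof -
  let ?A = "fst ` Poly_Mapping.keys f" and ?S = "snd ` Poly_Mapping.keys f"
  let ?f = "Poly_Mapping.lookup f"
  have sub: "Poly_Mapping.keys f \<subseteq> ?A \<times> ?S" by force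
  have "pd_form f f = (\<Sum>a\<in>?A\<times>?S. \<Sum>b\<in>?A\<times>?S. ?f a * cnj (?f b) * pd_kernel a b)"
    by (rule pd_form_superset) (use sub in auto)
  also have "\<dots> = (\<Sum>u\<in>?A. \<Sum>s\<in>?S. \<Sum>v\<in>?A. \<Sum>t\<in>?S. ?f (u,s) * cnj (?f (v,t)) * pd_kernel (u,s) (v,t))"
    by (simp only: sum.cartesian_product')
  also have "\<dots> = (\<Sum>u\<in>?A. \<Sum>s\<in>?S. \<Sum>t\<in>?S. \<Sum>v\<in>?A. ?f (u,s) * cnj (?f (v,t)) * pd_kernel (u,s) (v,t))"
    by (intro sum.cong refl sum.swap)
  also have "\<dots> = (\<Sum>u\<in>?A. \<Sum>s\<in>?S. \<Sum>t\<in>?S. ?f (u,s) * cnj (?f (u,t)) * (if pos_def u then u (- t + s) else 0))"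
  proof (intro sum.cong refl)
    fix u s t assume u: "u \<in> ?A"
    have "(\<Sum>v\<in>?A. ?f (u,s) * cnj (?f (v,t)) * pd_kernel (u,s) (v,t))
      = (\<Sum>v\<in>?A. if v = u then ?f (u,s) * cnj (?f (u,t)) * (if pos_def u then u (- t + s) else 0) else 0)"
      by (intro sum.cong) (auto simp: pd_kernel_def)
    also have "\<dots> = ?f (u,s) * cnj (?f (u,t)) * (if pos_def u then u (- t + s) else 0)"
      using u by (subst sum.delta) auto
    finally show "(\<Sum>v\<in>?A. ?f (u,s) * cnj (?f (v,t)) * pd_kernel (u,s) (v,t))
      = ?f (u,s) * cnj (?f (u,t)) * (if pos_def u then u (- t + s) else 0)" .
  qed
  also have "\<dots> \<in> \<real>\<^sub>\<ge>\<^sub>0"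
  proof -
    have "(\<Sum>s\<in>?S. \<Sum>t\<in>?S. ?f (u,s) * cnj (?f (u,t)) * (if pos_def u then u (- t + s) else 0)) \<in> \<real>\<^sub>\<ge>\<^sub>0" for u
    proof (cases "pos_def u")
      case True
      then have "(\<Sum>s\<in>?S. \<Sum>t\<in>?S. ?f (u,s) * cnj (?f (u,t)) * u (- t + s)) \<in> \<real>\<^sub>\<ge>\<^sub>0"
        unfolding pos_def_def by (elim allE[of _ ?S] allE[of _ "\<lambda>s. ?f (u,s)"]) auto
      then show ?thesis using True by simp
    qed simp
    then show ?thesis by (rule sum_in_nonneg_Reals[rotated]) simp
  qed
  finally show ?thesis .
qed

lemma pd_scale_1 [simp]: "pd_scale 1 f = f"
  by (rule poly_mapping_eqI) simp

lemma pd_scale_0 [simp]: "pd_scale 0 f = 0"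
  by (rule poly_mapping_eqI) simp

lemma pd_scale_zero [simp]: "pd_scale c 0 = 0"
  by (rule poly_mapping_eqI) simp

lemma pd_scale_minus1: "pd_scale (-1) f = - f"
  by (rule poly_mapping_eqI) simp

lemma pd_scale_add: "pd_scale c (f + g) = pd_scale c f + pd_scale c g"
  by (rule poly_mapping_eqI) (simp add: lookup_add algebra_simps)

lemma pd_scale_add_left: "pd_scale (c + d) f = pd_scale c f + pd_scale d f"
  by (rule poly_mapping_eqI) (simp add: lookup_add algebra_simps)

lemma pd_scale_diff: "pd_scale c (f - g) = pd_scale c f - pd_scale c g"
  by (rule poly_mapping_eqI) (simp add: lookup_minus algebra_simps)

lemma pd_scale_scale: "pd_scale c (pd_scale d f) = pd_scale (c * d) f"
  by (rule poly_mapping_eqI) (simp add: mult.assoc)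

lemma pd_form_zero [simp]: "pd_form 0 g = 0" "pd_form f 0 = 0"
  by (simp_all add: pd_form_def)

lemma pd_form_minus_left: "pd_form (- f) g = - pd_form f g"
  using pd_form_scale_left[of "-1" f g] by (simp add: pd_scale_minus1)

lemma pd_form_minus_right: "pd_form g (- f) = - pd_form g f"
  using pd_form_scale_right[of g "-1" f] by (simp add: pd_scale_minus1)

lemma pd_form_diff_left: "pd_form (f - g) h = pd_form f h - pd_form g h"
  using pd_form_add_left[of f "- g" h] by (simp add: pd_form_minus_left)

lemma pd_form_diff_right: "pd_form h (f - g) = pd_form h f - pd_form h g"
  using pd_form_add_right[of h f "- g"] by (simp add: pd_form_minus_right)

lemma pd_form_self: "pd_form f f = complex_of_real ((pd_norm f)\<^sup>2)"
  using pd_form_nonneg[of f]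
  by (auto simp: pd_norm_def simp del: of_real_power elim!: nonneg_Reals_cases)

lemma pd_norm_nonneg [simp]: "0 \<le> pd_norm f"
  using pd_form_nonneg[of f] by (auto simp: pd_norm_def elim!: nonneg_Reals_cases)

lemma pd_form_commute: "pd_form f g = cnj (pd_form g f)"
proof -
  have im: "Im (pd_form h h) = 0" for h :: "'a pd_free"
    by (simp add: pd_form_self)
  from im[of "f + g"] have 1: "Im (pd_form f g) + Im (pd_form g f) = 0"
    by (simp add: pd_form_add_left pd_form_add_right im)
  from im[of "f + pd_scale \<i> g"] have 2: "Re (pd_form g f) - Re (pd_form f g) = 0"
    by (simp add: pd_form_add_left pd_form_add_right im pd_form_scale_left pd_form_scale_right)
  from 1 2 show ?thesis by (simp add: complex_eq_iff)
qed

lemma pd_form_Cauchy_Schwarz: "cmod (pd_form f g) \<le> pd_norm f * pd_norm g"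
proof -
  define z where "z = pd_form f g"
  define a where "a = (cmod z)\<^sup>2"
  have key: "0 \<le> (pd_norm f)\<^sup>2 - 2 * r * a + r\<^sup>2 * a * (pd_norm g)\<^sup>2" for r :: real
  proof -
    let ?c = "complex_of_real r * z"
    have "pd_form (f - pd_scale ?c g) (f - pd_scale ?c g)
       = pd_form f f - cnj ?c * z - ?c * cnj z + ?c * cnj ?c * pd_form g g"
      using pd_form_commute[of g f]
      by (simp add: pd_form_diff_left pd_form_diff_right pd_form_scale_left pd_form_scale_right z_def algebra_simps)
    also have "\<dots> = complex_of_real ((pd_norm f)\<^sup>2 - 2 * r * a + r\<^sup>2 * a * (pd_norm g)\<^sup>2)"
      using complex_norm_square[of z] unfolding a_def
      by (simp add: pd_form_self power2_eq_square algebra_simps)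
    finally have "complex_of_real ((pd_norm (f - pd_scale ?c g))\<^sup>2)
       = complex_of_real ((pd_norm f)\<^sup>2 - 2 * r * a + r\<^sup>2 * a * (pd_norm g)\<^sup>2)"
      by (simp only: pd_form_self)
    then show ?thesis by (metis of_real_eq_iff zero_le_power2)
  qed
  have "a \<le> (pd_norm f)\<^sup>2 * (pd_norm g)\<^sup>2"
  proof (cases "pd_norm g = 0")
    case True
    have "a = 0"
    proof (rule ccontr)
      assume "a \<noteq> 0"
      then have "a > 0" unfolding a_def by simp
      with key[of "((pd_norm f)\<^sup>2 + 1) / (2 * a)"] True show False by (simp add: field_simps)
    qed
    then show ?thesis by simp
  next
    case False
    then have g: "(pd_norm g)\<^sup>2 > 0" by simp
    have "r * a + r * a = 2 * r * a \<and> r\<^sup>2 * a * q = r * a" if "r = 1 / q" "q > 0" for q r :: real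
      using that by (simp add: power2_eq_square)
    from this[OF refl g] key[of "1 / (pd_norm g)\<^sup>2"]
    have "0 \<le> (pd_norm f)\<^sup>2 - a / (pd_norm g)\<^sup>2" by simp
    with g show ?thesis by (simp add: field_simps)
  qed
  then have "(cmod z)\<^sup>2 \<le> (pd_norm f * pd_norm g)\<^sup>2"
    by (simp add: a_def power_mult_distrib)
  then show ?thesis unfolding z_def by (rule power2_le_imp_le) simp
qed

lemma pd_norm_zero [simp]: "pd_norm 0 = 0"
  by (simp add: pd_norm_def)

lemma pd_norm_scale: "pd_norm (pd_scale c f) = cmod c * pd_norm f"
proof -
  have "pd_form (pd_scale c f) (pd_scale c f) = complex_of_real ((cmod c * pd_norm f)\<^sup>2)"
    using complex_norm_square[of c] unfolding pd_form_scale_left pd_form_scale_right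
    by (simp add: pd_form_self power_mult_distrib)
  then have "pd_norm (pd_scale c f) = \<bar>cmod c * pd_norm f\<bar>"
    unfolding pd_norm_def[of "pd_scale c f"] by (simp del: of_real_power of_real_mult)
  then show ?thesis by (simp add: abs_mult)
qed

lemma pd_norm_minus [simp]: "pd_norm (- f) = pd_norm f"
  using pd_norm_scale[of "-1" f] by (simp add: pd_scale_minus1)

lemma pd_norm_minus_commute: "pd_norm (f - g) = pd_norm (g - f)"
  by (metis minus_diff_eq pd_norm_minus)

lemma pd_norm_triangle: "pd_norm (f + g) \<le> pd_norm f + pd_norm g"
proof -
  have "(pd_norm (f + g))\<^sup>2 = Re (pd_form (f + g) (f + g))"
    by (simp add: pd_form_self del: of_real_power)
  also have "\<dots> = (pd_norm f)\<^sup>2 + Re (pd_form f g) + Re (pd_form g f) + (pd_norm g)\<^sup>2"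
    unfolding pd_form_add_left pd_form_add_right
    by (simp add: pd_form_self[of f] pd_form_self[of g] del: of_real_power)
  also have "\<dots> \<le> (pd_norm f)\<^sup>2 + pd_norm f * pd_norm g + pd_norm g * pd_norm f + (pd_norm g)\<^sup>2"
    using pd_form_Cauchy_Schwarz[of f g] pd_form_Cauchy_Schwarz[of g f]
      complex_Re_le_cmod[of "pd_form f g"] complex_Re_le_cmod[of "pd_form g f"] by linarith
  also have "\<dots> = (pd_norm f + pd_norm g)\<^sup>2" by (simp add: power2_eq_square algebra_simps)
  finally show ?thesis by (rule power2_le_imp_le) simp
qed

lemma pd_norm_triangle_diff: "pd_norm (f - h) \<le> pd_norm (f - g) + pd_norm (g - h)"
  using pd_norm_triangle[of "f - g" "g - h"] by simp

lemma pd_norm_triangle_abs: "\<bar>pd_norm f - pd_norm g\<bar> \<le> pd_norm (f - g)"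
  using pd_norm_triangle[of "f - g" g] pd_norm_triangle[of "g - f" f] pd_norm_minus_commute[of f g]
  by simp

definition pd_Cauchy :: "(nat \<Rightarrow> 'g::group_add pd_free) \<Rightarrow> bool" where
  "pd_Cauchy X \<longleftrightarrow> (\<forall>e>0. \<exists>N. \<forall>m\<ge>N. \<forall>n\<ge>N. pd_norm (X m - X n) < e)"

lemma pd_Cauchy_const: "pd_Cauchy (\<lambda>n. f)"
  by (simp add: pd_Cauchy_def)

lemma pd_Cauchy_add:
  assumes "pd_Cauchy X" "pd_Cauchy Y" shows "pd_Cauchy (\<lambda>n. X n + Y n)"
  unfolding pd_Cauchy_def
proof (intro allI impI)
  fix e :: real assume "e > 0"
  then have e: "e / 2 > 0" by simp
  obtain M where M: "\<And>m n. m \<ge> M \<Longrightarrow> n \<ge> M \<Longrightarrow> pd_norm (X m - X n) < e / 2"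
    using assms(1) e unfolding pd_Cauchy_def by meson
  obtain N where N: "\<And>m n. m \<ge> N \<Longrightarrow> n \<ge> N \<Longrightarrow> pd_norm (Y m - Y n) < e / 2"
    using assms(2) e unfolding pd_Cauchy_def by meson
  have "pd_norm (X m + Y m - (X n + Y n)) < e" if "m \<ge> max M N" "n \<ge> max M N" for m n
    using M[of m n] N[of m n] that pd_norm_triangle[of "X m - X n" "Y m - Y n"]
    by (simp add: algebra_simps)
  then show "\<exists>N. \<forall>m\<ge>N. \<forall>n\<ge>N. pd_norm (X m + Y m - (X n + Y n)) < e" by blast
qed

lemma pd_Cauchy_lipschitz:
  assumes "pd_Cauchy X" "\<And>m n. pd_norm (Y m - Y n) \<le> C * pd_norm (X m - X n)"
  shows "pd_Cauchy Y"
  unfolding pd_Cauchy_def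
proof (intro allI impI)
  fix e :: real assume e: "e > 0"
  then have "e / (\<bar>C\<bar> + 1) > 0" by simp
  then obtain N where N: "\<And>m n. m \<ge> N \<Longrightarrow> n \<ge> N \<Longrightarrow> pd_norm (X m - X n) < e / (\<bar>C\<bar> + 1)"
    using assms(1) unfolding pd_Cauchy_def by meson
  have "pd_norm (Y m - Y n) < e" if "m \<ge> N" "n \<ge> N" for m n
  proof -
    have "pd_norm (Y m - Y n) \<le> C * pd_norm (X m - X n)" by (rule assms)
    also have "\<dots> \<le> (\<bar>C\<bar> + 1) * pd_norm (X m - X n)" by (intro mult_right_mono) auto
    also have "\<dots> < e" using N[OF that] by (simp add: field_simps)
    finally show ?thesis .
  qed
  then show "\<exists>N. \<forall>m\<ge>N. \<forall>n\<ge>N. pd_norm (Y m - Y n) < e" by blast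
qed

lemma pd_Cauchy_scale: "pd_Cauchy X \<Longrightarrow> pd_Cauchy (\<lambda>n. pd_scale c (X n))"
  by (erule pd_Cauchy_lipschitz[where C = "cmod c"]) (simp add: pd_norm_scale flip: pd_scale_diff)

lemma pd_Cauchy_norm_convergent: "pd_Cauchy X \<Longrightarrow> convergent (\<lambda>n. pd_norm (X n))"
  unfolding Cauchy_convergent_iff[symmetric] Cauchy_def pd_Cauchy_def dist_real_def
  by (meson pd_norm_triangle_abs order.strict_trans1)

lemma pd_form_diff_bound:
  "cmod (pd_form f g - pd_form f' g') \<le> pd_norm (f - f') * pd_norm g + pd_norm f' * pd_norm (g - g')"
proof -
  have "pd_form f g - pd_form f' g' = pd_form (f - f') g + pd_form f' (g - g')"
    by (simp add: pd_form_diff_left pd_form_diff_right)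
  then show ?thesis
    using norm_triangle_ineq[of "pd_form (f - f') g" "pd_form f' (g - g')"]
      pd_form_Cauchy_Schwarz[of "f - f'" g] pd_form_Cauchy_Schwarz[of f' "g - g'"] by simp
qed

lemma pd_Cauchy_bounded:
  assumes "pd_Cauchy X" obtains B where "B > 0" "\<And>n. pd_norm (X n) \<le> B"
proof -
  from pd_Cauchy_norm_convergent[OF assms] have "Bseq (\<lambda>n. pd_norm (X n))"
    by (rule convergent_imp_Bseq)
  then show ?thesis using that by (auto elim!: BseqE)
qed

lemma pd_form_convergent:
  assumes "pd_Cauchy X" "pd_Cauchy Y" shows "convergent (\<lambda>n. pd_form (X n) (Y n))"
proof -
  obtain B where B: "B > 0" "\<And>n. pd_norm (X n) \<le> B" using pd_Cauchy_bounded[OF assms(1)] by blast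
  obtain C where C: "C > 0" "\<And>n. pd_norm (Y n) \<le> C" using pd_Cauchy_bounded[OF assms(2)] by blast
  have "Cauchy (\<lambda>n. pd_form (X n) (Y n))"
  proof (rule metric_CauchyI)
    fix e :: real assume "e > 0"
    then have e: "e / (2 * C) > 0" "e / (2 * B) > 0" using B C by simp_all
    obtain M where M: "\<And>m n. m \<ge> M \<Longrightarrow> n \<ge> M \<Longrightarrow> pd_norm (X m - X n) < e / (2 * C)"
      using assms(1) e unfolding pd_Cauchy_def by meson
    obtain N where N: "\<And>m n. m \<ge> N \<Longrightarrow> n \<ge> N \<Longrightarrow> pd_norm (Y m - Y n) < e / (2 * B)"
      using assms(2) e unfolding pd_Cauchy_def by meson
    have "dist (pd_form (X m) (Y m)) (pd_form (X n) (Y n)) < e"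
      if "m \<ge> max M N" "n \<ge> max M N" for m n
    proof -
      have 1: "pd_norm (X m - X n) * pd_norm (Y m) \<le> pd_norm (X m - X n) * C"
        by (rule mult_left_mono) (use C in auto)
      have 2: "pd_norm (X m - X n) * C < e / 2" using M[of m n] that C by (simp add: field_simps)
      have 3: "pd_norm (X n) * pd_norm (Y m - Y n) \<le> B * pd_norm (Y m - Y n)"
        by (rule mult_right_mono) (use B in auto)
      have 4: "B * pd_norm (Y m - Y n) < e / 2" using N[of m n] that B by (simp add: field_simps)
      from 1 2 3 4 pd_form_diff_bound[of "X m" "Y m" "X n" "Y n"] show ?thesis
        by (simp add: dist_norm)
    qed
    then show "\<exists>M. \<forall>m\<ge>M. \<forall>n\<ge>M. dist (pd_form (X m) (Y m)) (pd_form (X n) (Y n)) < e" by blast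
  qed
  then show ?thesis by (rule Cauchy_convergent)
qed

definition pd_equiv :: "(nat \<Rightarrow> 'g::group_add pd_free) \<Rightarrow> (nat \<Rightarrow> 'g pd_free) \<Rightarrow> bool" where
  "pd_equiv X Y \<longleftrightarrow> pd_Cauchy X \<and> pd_Cauchy Y \<and> (\<lambda>n. pd_norm (X n - Y n)) \<longlonglongrightarrow> 0"

lemma pd_norm_tendsto_0_mono:
  "g \<longlonglongrightarrow> 0 \<Longrightarrow> (\<And>n. pd_norm (f n) \<le> g n) \<Longrightarrow> (\<lambda>n. pd_norm (f n)) \<longlonglongrightarrow> 0"
  by (rule Lim_null_comparison) auto

quotient_type (overloaded) 'g gns_total = "nat \<Rightarrow> 'g::group_add pd_free" / partial: pd_equiv
proof (rule part_equivpI)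
  show "\<exists>x. pd_equiv x x" by (rule exI[of _ "\<lambda>n. 0"]) (simp add: pd_equiv_def pd_Cauchy_const)
  show "symp pd_equiv" by (rule sympI) (auto simp: pd_equiv_def pd_norm_minus_commute)
  show "transp pd_equiv"
  proof (rule transpI)
    fix X Y Z :: "nat \<Rightarrow> 'a pd_free" assume *: "pd_equiv X Y" "pd_equiv Y Z"
    then have "(\<lambda>n. pd_norm (X n - Y n) + pd_norm (Y n - Z n)) \<longlonglongrightarrow> 0 + 0"
      unfolding pd_equiv_def by (intro tendsto_add) auto
    then have "(\<lambda>n. pd_norm (X n - Z n)) \<longlonglongrightarrow> 0"
      by (intro pd_norm_tendsto_0_mono[of "\<lambda>n. pd_norm (X n - Y n) + pd_norm (Y n - Z n)"])
         (auto intro: pd_norm_triangle_diff)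
    with * show "pd_equiv X Z" by (simp add: pd_equiv_def)
  qed
qed

lemma pd_equiv_lipschitz:
  assumes "pd_equiv X Y" "pd_Cauchy X'" "pd_Cauchy Y'"
    "\<And>n. pd_norm (X' n - Y' n) \<le> C * pd_norm (X n - Y n)"
  shows "pd_equiv X' Y'"
proof -
  have "(\<lambda>n. C * pd_norm (X n - Y n)) \<longlonglongrightarrow> C * 0"
    using assms(1) unfolding pd_equiv_def by (intro tendsto_mult) auto
  then have "(\<lambda>n. pd_norm (X' n - Y' n)) \<longlonglongrightarrow> 0"
    by (intro pd_norm_tendsto_0_mono[of "\<lambda>n. C * pd_norm (X n - Y n)"]) (auto simp: assms(4))
  with assms show ?thesis by (simp add: pd_equiv_def)
qed

lemma pd_equiv_add:
  assumes "pd_equiv X X'" "pd_equiv Y Y'"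
  shows "pd_equiv (\<lambda>n. X n + Y n) (\<lambda>n. X' n + Y' n)"
proof -
  have "(\<lambda>n. pd_norm (X n - X' n) + pd_norm (Y n - Y' n)) \<longlonglongrightarrow> 0 + 0"
    using assms unfolding pd_equiv_def by (intro tendsto_add) auto
  moreover have "pd_norm (X n + Y n - (X' n + Y' n)) \<le> pd_norm (X n - X' n) + pd_norm (Y n - Y' n)" for n
    using pd_norm_triangle[of "X n - X' n" "Y n - Y' n"] by (simp add: algebra_simps)
  ultimately have "(\<lambda>n. pd_norm (X n + Y n - (X' n + Y' n))) \<longlonglongrightarrow> 0"
    by (intro pd_norm_tendsto_0_mono[of "\<lambda>n. pd_norm (X n - X' n) + pd_norm (Y n - Y' n)"]) auto
  with assms show ?thesis by (simp add: pd_equiv_def pd_Cauchy_add)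
qed

lemma pd_equiv_scale: "pd_equiv X Y \<Longrightarrow> pd_equiv (\<lambda>n. pd_scale c (X n)) (\<lambda>n. pd_scale c (Y n))"
  by (rule pd_equiv_lipschitz[where C = "cmod c"])
     (auto simp: pd_equiv_def pd_Cauchy_scale pd_norm_scale simp flip: pd_scale_diff)

lemma pd_equiv_form:
  assumes "pd_equiv X X'" "pd_equiv Y Y'"
  shows "lim (\<lambda>n. pd_form (X n) (Y n)) = lim (\<lambda>n. pd_form (X' n) (Y' n))"
proof -
  have c: "pd_Cauchy X" "pd_Cauchy X'" "pd_Cauchy Y" "pd_Cauchy Y'"
    using assms by (auto simp: pd_equiv_def)
  obtain B where B: "B > 0" "\<And>n. pd_norm (X' n) \<le> B" using pd_Cauchy_bounded[OF c(2)] by blast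
  obtain C where C: "C > 0" "\<And>n. pd_norm (Y n) \<le> C" using pd_Cauchy_bounded[OF c(3)] by blast
  have "(\<lambda>n. pd_norm (X n - X' n) * C + B * pd_norm (Y n - Y' n)) \<longlonglongrightarrow> 0 * C + B * 0"
    using assms unfolding pd_equiv_def by (intro tendsto_intros) auto
  then have lim: "(\<lambda>n. pd_norm (X n - X' n) * C + B * pd_norm (Y n - Y' n)) \<longlonglongrightarrow> 0"
    by simp
  have bound: "cmod (pd_form (X n) (Y n) - pd_form (X' n) (Y' n))
        \<le> pd_norm (X n - X' n) * C + B * pd_norm (Y n - Y' n)" for n
  proof -
    have "pd_norm (X n - X' n) * pd_norm (Y n) \<le> pd_norm (X n - X' n) * C"
      by (rule mult_left_mono) (use C in auto)
    moreover have "pd_norm (X' n) * pd_norm (Y n - Y' n) \<le> B * pd_norm (Y n - Y' n)"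
      by (rule mult_right_mono) (use B in auto)
    ultimately show ?thesis
      using pd_form_diff_bound[of "X n" "Y n" "X' n" "Y' n"] by linarith
  qed
  have "(\<lambda>n. pd_form (X n) (Y n) - pd_form (X' n) (Y' n)) \<longlonglongrightarrow> 0"
    by (rule Lim_null_comparison[OF always_eventually lim]) (use bound in blast)
  moreover have "(\<lambda>n. pd_form (X' n) (Y' n)) \<longlonglongrightarrow> lim (\<lambda>n. pd_form (X' n) (Y' n))"
    using pd_form_convergent[OF c(2) c(4)] by (simp add: convergent_LIMSEQ_iff)
  ultimately have "(\<lambda>n. pd_form (X n) (Y n)) \<longlonglongrightarrow> lim (\<lambda>n. pd_form (X' n) (Y' n))"
    by (metis Lim_transform)
  then show ?thesis by (rule limI)
qed

instantiation gns_total :: (group_add) real_vector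
begin

lift_definition zero_gns_total :: "'a gns_total" is "\<lambda>n. 0"
  by (simp add: pd_equiv_def pd_Cauchy_const)

lift_definition plus_gns_total :: "'a gns_total \<Rightarrow> 'a gns_total \<Rightarrow> 'a gns_total"
  is "\<lambda>X Y n. X n + Y n" by (rule pd_equiv_add)

lift_definition uminus_gns_total :: "'a gns_total \<Rightarrow> 'a gns_total"
  is "\<lambda>X n. pd_scale (-1) (X n)" by (rule pd_equiv_scale)

lift_definition minus_gns_total :: "'a gns_total \<Rightarrow> 'a gns_total \<Rightarrow> 'a gns_total"
  is "\<lambda>X Y n. X n + pd_scale (-1) (Y n)" by (intro pd_equiv_add pd_equiv_scale)

lift_definition scaleR_gns_total :: "real \<Rightarrow> 'a gns_total \<Rightarrow> 'a gns_total"
  is "\<lambda>r X n. pd_scale (complex_of_real r) (X n)" by (rule pd_equiv_scale)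

lemma pd_equiv_refl: "pd_Cauchy X \<Longrightarrow> pd_equiv X X" by (simp add: pd_equiv_def)

instance
proof
  fix x y z :: "'a gns_total" and a b :: real
  show "x + y + z = x + (y + z)"
    by transfer (simp add: add.assoc pd_equiv_def pd_Cauchy_add)
  show "x + y = y + x"
    by transfer (simp add: add.commute pd_equiv_def pd_Cauchy_add)
  show "0 + x = x" by transfer simp
  show "- x + x = 0" by transfer (simp add: pd_scale_minus1 pd_equiv_def pd_Cauchy_const)
  show "x - y = x + - y" by transfer (intro pd_equiv_add pd_equiv_scale)
  show "a *\<^sub>R (x + y) = a *\<^sub>R x + a *\<^sub>R y"
    by transfer (simp add: pd_scale_add pd_equiv_refl pd_Cauchy_add pd_Cauchy_scale pd_equiv_def)
  show "(a + b) *\<^sub>R x = a *\<^sub>R x + b *\<^sub>R x"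
    by transfer (simp add: pd_scale_add_left pd_equiv_refl pd_Cauchy_add pd_Cauchy_scale pd_equiv_def)
  show "a *\<^sub>R b *\<^sub>R x = (a * b) *\<^sub>R x"
    by transfer (simp add: pd_scale_scale pd_equiv_refl pd_Cauchy_add pd_Cauchy_scale pd_equiv_def)
  show "1 *\<^sub>R x = x" by transfer simp
qed

end

lift_definition gns_scaleC :: "complex \<Rightarrow> 'g::group_add gns_total \<Rightarrow> 'g gns_total"
  is "\<lambda>c X n. pd_scale c (X n)" by (rule pd_equiv_scale)

lift_definition gns_cinner :: "'g::group_add gns_total \<Rightarrow> 'g gns_total \<Rightarrow> complex"
  is "\<lambda>X Y. lim (\<lambda>n. pd_form (X n) (Y n))" by (rule pd_equiv_form)

lemma pd_form_lim:
  "pd_Cauchy X \<Longrightarrow> pd_Cauchy Y \<Longrightarrow> (\<lambda>n. pd_form (X n) (Y n)) \<longlonglongrightarrow> lim (\<lambda>n. pd_form (X n) (Y n))"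
  by (simp add: pd_form_convergent flip: convergent_LIMSEQ_iff)

lemma gns_cinner_add_left: "gns_cinner (x + y) z = gns_cinner x z + gns_cinner y z"
proof (transfer, rule limI)
  fix X Y Z :: "nat \<Rightarrow> 'a pd_free"
  assume "pd_equiv X X" "pd_equiv Y Y" "pd_equiv Z Z"
  then show "(\<lambda>n. pd_form (X n + Y n) (Z n)) \<longlonglongrightarrow>
      lim (\<lambda>n. pd_form (X n) (Z n)) + lim (\<lambda>n. pd_form (Y n) (Z n))"
    unfolding pd_form_add_left by (intro tendsto_add pd_form_lim) (auto simp: pd_equiv_def)
qed

lemma gns_cinner_scale_left: "gns_cinner (gns_scaleC a x) y = a * gns_cinner x y"
proof (transfer, rule limI)
  fix X Y :: "nat \<Rightarrow> 'a pd_free" and a :: complex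
  assume "pd_equiv X X" "pd_equiv Y Y"
  then show "(\<lambda>n. pd_form (pd_scale a (X n)) (Y n)) \<longlonglongrightarrow> a * lim (\<lambda>n. pd_form (X n) (Y n))"
    unfolding pd_form_scale_left by (intro tendsto_intros pd_form_lim) (auto simp: pd_equiv_def)
qed

lemma gns_cinner_commute: "gns_cinner x y = cnj (gns_cinner y x)"
proof (transfer, rule limI)
  fix X Y :: "nat \<Rightarrow> 'a pd_free"
  assume *: "pd_equiv X X" "pd_equiv Y Y"
  have "(\<lambda>n. cnj (pd_form (Y n) (X n))) \<longlonglongrightarrow> cnj (lim (\<lambda>n. pd_form (Y n) (X n)))"
    by (intro tendsto_cnj pd_form_lim) (use * in \<open>auto simp: pd_equiv_def\<close>)
  then show "(\<lambda>n. pd_form (X n) (Y n)) \<longlonglongrightarrow> cnj (lim (\<lambda>n. pd_form (Y n) (X n)))"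
    by (subst pd_form_commute)
qed

lift_definition gns_norm :: "'g::group_add gns_total \<Rightarrow> real"
  is "\<lambda>X. sqrt (Re (lim (\<lambda>n. pd_form (X n) (X n))))"
  using pd_equiv_form by metis

lemma pd_norm_lim:
  assumes "pd_Cauchy X"
  shows "(\<lambda>n. pd_norm (X n)) \<longlonglongrightarrow> sqrt (Re (lim (\<lambda>n. pd_form (X n) (X n))))"
  unfolding pd_norm_def by (intro tendsto_intros pd_form_lim assms)

lemma gns_cinner_self: "gns_cinner x x = complex_of_real ((gns_norm x)\<^sup>2)"
proof transfer
  fix X :: "nat \<Rightarrow> 'a pd_free" assume "pd_equiv X X"
  then have c: "pd_Cauchy X" by (simp add: pd_equiv_def)
  have "(\<lambda>n. pd_form (X n) (X n)) \<longlonglongrightarrow> complex_of_real ((sqrt (Re (lim (\<lambda>n. pd_form (X n) (X n)))))\<^sup>2)"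
    unfolding pd_form_self using pd_norm_lim[OF c] unfolding pd_form_self by (intro tendsto_intros)
  then show "lim (\<lambda>n. pd_form (X n) (X n)) = complex_of_real ((sqrt (Re (lim (\<lambda>n. pd_form (X n) (X n)))))\<^sup>2)"
    by (rule limI)
qed

instantiation gns_total :: (group_add) real_normed_vector
begin

definition norm_gns_total :: "'a gns_total \<Rightarrow> real" where
  "norm_gns_total = gns_norm"

definition dist_gns_total :: "'a gns_total \<Rightarrow> 'a gns_total \<Rightarrow> real" where
  "dist_gns_total x y = norm (x - y)"

definition sgn_gns_total :: "'a gns_total \<Rightarrow> 'a gns_total" where
  "sgn_gns_total x = x /\<^sub>R norm x"

definition uniformity_gns_total :: "('a gns_total \<times> 'a gns_total) filter" where
  "uniformity_gns_total = (INF e\<in>{0 <..}. principal {(x, y). dist x y < e})"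

definition open_gns_total :: "'a gns_total set \<Rightarrow> bool" where
  "open_gns_total U \<longleftrightarrow> (\<forall>x\<in>U. eventually (\<lambda>(x', y). x' = x \<longrightarrow> y \<in> U) uniformity)"

instance
proof
  fix x y :: "'a gns_total" and a :: real
  show "dist x y = norm (x - y)" by (rule dist_gns_total_def)
  show "sgn x = x /\<^sub>R norm x" by (rule sgn_gns_total_def)
  show "uniformity = (INF e\<in>{0 <..}. principal {(x :: 'a gns_total, y). dist x y < e})"
    by (rule uniformity_gns_total_def)
  show "open U \<longleftrightarrow> (\<forall>x\<in>U. \<forall>\<^sub>F (x', y) in uniformity. x' = x \<longrightarrow> y \<in> U)" for U :: "'a gns_total set"
    by (rule open_gns_total_def)
  show "(norm x = 0) = (x = 0)"
    unfolding norm_gns_total_def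
  proof transfer
    fix X :: "nat \<Rightarrow> 'a pd_free" assume "pd_equiv X X"
    then have c: "pd_Cauchy X" by (simp add: pd_equiv_def)
    show "(sqrt (Re (lim (\<lambda>n. pd_form (X n) (X n)))) = 0) = pd_equiv X (\<lambda>n. 0)"
      using pd_norm_lim[OF c] LIMSEQ_unique[OF pd_norm_lim[OF c], of 0]
      unfolding pd_equiv_def by (auto simp: c pd_Cauchy_const)
  qed
  show "norm (x + y) \<le> norm x + norm y"
    unfolding norm_gns_total_def
  proof transfer
    fix X Y :: "nat \<Rightarrow> 'a pd_free" assume "pd_equiv X X" "pd_equiv Y Y"
    then have c: "pd_Cauchy X" "pd_Cauchy Y" by (simp_all add: pd_equiv_def)
    show "sqrt (Re (lim (\<lambda>n. pd_form (X n + Y n) (X n + Y n)))) \<le>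
      sqrt (Re (lim (\<lambda>n. pd_form (X n) (X n)))) + sqrt (Re (lim (\<lambda>n. pd_form (Y n) (Y n))))"
      by (rule LIMSEQ_le[OF pd_norm_lim[OF pd_Cauchy_add[OF c]]
            tendsto_add[OF pd_norm_lim[OF c(1)] pd_norm_lim[OF c(2)]]])
         (auto intro: pd_norm_triangle)
  qed
  show "norm (a *\<^sub>R x) = \<bar>a\<bar> * norm x"
    unfolding norm_gns_total_def
  proof transfer
    fix X :: "nat \<Rightarrow> 'a pd_free" and a assume "pd_equiv X X"
    then have c: "pd_Cauchy X" by (simp add: pd_equiv_def)
    have "(\<lambda>n. pd_norm (pd_scale (complex_of_real a) (X n))) \<longlonglongrightarrow> \<bar>a\<bar> * sqrt (Re (lim (\<lambda>n. pd_form (X n) (X n))))"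
      unfolding pd_norm_scale norm_of_real by (intro tendsto_intros pd_norm_lim c)
    with pd_norm_lim[OF pd_Cauchy_scale[OF c]]
    show "sqrt (Re (lim (\<lambda>n. pd_form (pd_scale (complex_of_real a) (X n)) (pd_scale (complex_of_real a) (X n)))))
       = \<bar>a\<bar> * sqrt (Re (lim (\<lambda>n. pd_form (X n) (X n))))"
      by (rule LIMSEQ_unique)
  qed
qed

end

definition gns_embed :: "'g::group_add pd_free \<Rightarrow> 'g gns_total" where
  "gns_embed f = abs_gns_total (\<lambda>n. f)"

lemma gns_embed_diff: "gns_embed (f - g) = gns_embed f - gns_embed g"
  by (simp add: gns_embed_def minus_gns_total.abs_eq pd_equiv_refl pd_Cauchy_const pd_scale_minus1)

lemma norm_gns_embed: "norm (gns_embed f) = pd_norm f"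
  by (simp add: norm_gns_total_def gns_embed_def gns_norm.abs_eq pd_equiv_refl pd_Cauchy_const pd_norm_def)

lemma gns_embed_approx:
  assumes "pd_Cauchy X"
  shows "(\<lambda>n. norm (abs_gns_total X - gns_embed (X n))) \<longlonglongrightarrow> 0"
proof (rule LIMSEQ_I)
  fix e :: real assume "e > 0"
  then have "e / 2 > 0" by simp
  then obtain N where N: "\<And>m n. m \<ge> N \<Longrightarrow> n \<ge> N \<Longrightarrow> pd_norm (X m - X n) < e / 2"
    using assms unfolding pd_Cauchy_def by meson
  have "norm (abs_gns_total X - gns_embed (X n)) < e" if "n \<ge> N" for n
  proof -
    have c: "pd_Cauchy (\<lambda>m. X m + pd_scale (-1) (X n))"
      by (rule pd_Cauchy_lipschitz[OF assms, where C = 1]) simp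
    have eq: "abs_gns_total X - gns_embed (X n) = abs_gns_total (\<lambda>m. X m + pd_scale (-1) (X n))"
      unfolding gns_embed_def
      using assms by (simp add: minus_gns_total.abs_eq pd_equiv_refl pd_Cauchy_const)
    have "norm (abs_gns_total X - gns_embed (X n))
        = sqrt (Re (lim (\<lambda>m. pd_form (X m + pd_scale (-1) (X n)) (X m + pd_scale (-1) (X n)))))"
      unfolding eq norm_gns_total_def using c by (simp add: gns_norm.abs_eq pd_equiv_refl)
    moreover have "\<dots> \<le> e / 2"
      by (rule LIMSEQ_le_const2[OF pd_norm_lim[OF c]])
         (use N[of _ n] that in \<open>auto simp: pd_scale_minus1 intro!: exI[of _ N] less_imp_le\<close>)
    ultimately show ?thesis using \<open>e > 0\<close> by simp
  qed
  then show "\<exists>N. \<forall>n\<ge>N. norm (norm (abs_gns_total X - gns_embed (X n)) - 0) < e" by auto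
qed

lemma gns_embed_dense: assumes "e > 0" obtains f where "norm (x - gns_embed f) < e"
proof -
  obtain X where X: "pd_Cauchy X" "x = abs_gns_total X"
    using Quotient_abs_rep[OF Quotient_gns_total, of x] Quotient_rep_reflp[OF Quotient_gns_total, of x]
    unfolding pd_equiv_def by metis
  from LIMSEQ_D[OF gns_embed_approx[OF X(1)] assms] X(2) that show thesis by force
qed

instance gns_total :: (group_add) banach
proof
  fix x :: "nat \<Rightarrow> 'a gns_total" assume "Cauchy x"
  have "\<forall>n. \<exists>f. norm (x n - gns_embed f) < inverse (Suc n)"
    by (metis gns_embed_dense inverse_positive_iff_positive of_nat_0_less_iff zero_less_Suc)
  then obtain f where f: "\<And>n. norm (x n - gns_embed (f n)) < inverse (Suc n)" by metis
  have lim: "(\<lambda>n. norm (x n - gns_embed (f n))) \<longlonglongrightarrow> 0"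
    by (rule Lim_null_comparison[OF always_eventually LIMSEQ_inverse_real_of_nat])
       (use f in \<open>auto intro: less_imp_le\<close>)
  then have lim0: "(\<lambda>n. gns_embed (f n) - x n) \<longlonglongrightarrow> 0"
    using tendsto_minus[of "\<lambda>n. x n - gns_embed (f n)" 0] by (simp add: tendsto_norm_zero_iff)
  have "Cauchy (\<lambda>n. gns_embed (f n))"
  proof (rule metric_CauchyI)
    fix e :: real assume "e > 0"
    then have e: "e / 3 > 0" by simp
    obtain M where M: "\<And>m n. m \<ge> M \<Longrightarrow> n \<ge> M \<Longrightarrow> dist (x m) (x n) < e / 3"
      using metric_CauchyD[OF \<open>Cauchy x\<close> e] by blast
    obtain N where N: "\<And>n. n \<ge> N \<Longrightarrow> norm (gns_embed (f n) - x n) < e / 3"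
      using LIMSEQ_D[OF lim0 e] by auto
    have "dist (gns_embed (f m)) (gns_embed (f n)) < e" if "m \<ge> max M N" "n \<ge> max M N" for m n
    proof -
      have "dist (gns_embed (f m)) (gns_embed (f n)) \<le>
          dist (gns_embed (f m)) (x m) + dist (x m) (x n) + dist (x n) (gns_embed (f n))"
        by metric
      with M[of m n] N[of m] N[of n] that show ?thesis
        by (simp add: dist_norm norm_minus_commute[of "x n"])
    qed
    then show "\<exists>M. \<forall>m\<ge>M. \<forall>n\<ge>M. dist (gns_embed (f m)) (gns_embed (f n)) < e" by blast
  qed
  then have c: "pd_Cauchy f"
    by (simp add: Cauchy_def pd_Cauchy_def dist_norm norm_gns_embed flip: gns_embed_diff)
  have "(\<lambda>n. gns_embed (f n)) \<longlonglongrightarrow> abs_gns_total f"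
    using gns_embed_approx[OF c] unfolding norm_minus_commute[of "abs_gns_total f"]
    by (rule LIM_zero_cancel[OF tendsto_norm_zero_cancel])
  from tendsto_diff[OF this lim0] have "x \<longlonglongrightarrow> abs_gns_total f" by simp
  then show "convergent x" by (auto simp: convergent_def)
qed

instantiation gns_total :: (group_add) complex_hilbert
begin

definition scaleC_gns_total :: "complex \<Rightarrow> 'a gns_total \<Rightarrow> 'a gns_total" where
  "scaleC_gns_total = gns_scaleC"

definition cinner_gns_total :: "'a gns_total \<Rightarrow> 'a gns_total \<Rightarrow> complex" where
  "cinner_gns_total = gns_cinner"

instance
proof
  fix x y z :: "'a gns_total" and a b :: complex and r :: real
  show "complex_of_real r *\<^sub>C x = r *\<^sub>R x"
    unfolding scaleC_gns_total_def by transfer (rule pd_equiv_scale)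
  show "a *\<^sub>C (x + y) = a *\<^sub>C x + a *\<^sub>C y"
    unfolding scaleC_gns_total_def
    by transfer (simp add: pd_scale_add pd_Cauchy_add pd_Cauchy_scale pd_equiv_def)
  show "(a + b) *\<^sub>C x = a *\<^sub>C x + b *\<^sub>C x"
    unfolding scaleC_gns_total_def
    by transfer (simp add: pd_scale_add_left pd_Cauchy_add pd_Cauchy_scale pd_equiv_def)
  show "a *\<^sub>C b *\<^sub>C x = (a * b) *\<^sub>C x"
    unfolding scaleC_gns_total_def
    by transfer (simp add: pd_scale_scale pd_Cauchy_add pd_Cauchy_scale pd_equiv_def)
  show "cinner (x + y) z = cinner x z + cinner y z"
    unfolding cinner_gns_total_def by (rule gns_cinner_add_left)
  show "cinner (a *\<^sub>C x) y = a * cinner x y"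
    unfolding cinner_gns_total_def scaleC_gns_total_def by (rule gns_cinner_scale_left)
  show "cinner x y = cnj (cinner y x)"
    unfolding cinner_gns_total_def by (rule gns_cinner_commute)
  show "cinner x x = complex_of_real ((norm x)\<^sup>2)"
    unfolding cinner_gns_total_def norm_gns_total_def by (rule gns_cinner_self)
qed

end


lemma cinner_gns_embed: "cinner (gns_embed f) (gns_embed g) = pd_form f g"
  by (simp add: cinner_gns_total_def gns_embed_def gns_cinner.abs_eq pd_equiv_refl pd_Cauchy_const)

text \<open>\<open>gns_vec u s\<close> is the class of $\delta_s$ in $\mathcal{H}_u$; in particular \<open>gns_vec u 0\<close> is the
  cyclic vector.\<close>

definition gns_vec :: "('g::group_add \<Rightarrow> complex) \<Rightarrow> 'g \<Rightarrow> 'g gns_total" where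
  "gns_vec u s = gns_embed (Poly_Mapping.single (u, s) 1)"

lemma cinner_gns_vec:
  "cinner (gns_vec u s) (gns_vec v t) = (if u = v \<and> pos_def u then u (- t + s) else 0)"
  by (auto simp: gns_vec_def cinner_gns_embed pd_form_def pd_kernel_def)

definition pd_shift :: "'g::group_add \<Rightarrow> 'g pd_free \<Rightarrow> 'g pd_free" where
  "pd_shift t f = Poly_Mapping.map_key (\<lambda>(u, s). (u, - t + s)) f"

lemma inj_shift: "inj (\<lambda>(u :: 'g \<Rightarrow> complex, s :: 'g::group_add). (u, - t + s))"
  by (auto simp: inj_def)

lemma lookup_pd_shift [simp]: "Poly_Mapping.lookup (pd_shift t f) (u, s) = Poly_Mapping.lookup f (u, - t + s)"
  by (simp add: pd_shift_def map_key.rep_eq[OF inj_shift])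

lemma keys_pd_shift: "Poly_Mapping.keys (pd_shift t f) = (\<lambda>(u, s). (u, t + s)) ` Poly_Mapping.keys f"
  by (force simp: in_keys_iff image_iff)

lemma pd_shift_diff: "pd_shift t (f - g) = pd_shift t f - pd_shift t g"
  by (rule poly_mapping_eqI) (auto simp: lookup_minus)

lemma pd_form_shift: "pd_form (pd_shift t f) (pd_shift t g) = pd_form f g"
proof -
  let ?h = "\<lambda>(u :: 'a \<Rightarrow> complex, s). (u, t + s)"
  have inj: "inj_on ?h A" for A by (auto simp: inj_on_def)
  have k: "pd_kernel (?h a) (?h b) = pd_kernel a b" for a b
  proof -
    have "- (t + y) + (t + x) = - y + x" for x y :: 'a
    proof -
      have "- (t + y) + (t + x) = - y + ((- t + t) + x)"
        unfolding minus_add by (simp only: add.assoc)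
      then show ?thesis by simp
    qed
    then show ?thesis by (auto simp: pd_kernel_def split: prod.splits)
  qed
  have l: "Poly_Mapping.lookup (pd_shift t f) (?h a) = Poly_Mapping.lookup f a" for a f
    by (auto simp: add.assoc[symmetric] split: prod.splits)
  show ?thesis
    unfolding pd_form_def keys_pd_shift sum.reindex[OF inj] by (simp only: o_def k l)
qed

lemma pd_norm_shift: "pd_norm (pd_shift t f) = pd_norm f"
  by (simp add: pd_norm_def pd_form_shift)

lemma pd_Cauchy_shift: "pd_Cauchy X \<Longrightarrow> pd_Cauchy (\<lambda>n. pd_shift t (X n))"
  by (erule pd_Cauchy_lipschitz[where C = 1]) (simp add: pd_norm_shift flip: pd_shift_diff)

lift_definition gns_shift :: "'g::group_add \<Rightarrow> 'g gns_total \<Rightarrow> 'g gns_total"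
  is "\<lambda>t X n. pd_shift t (X n)"
  by (simp add: pd_equiv_def pd_Cauchy_shift pd_norm_shift flip: pd_shift_diff)

lemma gns_shift_vec: "gns_shift t (gns_vec u s) = gns_vec u (t + s)"
proof -
  have "pd_shift t (Poly_Mapping.single (u, s) 1) = Poly_Mapping.single (u, t + s) 1"
    by (rule poly_mapping_eqI)
       (auto simp: lookup_single when_def add.assoc[symmetric] split: prod.splits if_splits)
  then show ?thesis
    by (simp add: gns_vec_def gns_embed_def gns_shift.abs_eq pd_equiv_refl pd_Cauchy_const)
qed

lemma gns_coefficient:
  "pos_def u \<Longrightarrow> cinner (gns_shift s (gns_vec u 0)) (gns_vec u 0) = u s"
  by (simp add: gns_shift_vec cinner_gns_vec)

lemma cinner_gns_shift: "cinner (gns_shift t x) (gns_shift t y) = cinner x y"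
  unfolding cinner_gns_total_def
  by transfer (simp add: pd_form_shift)


section \<open>Operators on closed subspaces\<close>

text \<open>A Hilbert space is a closed subspace \<open>K\<close> of a type of class \<open>complex_hilbert\<close>. An operator on \<open>K\<close>
  is a function on the whole type with junk value \<open>0\<close> outside \<open>K\<close>; with this convention operators
  are determined by their values on \<open>K\<close> and are composed by \<open>\<circ>\<close>.\<close>

definition csubspace :: "'h::complex_hilbert set \<Rightarrow> bool" where
  "csubspace K \<longleftrightarrow> 0 \<in> K \<and> (\<forall>x\<in>K. \<forall>y\<in>K. x + y \<in> K) \<and> (\<forall>c. \<forall>x\<in>K. c *\<^sub>C x \<in> K)"

definition closed_cspan :: "'h::complex_hilbert set \<Rightarrow> 'h set" where
  "closed_cspan A = \<Inter>{K. csubspace K \<and> closed K \<and> A \<subseteq> K}"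

definition op_restrict :: "'h::complex_hilbert set \<Rightarrow> ('h \<Rightarrow> 'h) \<Rightarrow> 'h \<Rightarrow> 'h" where
  "op_restrict K T = (\<lambda>x. if x \<in> K then T x else 0)"

definition op_id :: "'h::complex_hilbert set \<Rightarrow> 'h \<Rightarrow> 'h" where
  "op_id K = op_restrict K (\<lambda>x. x)"

definition bounded_ops :: "'h::complex_hilbert set \<Rightarrow> ('h \<Rightarrow> 'h) set" where
  "bounded_ops K = {T. (\<forall>x\<in>K. T x \<in> K) \<and> (\<forall>x. x \<notin> K \<longrightarrow> T x = 0) \<and>
     (\<forall>x\<in>K. \<forall>y\<in>K. T (x + y) = T x + T y) \<and> (\<forall>c. \<forall>x\<in>K. T (c *\<^sub>C x) = c *\<^sub>C T x) \<and>
     (\<exists>C. \<forall>x\<in>K. norm (T x) \<le> C * norm x)}"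

definition is_adjoint :: "'h::complex_hilbert set \<Rightarrow> ('h \<Rightarrow> 'h) \<Rightarrow> ('h \<Rightarrow> 'h) \<Rightarrow> bool" where
  "is_adjoint K S T \<longleftrightarrow> (\<forall>x\<in>K. \<forall>y\<in>K. cinner (S x) y = cinner x (T y))"

definition commutant :: "'h::complex_hilbert set \<Rightarrow> ('h \<Rightarrow> 'h) set \<Rightarrow> ('h \<Rightarrow> 'h) set" where
  "commutant K A = {T \<in> bounded_ops K. \<forall>S\<in>A. T \<circ> S = S \<circ> T}"

definition initial_topology :: "'a set \<Rightarrow> ('a \<Rightarrow> 'b::topological_space) set \<Rightarrow> 'a topology" where
  "initial_topology X F =
     topology_generated_by (insert X {f -` U \<inter> X | f U. f \<in> F \<and> open U})"

definition weak_op_topology :: "'h::complex_hilbert set \<Rightarrow> ('h \<Rightarrow> 'h) topology" where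
  "weak_op_topology K =
     initial_topology (bounded_ops K) {\<lambda>T. cinner (T x) y | x y. x \<in> K \<and> y \<in> K}"

definition ultraweak_topology :: "'h::complex_hilbert set \<Rightarrow> ('h \<Rightarrow> 'h) topology" where
  "ultraweak_topology K =
     initial_topology (bounded_ops K)
       {\<lambda>T. suminf (\<lambda>n. cinner (T (x n)) (y n)) | x y :: nat \<Rightarrow> 'h.
          range x \<subseteq> K \<and> range y \<subseteq> K \<and>
          summable (\<lambda>n. (norm (x n))\<^sup>2) \<and> summable (\<lambda>n. (norm (y n))\<^sup>2)}"

section \<open>Group topologies and unitary representations\<close>

definition group_topology :: "'g::group_add topology \<Rightarrow> bool" where
  "group_topology \<tau> \<longleftrightarrow> topspace \<tau> = UNIV \<and>
     continuous_map (prod_topology \<tau> \<tau>) \<tau> (\<lambda>(s, t). s + t) \<and> continuous_map \<tau> \<tau> uminus"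

definition cont_pos_def :: "'g::group_add topology \<Rightarrow> ('g \<Rightarrow> complex) set" where
  "cont_pos_def \<tau> = {u. pos_def u \<and> continuous_map \<tau> euclidean u}"

definition unitary_topologies :: "'g::group_add topology \<Rightarrow> 'g topology set" where
  "unitary_topologies \<tau>G = {\<tau>. group_topology \<tau> \<and> (\<forall>U. openin \<tau> U \<longrightarrow> openin \<tau>G U) \<and>
     \<tau> = initial_topology UNIV (cont_pos_def \<tau>)}"

definition unitarizable :: "'g::group_add topology \<Rightarrow> bool" where
  "unitarizable \<tau>G \<longleftrightarrow>
     group_topology \<tau>G \<and> Hausdorff_space \<tau>G \<and> \<tau>G \<in> unitary_topologies \<tau>G"

definition unitary_rep ::
    "'g::group_add topology \<Rightarrow> 'h::complex_hilbert set \<Rightarrow> ('g \<Rightarrow> 'h \<Rightarrow> 'h) \<Rightarrow> bool" where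
  "unitary_rep \<tau> K \<pi> \<longleftrightarrow> csubspace K \<and> closed K \<and> range \<pi> \<subseteq> bounded_ops K \<and>
     \<pi> 0 = op_id K \<and> (\<forall>s t. \<pi> (s + t) = \<pi> s \<circ> \<pi> t) \<and>
     (\<forall>s. \<forall>x\<in>K. \<forall>y\<in>K. cinner (\<pi> s x) (\<pi> s y) = cinner x y) \<and>
     continuous_map \<tau> (weak_op_topology K) \<pi>"

definition cont_subrep ::
    "'g::group_add topology \<Rightarrow> 'h::complex_hilbert set \<Rightarrow> ('g \<Rightarrow> 'h \<Rightarrow> 'h) \<Rightarrow> 'h set \<Rightarrow> bool" where
  "cont_subrep \<tau> K \<pi> L \<longleftrightarrow>
     L \<subseteq> K \<and> L \<noteq> {0} \<and> unitary_rep \<tau> L (\<lambda>s. op_restrict L (\<pi> s))"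

definition coefficient :: "('g \<Rightarrow> 'h::complex_hilbert \<Rightarrow> 'h) \<Rightarrow> 'h \<Rightarrow> 'h \<Rightarrow> 'g \<Rightarrow> complex" where
  "coefficient \<pi> \<xi> \<eta> = (\<lambda>s. cinner (\<pi> s \<xi>) \<eta>)"

section \<open>The universal representation and its compactification\<close>

definition gns_space :: "('g::group_add \<Rightarrow> complex) \<Rightarrow> 'g gns_total set" where
  "gns_space u = closed_cspan (range (gns_vec u))"

text \<open>The spaces \<open>gns_space u\<close> are mutually orthogonal, so \<open>univ_space \<tau>\<close> is the $\ell^2$-direct sum
  of the \<open>gns_space u\<close> over the \<open>\<tau>\<close>-continuous positive definite \<open>u\<close>, and \<open>univ_rep \<tau>\<close> is
  $\varpi_\tau$. For \<open>\<tau>\<close> coarser than \<open>\<tau>G\<close> it is a subrepresentation of \<open>univ_rep \<tau>G\<close>.\<close>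

definition univ_space :: "'g::group_add topology \<Rightarrow> 'g gns_total set" where
  "univ_space \<tau> = closed_cspan (\<Union>u\<in>cont_pos_def \<tau>. gns_space u)"

definition univ_rep :: "'g::group_add topology \<Rightarrow> 'g \<Rightarrow> 'g gns_total \<Rightarrow> 'g gns_total" where
  "univ_rep \<tau> s = op_restrict (univ_space \<tau>) (gns_shift s)"

definition univ_cpt :: "'g::group_add topology \<Rightarrow> ('g gns_total \<Rightarrow> 'g gns_total) set" where
  "univ_cpt \<tau> = weak_op_topology (univ_space \<tau>) closure_of range (univ_rep \<tau>)"

definition univ_cpt_topology :: "'g::group_add topology \<Rightarrow> ('g gns_total \<Rightarrow> 'g gns_total) topology" where
  "univ_cpt_topology \<tau> = subtopology (weak_op_topology (univ_space \<tau>)) (univ_cpt \<tau>)"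

text \<open>In the usual notation, \<open>univ_cpt \<tau>\<close> is $G^{\varpi_\tau}$, \<open>central_idempotents \<tau>G\<close> is
  $\mathrm{ZE}(G^\varpi)$, \<open>idempotent_topology \<tau>G\<close> is $T_u$, \<open>univ_extension \<tau>G \<tau>\<close> is the
  continuous extension $\tilde\varpi_\tau$ and \<open>topology_idempotent \<tau>G \<tau>\<close> is $P(\tau)$.\<close>

definition central_idempotents :: "'g::group_add topology \<Rightarrow> ('g gns_total \<Rightarrow> 'g gns_total) set" where
  "central_idempotents \<tau>G =
     {p \<in> univ_cpt \<tau>G. p \<circ> p = p \<and> (\<forall>s. univ_rep \<tau>G s \<circ> p = p \<circ> univ_rep \<tau>G s)}"

definition idempotent_topology ::
    "'g::group_add topology \<Rightarrow> ('g gns_total \<Rightarrow> 'g gns_total) \<Rightarrow> 'g topology" where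
  "idempotent_topology \<tau>G p =
     pullback_topology UNIV (\<lambda>s. p \<circ> univ_rep \<tau>G s) (univ_cpt_topology \<tau>G)"

definition idempotent_topologies :: "'g::group_add topology \<Rightarrow> 'g topology set" where
  "idempotent_topologies \<tau>G = idempotent_topology \<tau>G ` central_idempotents \<tau>G"

definition univ_extension :: "'g::group_add topology \<Rightarrow> 'g topology \<Rightarrow>
    ('g gns_total \<Rightarrow> 'g gns_total) \<Rightarrow> ('g gns_total \<Rightarrow> 'g gns_total)" where
  "univ_extension \<tau>G \<tau> = (THE \<Phi>. \<Phi> \<in> extensional (univ_cpt \<tau>G) \<and>
     continuous_map (univ_cpt_topology \<tau>G) (univ_cpt_topology \<tau>) \<Phi> \<and>
     (\<forall>s. \<Phi> (univ_rep \<tau>G s) = univ_rep \<tau> s))"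

definition minimal_idempotent :: "('h \<Rightarrow> 'h) set \<Rightarrow> ('h \<Rightarrow> 'h) \<Rightarrow> bool" where
  "minimal_idempotent S p \<longleftrightarrow> p \<in> S \<and> p \<circ> p = p \<and>
     (\<forall>q\<in>S. q \<circ> q = q \<and> q \<circ> p = q \<and> p \<circ> q = q \<longrightarrow> q = p)"

definition topology_idempotent ::
    "'g::group_add topology \<Rightarrow> 'g topology \<Rightarrow> 'g gns_total \<Rightarrow> 'g gns_total" where
  "topology_idempotent \<tau>G \<tau> = (THE p. minimal_idempotent
     {T \<in> univ_cpt \<tau>G. univ_extension \<tau>G \<tau> T = op_id (univ_space \<tau>)} p)"

section \<open>The Fourier-Stieltjes algebra\<close>

definition fs_algebra :: "'g::group_add topology \<Rightarrow> ('g \<Rightarrow> complex) set" where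
  "fs_algebra \<tau>G = {u. \<exists>F c. finite F \<and> F \<subseteq> cont_pos_def \<tau>G \<and> u = (\<lambda>s. \<Sum>v\<in>F. c v * v s)}"

definition group_vN :: "'g::group_add topology \<Rightarrow> ('g gns_total \<Rightarrow> 'g gns_total) set" where
  "group_vN \<tau>G =
     commutant (univ_space \<tau>G) (commutant (univ_space \<tau>G) (range (univ_rep \<tau>G)))"

text \<open>\<open>normal_extension \<tau>G K \<pi> \<Phi>\<close>: the map \<open>\<Phi>\<close> is a normal (that is, ultraweakly continuous)
  *-homomorphism from $W^*(G)$ to $\pi(G)''$ with $\Phi\circ\varpi=\pi$, i.e. \<open>\<Phi>\<close> is $\pi''$.\<close>

definition normal_extension :: "'g::group_add topology \<Rightarrow> 'h::complex_hilbert set \<Rightarrow>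
    ('g \<Rightarrow> 'h \<Rightarrow> 'h) \<Rightarrow> (('g gns_total \<Rightarrow> 'g gns_total) \<Rightarrow> 'h \<Rightarrow> 'h) \<Rightarrow> bool" where
  "normal_extension \<tau>G K \<pi> \<Phi> \<longleftrightarrow>
     (\<forall>S\<in>group_vN \<tau>G. \<forall>T\<in>group_vN \<tau>G.
        \<Phi> (\<lambda>x. S x + T x) = (\<lambda>x. \<Phi> S x + \<Phi> T x) \<and> \<Phi> (S \<circ> T) = \<Phi> S \<circ> \<Phi> T \<and>
        (is_adjoint (univ_space \<tau>G) S T \<longrightarrow> is_adjoint K (\<Phi> S) (\<Phi> T))) \<and>
     (\<forall>c. \<forall>T\<in>group_vN \<tau>G. \<Phi> (\<lambda>x. c *\<^sub>C T x) = (\<lambda>x. c *\<^sub>C \<Phi> T x)) \<and>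
     continuous_map (subtopology (ultraweak_topology (univ_space \<tau>G)) (group_vN \<tau>G))
       (subtopology (ultraweak_topology K) (commutant K (commutant K (range \<pi>)))) \<Phi> \<and>
     (\<forall>s. \<Phi> (univ_rep \<tau>G s) = \<pi> s)"

text \<open>The next two definitions do not depend on how \<open>u\<close> is written as a coefficient. Representations
  on closed subspaces of \<open>'g gns_total\<close> suffice here, as every element of \<open>fs_algebra \<tau>G\<close> is a
  coefficient of \<open>univ_rep \<tau>G\<close>.\<close>

definition fs_pairing ::
    "'g::group_add topology \<Rightarrow> ('g \<Rightarrow> complex) \<Rightarrow> ('g gns_total \<Rightarrow> 'g gns_total) \<Rightarrow> complex" where
  "fs_pairing \<tau>G u T = (THE z. \<exists>(K :: 'g gns_total set) \<pi> \<Phi> \<xi> \<eta>.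
     unitary_rep \<tau>G K \<pi> \<and> normal_extension \<tau>G K \<pi> \<Phi> \<and> \<xi> \<in> K \<and> \<eta> \<in> K \<and>
     u = coefficient \<pi> \<xi> \<eta> \<and> z = cinner (\<Phi> T \<xi>) \<eta>)"

definition fs_action ::
    "'g::group_add topology \<Rightarrow> ('g gns_total \<Rightarrow> 'g gns_total) \<Rightarrow> ('g \<Rightarrow> complex) \<Rightarrow> 'g \<Rightarrow> complex" where
  "fs_action \<tau>G Z u = (THE v. \<exists>(K :: 'g gns_total set) \<pi> \<Phi> \<xi> \<eta>.
     unitary_rep \<tau>G K \<pi> \<and> normal_extension \<tau>G K \<pi> \<Phi> \<and> \<xi> \<in> K \<and> \<eta> \<in> K \<and>
     u = coefficient \<pi> \<xi> \<eta> \<and> v = coefficient \<pi> (\<Phi> Z \<xi>) \<eta>)"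

definition fs_norm :: "'g::group_add topology \<Rightarrow> ('g \<Rightarrow> complex) \<Rightarrow> real" where
  "fs_norm \<tau>G u =
     (SUP T\<in>{T \<in> group_vN \<tau>G. \<forall>x\<in>univ_space \<tau>G. norm (T x) \<le> norm x}. cmod (fs_pairing \<tau>G u T))"

definition fs_closed :: "'g::group_add topology \<Rightarrow> ('g \<Rightarrow> complex) set \<Rightarrow> bool" where
  "fs_closed \<tau>G A \<longleftrightarrow> (\<forall>X u. range X \<subseteq> A \<and> u \<in> fs_algebra \<tau>G \<and>
     (\<lambda>n. fs_norm \<tau>G (\<lambda>s. X n s - u s)) \<longlonglongrightarrow> 0 \<longrightarrow> u \<in> A)"

definition fs_subspace :: "'g::group_add topology \<Rightarrow> ('g \<Rightarrow> complex) set \<Rightarrow> bool" where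
  "fs_subspace \<tau>G A \<longleftrightarrow> A \<subseteq> fs_algebra \<tau>G \<and> (\<lambda>s. 0) \<in> A \<and>
     (\<forall>u\<in>A. \<forall>v\<in>A. (\<lambda>s. u s + v s) \<in> A) \<and> (\<forall>c. \<forall>u\<in>A. (\<lambda>s. c * u s) \<in> A)"

definition fs_subalgebra :: "'g::group_add topology \<Rightarrow> ('g \<Rightarrow> complex) set \<Rightarrow> bool" where
  "fs_subalgebra \<tau>G A \<longleftrightarrow> fs_subspace \<tau>G A \<and> (\<forall>u\<in>A. \<forall>v\<in>A. (\<lambda>s. u s * v s) \<in> A)"

definition fs_ideal :: "'g::group_add topology \<Rightarrow> ('g \<Rightarrow> complex) set \<Rightarrow> bool" where
  "fs_ideal \<tau>G A \<longleftrightarrow> fs_subspace \<tau>G A \<and> (\<forall>u\<in>A. \<forall>v\<in>fs_algebra \<tau>G. (\<lambda>s. u s * v s) \<in> A)"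

definition translation_invariant :: "('g::group_add \<Rightarrow> complex) set \<Rightarrow> bool" where
  "translation_invariant A \<longleftrightarrow> (\<forall>u\<in>A. \<forall>t. (\<lambda>s. u (t + s)) \<in> A \<and> (\<lambda>s. u (s + t)) \<in> A)"

definition l1_direct_sum ::
    "'g::group_add topology \<Rightarrow> ('g \<Rightarrow> complex) set \<Rightarrow> ('g \<Rightarrow> complex) set \<Rightarrow> bool" where
  "l1_direct_sum \<tau>G A B \<longleftrightarrow> fs_subspace \<tau>G A \<and> fs_subspace \<tau>G B \<and>
     fs_algebra \<tau>G = {\<lambda>s. u s + v s | u v. u \<in> A \<and> v \<in> B} \<and> A \<inter> B = {\<lambda>s. 0} \<and>
     (\<forall>u\<in>A. \<forall>v\<in>B. fs_norm \<tau>G (\<lambda>s. u s + v s) = fs_norm \<tau>G u + fs_norm \<tau>G v)"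

definition fs_B :: "'g::group_add topology \<Rightarrow> 'g topology \<Rightarrow> ('g \<Rightarrow> complex) set" where
  "fs_B \<tau>G \<tau> = fs_action \<tau>G (topology_idempotent \<tau>G \<tau>) ` fs_algebra \<tau>G"

definition fs_I :: "'g::group_add topology \<Rightarrow> 'g topology \<Rightarrow> ('g \<Rightarrow> complex) set" where
  "fs_I \<tau>G \<tau> =
     fs_action \<tau>G (\<lambda>x. op_id (univ_space \<tau>G) x - topology_idempotent \<tau>G \<tau> x) ` fs_algebra \<tau>G"

end

theory Submission
  imports Defs
begin

text \<open>
  Let \<open>p\<close> be a central idempotent of the compactification that induces \<open>\<tau>\<close>, and let \<open>H\<close> be the
  universal space. Since \<open>p\<close> is a weak limit of group elements, there is a filter on the group along
  which the universal representation converges weakly to \<open>p\<close>. Because \<open>p p = p\<close>, this filter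
  converges to the unit in \<open>\<tau>\<close>. For a coefficient \<open>u\<close> of the universal representation,
  \<open>u (t + s)\<close> therefore tends along the filter to \<open>(p \<cdot> u) t\<close>, and to \<open>u t\<close> as well if \<open>u\<close> is
  \<open>\<tau>\<close>-continuous. Three things follow.
  \<^item> \<open>p \<cdot> u = u\<close> holds precisely for the \<open>\<tau>\<close>-continuous \<open>u\<close> (\<open>action_eq_iff_continuous\<close>).
  \<^item> The action of \<open>p\<close> is multiplicative (\<open>action_mult\<close>), so the functions that it fixes form a
    subalgebra and those that it annihilates form an ideal.
  \<^item> A vector with a \<open>\<tau>\<close>-continuous diagonal coefficient is fixed by \<open>p\<close>, which is a contraction
    (\<open>fixed_of_continuous\<close>).

  The last fact identifies \<open>p\<close> with the idempotent \<open>P(\<tau>)\<close>: it puts \<open>p\<close> into the kernel semigroup of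
  the restriction to the universal space of \<open>\<tau>\<close>, and conversely every element of that semigroup
  fixes the range of \<open>p\<close>, because the coefficients of vectors in this range are already coefficients
  of the universal space of \<open>\<tau>\<close> (\<open>topology_idempotent_eq\<close>). It also shows that the restriction of the
  universal representation to the kernel of \<open>p\<close> has no \<open>\<tau>\<close>-continuous subrepresentation. For the
  converse, if \<open>v\<close> is the coefficient of a vector in an arbitrary representation, the intertwiner from
  the GNS space of \<open>v\<close> takes \<open>p\<close> applied to the cyclic vector to a vector with \<open>\<tau>\<close>-continuous
  coefficients; this vector vanishes if there are no \<open>\<tau>\<close>-continuous subrepresentations
  (\<open>no_subrep_annihilates\<close>).

  Closedness, translation invariance and the decomposition with additive norms hold for every central
  projection \<open>Z\<close> of the von Neumann algebra. The norm is additive because contractions \<open>T\<close> and \<open>S\<close>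
  can be glued to the contraction \<open>T Z + S (1 - Z)\<close> (\<open>l1_norm\<close>).

  What makes the pairing and the action well defined is that the combinations of group elements are
  ultraweakly dense in the von Neumann algebra (\<open>group_vN_density\<close>). Both this and the treatment of
  arbitrary representations rest on one construction, the contraction out of a GNS space given by a
  dominated family of vectors (\<open>gns_contraction_exists\<close>).
\<close>

section \<open>Complex Hilbert spaces\<close>

lemma scaleC_one [simp]: "1 *\<^sub>C x = (x::'h::complex_hilbert)"
  using scaleC_of_real[of 1 x] by simp

lemma scaleC_zero_left [simp]: "0 *\<^sub>C x = (0::'h::complex_hilbert)"
  using scaleC_of_real[of 0 x] by simp

lemma scaleC_zero_right [simp]: "c *\<^sub>C 0 = (0::'h::complex_hilbert)"
  using scaleC_add_right[of c 0 0] by simp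

lemma scaleC_minus_one: "(- 1) *\<^sub>C x = - (x::'h::complex_hilbert)"
  using scaleC_of_real[of "-1" x] by simp

lemma scaleC_sum_right: "c *\<^sub>C (\<Sum>i\<in>A. f i) = (\<Sum>i\<in>A. c *\<^sub>C (f i::'h::complex_hilbert))"
  by (induction A rule: infinite_finite_induct) (auto simp: scaleC_add_right)

lemma cinner_add_right: "cinner x (y + z) = cinner x y + cinner x (z::'h::complex_hilbert)"
  by (metis cinner_add_left cinner_commute complex_cnj_add)

lemma cinner_scaleC_right: "cinner x (c *\<^sub>C y) = cnj c * cinner x (y::'h::complex_hilbert)"
  by (metis cinner_scaleC_left cinner_commute complex_cnj_mult)

lemma cinner_zero_left [simp]: "cinner 0 (y::'h::complex_hilbert) = 0"
  using cinner_add_left[of 0 0 y] by simp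

lemma cinner_zero_right [simp]: "cinner (y::'h::complex_hilbert) 0 = 0"
  using cinner_add_right[of y 0 0] by simp

lemma cinner_minus_left: "cinner (- x) y = - cinner x (y::'h::complex_hilbert)"
  using cinner_add_left[of x "-x" y] by (simp add: minus_unique)

lemma cinner_minus_right: "cinner x (- y) = - cinner x (y::'h::complex_hilbert)"
  using cinner_add_right[of x y "-y"] by (simp add: minus_unique)

lemma cinner_diff_left: "cinner (x - z) y = cinner x y - cinner z (y::'h::complex_hilbert)"
  using cinner_add_left[of x "-z" y] by (simp add: cinner_minus_left)

lemma cinner_diff_right: "cinner x (y - z) = cinner x y - cinner x (z::'h::complex_hilbert)"
  using cinner_add_right[of x y "-z"] by (simp add: cinner_minus_right)

lemma cinner_sum_left: "cinner (\<Sum>i\<in>A. f i) y = (\<Sum>i\<in>A. cinner (f i) (y::'h::complex_hilbert))"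
  by (induction A rule: infinite_finite_induct) (auto simp: cinner_add_left)

lemma cinner_sum_right: "cinner y (\<Sum>i\<in>A. f i) = (\<Sum>i\<in>A. cinner y (f i::'h::complex_hilbert))"
  by (induction A rule: infinite_finite_induct) (auto simp: cinner_add_right)

lemma Re_cinner_self: "Re (cinner x x) = (norm (x::'h::complex_hilbert))\<^sup>2"
  by (simp add: cinner_self del: of_real_power)

lemma norm_add_square:
  "(norm (x + y :: 'h::complex_hilbert))\<^sup>2 = (norm x)\<^sup>2 + 2 * Re (cinner x y) + (norm y)\<^sup>2"
proof -
  have "Re (cinner y x) = Re (cinner x y)"
    using cinner_commute[of x y] by simp
  then show ?thesis
    unfolding Re_cinner_self[symmetric] by (simp add: cinner_add_left cinner_add_right)
qed

lemma norm_diff_square: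
  "(norm (x - y :: 'h::complex_hilbert))\<^sup>2 = (norm x)\<^sup>2 - 2 * Re (cinner x y) + (norm y)\<^sup>2"
  using norm_add_square[of x "-y"] by (simp add: cinner_minus_right)

lemma norm_scaleC: "norm (c *\<^sub>C x) = cmod c * norm (x::'h::complex_hilbert)"
proof -
  have "complex_of_real ((norm (c *\<^sub>C x))\<^sup>2) = c * cnj c * cinner x x"
    unfolding cinner_self[symmetric] by (simp add: cinner_scaleC_left cinner_scaleC_right)
  also have "\<dots> = complex_of_real ((cmod c * norm x)\<^sup>2)"
    unfolding cinner_self complex_norm_square[symmetric] by (simp add: power_mult_distrib)
  finally have "(norm (c *\<^sub>C x))\<^sup>2 = (cmod c * norm x)\<^sup>2" by (metis of_real_eq_iff)
  then show ?thesis by (simp add: power2_eq_iff_nonneg)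
qed

lemma cinner_Cauchy_Schwarz: "cmod (cinner x y) \<le> norm x * norm (y::'h::complex_hilbert)"
proof (cases "norm y = 0")
  case False
  (* The multiple c of y is the component of x along y. *)
  define c where "c = cinner x y / complex_of_real ((norm y)\<^sup>2)"
  have c: "c * cnj (cinner x y) = complex_of_real ((cmod (cinner x y))\<^sup>2 / (norm y)\<^sup>2)"
    unfolding c_def using complex_norm_square[of "cinner x y"] by simp
  have "0 \<le> (norm (x - c *\<^sub>C y))\<^sup>2" by simp
  also have "\<dots> = (norm x)\<^sup>2 - 2 * Re (cnj c * cinner x y) + (cmod c * norm y)\<^sup>2"
    by (simp add: norm_diff_square cinner_scaleC_right norm_scaleC)
  also have "Re (cnj c * cinner x y) = (cmod (cinner x y))\<^sup>2 / (norm y)\<^sup>2"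
    using arg_cong[OF c, of "\<lambda>z. Re (cnj z)"] by simp
  also have "(cmod c * norm y)\<^sup>2 = (cmod (cinner x y))\<^sup>2 / (norm y)\<^sup>2"
    using False by (simp add: c_def norm_divide norm_mult power2_eq_square)
  finally have "(cmod (cinner x y))\<^sup>2 \<le> (norm x * norm y)\<^sup>2"
    using False by (simp add: field_simps power_mult_distrib)
  then show ?thesis by (rule power2_le_imp_le) simp
qed simp

lemma bounded_bilinear_cinner: "bounded_bilinear (cinner :: 'h::complex_hilbert \<Rightarrow> 'h \<Rightarrow> complex)"
proof
  fix a a' b b' :: 'h and r :: real
  show "cinner (r *\<^sub>R a) b = r *\<^sub>R cinner a b"
    by (metis cinner_scaleC_left scaleC_of_real scaleR_conv_of_real)
  show "cinner a (r *\<^sub>R b) = r *\<^sub>R cinner a b"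
    by (metis cinner_scaleC_right scaleC_of_real scaleR_conv_of_real complex_cnj_complex_of_real)
  show "\<exists>K. \<forall>a b :: 'h. norm (cinner a b) \<le> norm a * norm b * K"
    by (rule exI[of _ 1]) (simp add: cinner_Cauchy_Schwarz)
qed (simp_all add: cinner_add_left cinner_add_right)

lemmas tendsto_cinner [tendsto_intros] = bounded_bilinear.tendsto[OF bounded_bilinear_cinner]
lemmas continuous_on_cinner [continuous_intros] =
  bounded_bilinear.continuous_on[OF bounded_bilinear_cinner]

lemma bounded_linear_scaleC: "bounded_linear (\<lambda>x::'h::complex_hilbert. c *\<^sub>C x)"
proof
  fix x y :: 'h and r
  show "c *\<^sub>C (x + y) = c *\<^sub>C x + c *\<^sub>C y" by (rule scaleC_add_right)
  show "c *\<^sub>C (r *\<^sub>R x) = r *\<^sub>R (c *\<^sub>C x)"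
    by (simp add: scaleC_of_real[symmetric] scaleC_scaleC mult.commute)
  show "\<exists>K. \<forall>x::'h. norm (c *\<^sub>C x) \<le> norm x * K"
    by (rule exI[of _ "cmod c"]) (simp add: norm_scaleC)
qed

lemmas tendsto_scaleC [tendsto_intros] = bounded_linear.tendsto[OF bounded_linear_scaleC]

lemma cinner_eq_zero_all: "(\<And>y. y \<in> K \<Longrightarrow> cinner x y = 0) \<Longrightarrow> x \<in> K \<Longrightarrow> x = (0::'h::complex_hilbert)"
  using cinner_self[of x] by simp

text \<open>A vector that is no longer than \<open>x\<close> and whose component along \<open>x\<close> is all of \<open>x\<close> has no room
  for anything else.\<close>

lemma eq_of_cinner_eq_norm_square:
  fixes x y :: "'h::complex_hilbert"
  assumes "norm y \<le> norm x" "cinner y x = complex_of_real ((norm x)\<^sup>2)"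
  shows "y = x"
proof -
  have "(norm (y - x))\<^sup>2 = (norm y)\<^sup>2 - (norm x)\<^sup>2"
    using assms(2) by (simp add: norm_diff_square del: of_real_power)
  also have "\<dots> \<le> 0" using assms(1) by (simp add: power_mono)
  finally show ?thesis by simp
qed

lemma norm_sum_scaleC_square:
  "complex_of_real ((norm (\<Sum>s\<in>F. c s *\<^sub>C x s))\<^sup>2)
    = (\<Sum>s\<in>F. \<Sum>t\<in>F. c s * cnj (c t) * cinner (x s) (x t :: 'h::complex_hilbert))"
  unfolding cinner_self[symmetric] cinner_sum_left
  by (simp add: cinner_sum_right cinner_scaleC_left cinner_scaleC_right
      sum_distrib_left mult_ac)

text \<open>Removing from \<open>x\<close> its component along \<open>z\<close> would shorten \<open>x\<close>, unless that component is zero.\<close>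

lemma orthogonal_of_norm_le:
  fixes x z :: "'h::complex_hilbert"
  assumes "\<And>c. norm x \<le> norm (x + c *\<^sub>C z)"
  shows "cinner x z = 0"
proof (cases "norm z = 0")
  case False
  define c where "c = - cinner x z / complex_of_real ((norm z)\<^sup>2)"
  have "(norm x)\<^sup>2 \<le> (norm (x + c *\<^sub>C z))\<^sup>2"
    using assms by (simp add: power_mono)
  also have "\<dots> = (norm x)\<^sup>2 + 2 * Re (cnj c * cinner x z) + (cmod c * norm z)\<^sup>2"
    by (simp add: norm_add_square cinner_scaleC_right norm_scaleC)
  also have "cnj c * cinner x z = - complex_of_real ((cmod (cinner x z))\<^sup>2 / (norm z)\<^sup>2)"
    unfolding c_def using complex_norm_square[of "cinner x z"] by (simp add: mult.commute)
  also have "(cmod c * norm z)\<^sup>2 = (cmod (cinner x z))\<^sup>2 / (norm z)\<^sup>2"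
    using False by (simp add: c_def norm_divide norm_mult power2_eq_square)
  finally show ?thesis using False by (simp add: field_simps)
qed simp

text \<open>The idempotent sends \<open>p x + c (y - p y)\<close> to \<open>p x\<close>. Being a contraction, it makes \<open>p x\<close> the
  shortest of these vectors.\<close>

lemma idempotent_contraction_orthogonal:
  fixes p :: "'h::complex_hilbert \<Rightarrow> 'h"
  assumes p: "p \<in> bounded_ops K" and K: "csubspace K"
    and contr: "\<And>x. x \<in> K \<Longrightarrow> norm (p x) \<le> norm x" and idem: "p \<circ> p = p"
    and x: "x \<in> K" and y: "y \<in> K"
  shows "cinner (p x) (y - p y) = 0"
proof (rule orthogonal_of_norm_le)
  fix c
  have in_K: "p u \<in> K" "u + v \<in> K" "d *\<^sub>C u \<in> K" if "u \<in> K" "v \<in> K" for u v d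
    using p K that by (auto simp: bounded_ops_def csubspace_def)
  have lin: "p (u + v) = p u + p v" "p (d *\<^sub>C u) = d *\<^sub>C p u" if "u \<in> K" "v \<in> K" for u v d
    using p that by (auto simp: bounded_ops_def)
  have pp: "p (p u) = p u" for u using fun_cong[OF idem, of u] by simp
  have z: "y - p y \<in> K" "p (y - p y) = 0"
    using in_K(2)[of y "(-1) *\<^sub>C p y"] in_K(3)[of "p y" y "-1"] in_K(1)[of y y] y
      lin(1)[of y "(-1) *\<^sub>C p y"] lin(2)[of "p y" y "-1"]
    by (auto simp: scaleC_minus_one pp)
  have "p (p x + c *\<^sub>C (y - p y)) = p x"
    using lin(1)[of "p x" "c *\<^sub>C (y - p y)"] lin(2)[of "y - p y" y c] in_K x y z
    by (simp add: pp)
  then show "norm (p x) \<le> norm (p x + c *\<^sub>C (y - p y))"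
    using contr[of "p x + c *\<^sub>C (y - p y)"] in_K x y z by metis
qed

subsection \<open>Closed subspaces\<close>

lemma csubspaceD:
  assumes "csubspace (K :: 'h::complex_hilbert set)"
  shows "0 \<in> K" "x \<in> K \<Longrightarrow> y \<in> K \<Longrightarrow> x + y \<in> K" "x \<in> K \<Longrightarrow> c *\<^sub>C x \<in> K"
    "x \<in> K \<Longrightarrow> - x \<in> K" "x \<in> K \<Longrightarrow> y \<in> K \<Longrightarrow> x - y \<in> K" "x \<in> K \<Longrightarrow> r *\<^sub>R x \<in> K"
proof -
  show *: "0 \<in> K" "\<And>x y. x \<in> K \<Longrightarrow> y \<in> K \<Longrightarrow> x + y \<in> K" "\<And>x c. x \<in> K \<Longrightarrow> c *\<^sub>C x \<in> K"
    using assms by (auto simp: csubspace_def)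
  show m: "\<And>x. x \<in> K \<Longrightarrow> - x \<in> K" by (metis *(3) scaleC_minus_one)
  show "x \<in> K \<Longrightarrow> y \<in> K \<Longrightarrow> x - y \<in> K" using *(2)[of x "-y"] m[of y] by simp
  show "x \<in> K \<Longrightarrow> r *\<^sub>R x \<in> K" by (metis *(3) scaleC_of_real)
qed

lemma csubspace_sum:
  "csubspace K \<Longrightarrow> (\<And>i. i \<in> A \<Longrightarrow> f i \<in> K) \<Longrightarrow> (\<Sum>i\<in>A. f i) \<in> (K :: 'h::complex_hilbert set)"
  by (induction A rule: infinite_finite_induct) (auto simp: csubspaceD)

lemma closed_cspan:
  shows csubspace_closed_cspan: "csubspace (closed_cspan A)"
    and closed_closed_cspan: "closed (closed_cspan A)"
    and closed_cspan_superset: "A \<subseteq> closed_cspan A"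
  by (auto simp: closed_cspan_def csubspace_def)

lemma closed_cspan_least:
  "csubspace K \<Longrightarrow> closed K \<Longrightarrow> A \<subseteq> K \<Longrightarrow> closed_cspan A \<subseteq> K"
  by (auto simp: closed_cspan_def)

lemma closed_cspan_induct [consumes 1, case_names base zero add scale closed]:
  assumes "x \<in> closed_cspan A" "\<And>x. x \<in> A \<Longrightarrow> P x" "P 0"
    "\<And>x y. P x \<Longrightarrow> P y \<Longrightarrow> P (x + y)" "\<And>c x. P x \<Longrightarrow> P (c *\<^sub>C x)" "closed {x. P x}"
  shows "P x"
  using closed_cspan_least[of "{x. P x}" A] assms by (auto simp: csubspace_def)

subsection \<open>The Riesz representation theorem\<close>

text \<open>The representing vector is the minimiser of \<open>norm x ^ 2 - 2 * Re (f x)\<close>: by the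
  parallelogram law a minimising sequence is Cauchy, and the vanishing of the first
  variation at the minimum is the representation.\<close>

theorem Riesz_representation:
  fixes f :: "'h::complex_hilbert \<Rightarrow> complex"
  assumes K: "csubspace K" "closed K"
    and add: "\<And>x y. x \<in> K \<Longrightarrow> y \<in> K \<Longrightarrow> f (x + y) = f x + f y"
    and scale: "\<And>c x. x \<in> K \<Longrightarrow> f (c *\<^sub>C x) = c * f x"
    and bound: "\<And>x. x \<in> K \<Longrightarrow> cmod (f x) \<le> C * norm x"
  obtains y where "y \<in> K" "\<And>x. x \<in> K \<Longrightarrow> f x = cinner x y"
proof -
  define J where "J x = (norm x)\<^sup>2 - 2 * Re (f x)" for x
  define m where "m = Inf (J ` K)"
  have lower: "- C\<^sup>2 \<le> J x" if "x \<in> K" for x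
  proof -
    have "Re (f x) \<le> C * norm x"
      using bound[OF that] complex_Re_le_cmod[of "f x"] by linarith
    moreover have "0 \<le> (norm x - C)\<^sup>2" by simp
    ultimately show ?thesis by (simp add: J_def power2_diff mult_ac)
  qed
  have bdd: "bdd_below (J ` K)" using lower by (rule bdd_belowI2)
  have m_le: "m \<le> J x" if "x \<in> K" for x
    unfolding m_def by (rule cINF_lower[OF bdd that])
  have "\<exists>x\<in>K. J x < m + inverse (real (Suc n))" for n
  proof -
    have "J ` K \<noteq> {}" using csubspaceD(1)[OF K(1)] by auto
    then show ?thesis
      using cInf_lessD[of "J ` K" "m + inverse (real (Suc n))"] unfolding m_def by auto
  qed
  then obtain X where X: "\<And>n. X n \<in> K" "\<And>n. J (X n) < m + inverse (real (Suc n))" by metis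
  have par: "(norm (x - y))\<^sup>2 \<le> 2 * (J x - m) + 2 * (J y - m)" if "x \<in> K" "y \<in> K" for x y
  proof -
    have h: "(1/2) *\<^sub>R (x + y) \<in> K" using K(1) that by (simp add: csubspaceD)
    have "f ((1/2) *\<^sub>R (x + y)) = (f x + f y) / 2"
      using scale[of "x + y" "1/2"] that K(1) add[OF that] scaleC_of_real[of "1/2" "x + y"]
      by (simp add: csubspaceD)
    then have "Re (f ((1/2) *\<^sub>R (x + y))) = (Re (f x) + Re (f y)) / 2"
      by (metis Re_divide_numeral plus_complex.sel(1))
    then have "4 * J ((1/2) *\<^sub>R (x + y)) = (norm (x + y))\<^sup>2 - 4 * (Re (f x) + Re (f y))"
      by (simp add: J_def power2_eq_square)
    moreover have "4 * m \<le> 4 * J ((1/2) *\<^sub>R (x + y))" using m_le[OF h] by simp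
    ultimately show ?thesis
      unfolding norm_diff_square norm_add_square J_def by (simp add: algebra_simps)
  qed
  have "Cauchy X"
  proof (rule metric_CauchyI)
    fix e :: real assume e: "e > 0"
    then have "e\<^sup>2 / 4 > 0" by simp
    then obtain N where N: "inverse (real (Suc N)) < e\<^sup>2 / 4" using reals_Archimedean by blast
    have small: "J (X a) < m + e\<^sup>2 / 4" if "a \<ge> N" for a
    proof -
      have "J (X a) < m + inverse (real (Suc a))" by (rule X(2))
      also have "\<dots> \<le> m + inverse (real (Suc N))" using that by simp
      also have "\<dots> < m + e\<^sup>2 / 4" using N by simp
      finally show ?thesis .
    qed
    have "dist (X a) (X b) < e" if "a \<ge> N" "b \<ge> N" for a b
    proof -
      have "(norm (X a - X b))\<^sup>2 < e\<^sup>2"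
        using par[OF X(1) X(1), of a b] small[OF that(1)] small[OF that(2)] by argo
      then show ?thesis using e by (simp add: dist_norm power2_less_imp_less)
    qed
    then show "\<exists>M. \<forall>a\<ge>M. \<forall>b\<ge>M. dist (X a) (X b) < e" by blast
  qed
  then obtain y where y: "X \<longlonglongrightarrow> y" using Cauchy_convergent convergent_def by blast
  have yK: "y \<in> K" using closed_sequentially[OF K(2) _ y] X(1) by blast
  have Jy: "J y \<le> m"
  proof (rule LIMSEQ_le_const)
    have fl: "(\<lambda>n. f (X n)) \<longlonglongrightarrow> f y"
    proof -
      have "(\<lambda>n. C * norm (X n - y)) \<longlonglongrightarrow> C * norm (y - y)" by (intro tendsto_intros y)
      then have *: "(\<lambda>n. C * norm (X n - y)) \<longlonglongrightarrow> 0" by simp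
      have "f (X n) - f y = f (X n - y)" for n
        using add[of "X n - y" y] X(1)[of n] yK K(1) by (simp add: csubspaceD)
      then have "norm (f (X n) - f y) \<le> C * norm (X n - y)" for n
        using bound[of "X n - y"] X(1)[of n] yK K(1) by (simp add: csubspaceD)
      then have "(\<lambda>n. f (X n) - f y) \<longlonglongrightarrow> 0"
        by (intro Lim_null_comparison[OF always_eventually *]) blast
      then show ?thesis by (rule LIM_zero_cancel)
    qed
    have "(\<lambda>n. m + inverse (real (Suc n)) - J (X n)) \<longlonglongrightarrow> m + 0 - J y"
      unfolding J_def by (intro tendsto_intros fl y LIMSEQ_inverse_real_of_nat)
    then have "(\<lambda>n. m + inverse (real (Suc n)) - J (X n) + J y) \<longlonglongrightarrow> m"
      using tendsto_add[OF _ tendsto_const[of "J y"]] by fastforce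
    then show "(\<lambda>n. m + inverse (real (Suc n)) - J (X n) + J y) \<longlonglongrightarrow> m" .
    show "\<exists>N. \<forall>n\<ge>N. J y \<le> m + inverse (real (Suc n)) - J (X n) + J y"
      using X(2) less_imp_le by (auto simp: algebra_simps)
  qed
  have re: "Re (f x) = Re (cinner x y)" if x: "x \<in> K" for x
  proof (rule ccontr)
    assume neq: "Re (f x) \<noteq> Re (cinner x y)"
    define d where "d = Re (f x) - Re (cinner x y)"
    (* This step length makes the change of J along x negative; the summand 1 covers x = 0. *)
    define t where "t = d / ((norm x)\<^sup>2 + 1)"
    have pos: "(norm x)\<^sup>2 + 1 > 0" using zero_le_power2[of "norm x"] by linarith
    have "J (y + t *\<^sub>R x) \<ge> J y" using Jy m_le[of "y + t *\<^sub>R x"] yK x K(1) by (simp add: csubspaceD)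
    moreover have "f (y + t *\<^sub>R x) = f y + t * f x"
      using add[of y "t *\<^sub>R x"] scale[of x "complex_of_real t"] yK x K(1)
      by (simp add: csubspaceD scaleC_of_real)
    moreover have "Re (cinner y (t *\<^sub>R x)) = t * Re (cinner x y)"
      using cinner_commute[of y x] cinner_scaleC_right[of y "complex_of_real t" x]
      by (simp add: scaleC_of_real)
    ultimately have "2 * (t * d) \<le> t\<^sup>2 * (norm x)\<^sup>2"
      by (simp add: J_def d_def norm_add_square algebra_simps power_mult_distrib)
    also have "\<dots> \<le> t\<^sup>2 * ((norm x)\<^sup>2 + 1)" by (simp add: algebra_simps)
    also have "\<dots> = t * d" using pos by (simp add: t_def power2_eq_square)
    finally have "t * d \<le> 0" by linarith
    moreover have "t * d = d\<^sup>2 / ((norm x)\<^sup>2 + 1)" by (simp add: t_def power2_eq_square)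
    ultimately show False using neq pos by (simp add: d_def divide_le_0_iff)
  qed
  have "f x = cinner x y" if x: "x \<in> K" for x
  proof (rule complex_eqI)
    show "Re (f x) = Re (cinner x y)" by (rule re[OF x])
    (* The imaginary part at x is the real part at - i x. *)
    have "Re (f ((-\<i>) *\<^sub>C x)) = Re (cinner ((-\<i>) *\<^sub>C x) y)"
      by (rule re) (use K(1) x in \<open>simp add: csubspaceD\<close>)
    then show "Im (f x) = Im (cinner x y)" using scale[OF x] by (simp add: cinner_scaleC_left)
  qed
  with yK that show thesis by blast
qed

section \<open>Initial topologies and limits\<close>

lemma topspace_initial_topology [simp]: "topspace (initial_topology X F) = X"
  by (auto simp: initial_topology_def)

text \<open>This turns approximation on finitely many coefficients into membership in weakly or ultraweakly
  open sets.\<close>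

lemma openin_initial_topology_nbhd:
  fixes F :: "('a \<Rightarrow> 'b::metric_space) set"
  assumes "openin (initial_topology X F) U" "T \<in> U"
  obtains Y e where "finite Y" "Y \<subseteq> F" "e > 0"
    "\<And>S. S \<in> X \<Longrightarrow> (\<And>f. f \<in> Y \<Longrightarrow> dist (f S) (f T) < e) \<Longrightarrow> S \<in> U"
proof -
  have "generate_topology_on (insert X {f -` U \<inter> X | f U. f \<in> F \<and> open U}) U"
    using assms(1) by (simp add: initial_topology_def openin_topology_generated_by_iff)
  then have "\<forall>T\<in>U. \<exists>Y e. finite Y \<and> Y \<subseteq> F \<and> e > 0 \<and>
      (\<forall>S\<in>X. (\<forall>f\<in>Y. dist (f S) (f T) < e) \<longrightarrow> S \<in> U)"
  proof induction
    case (Int a b)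
    show ?case
    proof
      fix T assume "T \<in> a \<inter> b"
      then obtain Y e Z d where "finite Y" "Y \<subseteq> F" "e > 0" "finite Z" "Z \<subseteq> F" "d > (0::real)"
        and a: "\<forall>S\<in>X. (\<forall>f\<in>Y. dist (f S) (f T) < e) \<longrightarrow> S \<in> a"
        and b: "\<forall>S\<in>X. (\<forall>f\<in>Z. dist (f S) (f T) < d) \<longrightarrow> S \<in> b"
        using Int.IH by (metis IntE)
      then show "\<exists>Y e. finite Y \<and> Y \<subseteq> F \<and> e > 0 \<and>
          (\<forall>S\<in>X. (\<forall>f\<in>Y. dist (f S) (f T) < e) \<longrightarrow> S \<in> a \<inter> b)"
        by (intro exI[of _ "Y \<union> Z"] exI[of _ "min e d"]) auto
    qed
  next
    case (UN K)
    show ?case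
    proof
      fix T assume "T \<in> \<Union>K"
      then obtain k where k: "k \<in> K" "T \<in> k" by blast
      with UN.IH[OF k(1)] show "\<exists>Y e. finite Y \<and> Y \<subseteq> F \<and> e > 0 \<and>
          (\<forall>S\<in>X. (\<forall>f\<in>Y. dist (f S) (f T) < e) \<longrightarrow> S \<in> \<Union>K)"
        by (meson UnionI)
    qed
  next
    case (Basis s)
    show ?case
    proof
      fix T assume T: "T \<in> s"
      from Basis consider "s = X" | f V where "f \<in> F" "open V" "s = f -` V \<inter> X" by blast
      then show "\<exists>Y e. finite Y \<and> Y \<subseteq> F \<and> e > 0 \<and>
          (\<forall>S\<in>X. (\<forall>f\<in>Y. dist (f S) (f T) < e) \<longrightarrow> S \<in> s)"
      proof cases
        case 1
        then show ?thesis by (intro exI[of _ "{}"] exI[of _ 1]) auto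
      next
        case (2 f V)
        then obtain e where "e > 0" "\<forall>z. dist z (f T) < e \<longrightarrow> z \<in> V"
          using T unfolding open_dist by auto
        then show ?thesis using 2 by (intro exI[of _ "{f}"] exI[of _ e]) auto
      qed
    qed
  qed simp
  then show thesis using that assms(2) by metis
qed

lemma limitin_initial_topology:
  fixes F :: "('a \<Rightarrow> 'b::metric_space) set"
  assumes "T \<in> X" "\<And>s. h s \<in> X" "\<And>f. f \<in> F \<Longrightarrow> ((\<lambda>s. f (h s)) \<longlongrightarrow> f T) \<F>"
  shows "limitin (initial_topology X F) h T \<F>"
  unfolding limitin_def topspace_initial_topology
proof (intro conjI assms(1) allI impI)
  fix U assume U: "openin (initial_topology X F) U \<and> T \<in> U"
  obtain Y e where Y: "finite Y" "Y \<subseteq> F" "e > 0"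
      "\<And>S. S \<in> X \<Longrightarrow> (\<And>f. f \<in> Y \<Longrightarrow> dist (f S) (f T) < e) \<Longrightarrow> S \<in> U"
    using openin_initial_topology_nbhd U by metis
  have "\<forall>\<^sub>F s in \<F>. \<forall>f\<in>Y. dist (f (h s)) (f T) < e"
    using Y by (intro eventually_ball_finite) (auto intro!: tendstoD assms(3))
  then show "\<forall>\<^sub>F s in \<F>. h s \<in> U"
    by eventually_elim (use Y(4) assms(2) in blast)
qed

lemma continuous_map_initial_topology_component:
  fixes F :: "('a \<Rightarrow> 'b::metric_space) set"
  shows
  "f \<in> F \<Longrightarrow> continuous_map (initial_topology X F) euclidean f"
  unfolding continuous_map_def topspace_initial_topology
proof (intro conjI allI impI)
  fix U :: "'b set" assume "f \<in> F" "openin euclidean U"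
  moreover have "{x \<in> X. f x \<in> U} = f -` U \<inter> X" by auto
  ultimately show "openin (initial_topology X F) {x \<in> X. f x \<in> U}"
    unfolding initial_topology_def by (intro topology_generated_by_Basis) auto
qed auto

lemma continuous_map_into_initial_topology:
  assumes h: "\<And>s. s \<in> topspace \<tau> \<Longrightarrow> h s \<in> X"
    and F: "\<And>f. f \<in> F \<Longrightarrow> continuous_map \<tau> euclidean (\<lambda>s. f (h s))"
  shows "continuous_map \<tau> (initial_topology X F) h"
  unfolding initial_topology_def
proof (rule continuous_on_generated_topo)
  show "h ` topspace \<tau> \<subseteq> \<Union> (insert X {f -` U \<inter> X |f U. f \<in> F \<and> open U})" using h by auto
  fix V assume "V \<in> insert X {f -` U \<inter> X |f U. f \<in> F \<and> open U}"
  then consider "V = X" | f U where "f \<in> F" "open U" "V = f -` U \<inter> X" by blast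
  then show "openin \<tau> (h -` V \<inter> topspace \<tau>)"
  proof cases
    case 1
    then have "h -` V \<inter> topspace \<tau> = topspace \<tau>" using h by auto
    then show ?thesis by simp
  next
    case (2 f U)
    then have "h -` V \<inter> topspace \<tau> = {s \<in> topspace \<tau>. f (h s) \<in> U}" using h by auto
    then show ?thesis using F[OF 2(1)] 2(2) by (simp add: continuous_map_def)
  qed
qed

lemma continuous_map_euclidean_tendsto_iff:
  "continuous_map \<tau> euclidean f \<longleftrightarrow> (\<forall>s\<in>topspace \<tau>. (f \<longlongrightarrow> f s) (nhdsin \<tau> s))"
proof
  assume f: "continuous_map \<tau> euclidean f"
  show "\<forall>s\<in>topspace \<tau>. (f \<longlongrightarrow> f s) (nhdsin \<tau> s)"
  proof (intro ballI topological_tendstoI)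
    fix s U assume "s \<in> topspace \<tau>" "open U" "f s \<in> U"
    then show "\<forall>\<^sub>F x in nhdsin \<tau> s. f x \<in> U"
      using f unfolding eventually_nhdsin continuous_map_def
      by (auto intro!: exI[of _ "{x \<in> topspace \<tau>. f x \<in> U}"])
  qed
next
  assume R: "\<forall>s\<in>topspace \<tau>. (f \<longlongrightarrow> f s) (nhdsin \<tau> s)"
  show "continuous_map \<tau> euclidean f"
    unfolding continuous_map_def
  proof (intro conjI allI impI)
    fix U :: "'b set" assume U: "openin euclidean U"
    show "openin \<tau> {x \<in> topspace \<tau>. f x \<in> U}"
    proof (subst openin_subopen, intro ballI)
      fix s assume s: "s \<in> {x \<in> topspace \<tau>. f x \<in> U}"
      then have "\<forall>\<^sub>F x in nhdsin \<tau> s. f x \<in> U" using R U by (auto dest: topological_tendstoD)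
      then obtain S where "openin \<tau> S" "s \<in> S" "\<forall>x\<in>S. f x \<in> U"
        using s by (auto simp: eventually_nhdsin)
      then show "\<exists>T. openin \<tau> T \<and> s \<in> T \<and> T \<subseteq> {x \<in> topspace \<tau>. f x \<in> U}"
        using openin_subset by blast
    qed
  qed auto
qed

lemma continuous_map_approx:
  fixes f :: "'a \<Rightarrow> 'b::metric_space"
  assumes "\<And>e. e > 0 \<Longrightarrow> \<exists>g. continuous_map \<tau> euclidean g \<and> (\<forall>s. dist (f s) (g s) \<le> e)"
  shows "continuous_map \<tau> euclidean f"
  unfolding continuous_map_euclidean_tendsto_iff
proof (intro ballI tendstoI)
  fix s e assume s: "s \<in> topspace \<tau>" and e: "(0::real) < e"
  obtain g where g: "continuous_map \<tau> euclidean g" "\<And>s. dist (f s) (g s) \<le> e / 3"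
    using assms[of "e / 3"] e by auto
  then have "\<forall>\<^sub>F x in nhdsin \<tau> s. dist (g x) (g s) < e / 3"
    using s e by (intro tendstoD) (auto simp: continuous_map_euclidean_tendsto_iff)
  then show "\<forall>\<^sub>F x in nhdsin \<tau> s. dist (f x) (f s) < e"
  proof eventually_elim
    case (elim x)
    have "dist (f x) (f s) \<le> dist (f x) (g x) + dist (g x) (g s) + dist (f s) (g s)" by metric
    then show ?case using elim g(2)[of x] g(2)[of s] e by linarith
  qed
qed

text \<open>Filters on the index type take the place of nets: the preimages of the neighbourhoods of a
  closure point generate a proper filter along which \<open>h\<close> converges to it.\<close>

lemma in_closure_of_range_iff:
  "T \<in> X closure_of range h \<longleftrightarrow> (\<exists>\<F>. \<F> \<noteq> bot \<and> limitin X h T \<F>)"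
proof
  assume T: "T \<in> X closure_of range h"
  have "filtercomap h (nhdsin X T) \<noteq> bot"
  proof (rule filtercomap_neq_bot)
    fix P assume "eventually P (nhdsin X T)"
    then obtain S where "openin X S" "T \<in> S" "\<forall>x\<in>S. P x"
      using T by (auto simp: eventually_nhdsin in_closure_of)
    moreover from this obtain x where "h x \<in> S" using T unfolding in_closure_of by blast
    ultimately show "\<exists>x. P (h x)" by blast
  qed
  moreover have "limitin X h T (filtercomap h (nhdsin X T))"
    unfolding limitin_def
  proof (intro conjI allI impI)
    show "T \<in> topspace X" using T by (simp add: in_closure_of)
    fix U assume "openin X U \<and> T \<in> U"
    then have "eventually (\<lambda>x. x \<in> U) (nhdsin X T)" by (auto simp: eventually_nhdsin)
    then show "\<forall>\<^sub>F s in filtercomap h (nhdsin X T). h s \<in> U" by (rule eventually_filtercomapI)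
  qed
  ultimately show "\<exists>\<F>. \<F> \<noteq> bot \<and> limitin X h T \<F>" by blast
next
  assume "\<exists>\<F>. \<F> \<noteq> bot \<and> limitin X h T \<F>"
  then obtain \<F> where F: "\<F> \<noteq> bot" "limitin X h T \<F>" by blast
  show "T \<in> X closure_of range h"
    unfolding in_closure_of
  proof (intro conjI allI impI)
    show "T \<in> topspace X" using F by (simp add: limitin_def)
    fix U assume "T \<in> U \<and> openin X U"
    then have "\<forall>\<^sub>F s in \<F>. h s \<in> U" using F by (simp add: limitin_def)
    then obtain s where "h s \<in> U" using eventually_happens'[OF F(1)] by blast
    then show "\<exists>y. y \<in> range h \<and> y \<in> U" by blast
  qed
qed

subsection \<open>The weak operator topology\<close>

lemma topspace_weak_op_topology [simp]: "topspace (weak_op_topology K) = bounded_ops K"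
  by (simp add: weak_op_topology_def)

lemma continuous_map_weak_op_component:
  "x \<in> K \<Longrightarrow> y \<in> K \<Longrightarrow> continuous_map (weak_op_topology K) euclidean (\<lambda>T. cinner (T x) y)"
  unfolding weak_op_topology_def by (rule continuous_map_initial_topology_component) blast

lemma limitin_weak_op_iff:
  assumes "\<And>s. h s \<in> bounded_ops K"
  shows "limitin (weak_op_topology K) h T \<F> \<longleftrightarrow> T \<in> bounded_ops K \<and>
    (\<forall>x\<in>K. \<forall>y\<in>K. ((\<lambda>s. cinner (h s x) y) \<longlongrightarrow> cinner (T x) y) \<F>)"
proof (intro iffI conjI ballI)
  assume L: "limitin (weak_op_topology K) h T \<F>"
  then show "T \<in> bounded_ops K" by (simp add: limitin_def)
  fix x y assume "x \<in> K" "y \<in> K"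
  from continuous_map_limit[OF continuous_map_weak_op_component[OF this] L]
  show "((\<lambda>s. cinner (h s x) y) \<longlongrightarrow> cinner (T x) y) \<F>" by (simp add: o_def)
next
  assume "T \<in> bounded_ops K \<and> (\<forall>x\<in>K. \<forall>y\<in>K. ((\<lambda>s. cinner (h s x) y) \<longlongrightarrow> cinner (T x) y) \<F>)"
  then show "limitin (weak_op_topology K) h T \<F>"
    unfolding weak_op_topology_def using assms by (intro limitin_initial_topology) auto
qed

lemma continuous_map_weak_op_iff:
  "continuous_map \<tau> (weak_op_topology K) h \<longleftrightarrow> (\<forall>s\<in>topspace \<tau>. h s \<in> bounded_ops K) \<and>
    (\<forall>x\<in>K. \<forall>y\<in>K. continuous_map \<tau> euclidean (\<lambda>s. cinner (h s x) y))"
proof (intro iffI conjI ballI)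
  assume h: "continuous_map \<tau> (weak_op_topology K) h"
  show "h s \<in> bounded_ops K" if "s \<in> topspace \<tau>" for s
    using h that by (auto simp: continuous_map_def)
  fix x y assume "x \<in> K" "y \<in> K"
  from continuous_map_compose[OF h continuous_map_weak_op_component[OF this]]
  show "continuous_map \<tau> euclidean (\<lambda>s. cinner (h s x) y)" by (simp add: o_def)
next
  assume "(\<forall>s\<in>topspace \<tau>. h s \<in> bounded_ops K) \<and>
    (\<forall>x\<in>K. \<forall>y\<in>K. continuous_map \<tau> euclidean (\<lambda>s. cinner (h s x) y))"
  then show "continuous_map \<tau> (weak_op_topology K) h"
    unfolding weak_op_topology_def by (intro continuous_map_into_initial_topology) auto
qed

lemma bounded_opsD:
  assumes "T \<in> bounded_ops K"
  shows "x \<in> K \<Longrightarrow> T x \<in> K" "x \<notin> K \<Longrightarrow> T x = 0" "x \<in> K \<Longrightarrow> y \<in> K \<Longrightarrow> T (x + y) = T x + T y"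
    "x \<in> K \<Longrightarrow> T (c *\<^sub>C x) = c *\<^sub>C T x"
  using assms by (auto simp: bounded_ops_def)

lemma bounded_ops_bound: "T \<in> bounded_ops K \<Longrightarrow> \<exists>C. \<forall>x\<in>K. norm (T x) \<le> C * norm x"
  by (simp add: bounded_ops_def)

lemma bounded_ops_diff:
  assumes T: "T \<in> bounded_ops K" and K: "csubspace K" and xy: "x \<in> K" "y \<in> K"
  shows "T (x - y) = T x - T y"
  using bounded_opsD(3)[OF T xy(1), of "(-1) *\<^sub>C y"] bounded_opsD(4)[OF T xy(2), of "-1"]
    csubspaceD[OF K] xy by (simp add: scaleC_minus_one)

lemma bounded_ops_zero: "T \<in> bounded_ops K \<Longrightarrow> csubspace K \<Longrightarrow> T 0 = 0"
  using bounded_ops_diff[of T K 0 0] csubspaceD(1) by auto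

lemma bounded_ops_sum:
  assumes T: "T \<in> bounded_ops K" and K: "csubspace K" and x: "\<And>i. i \<in> A \<Longrightarrow> x i \<in> K"
  shows "T (\<Sum>i\<in>A. c i *\<^sub>C x i) = (\<Sum>i\<in>A. c i *\<^sub>C T (x i))"
  using x
proof (induction A rule: infinite_finite_induct)
  case (insert i A)
  have "c i *\<^sub>C x i \<in> K" "(\<Sum>i\<in>A. c i *\<^sub>C x i) \<in> K"
    using insert.prems by (auto intro!: csubspace_sum[OF K] csubspaceD[OF K])
  then show ?case using insert by (simp add: bounded_opsD(3,4)[OF T])
qed (simp_all add: bounded_ops_zero[OF T K])

lemma bounded_ops_tendsto:
  assumes T: "T \<in> bounded_ops K" and K: "csubspace K" and x: "\<And>n. x n \<in> K" "y \<in> K"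
    and lim: "(x \<longlongrightarrow> y) F"
  shows "((\<lambda>n. T (x n)) \<longlongrightarrow> T y) F"
proof -
  obtain C where C: "\<And>x. x \<in> K \<Longrightarrow> norm (T x) \<le> C * norm x" using bounded_ops_bound[OF T] by blast
  have "((\<lambda>n. C * norm (x n - y)) \<longlongrightarrow> C * norm (y - y)) F" by (intro tendsto_intros lim)
  then have *: "((\<lambda>n. C * norm (x n - y)) \<longlongrightarrow> 0) F" by simp
  have "norm (T (x n) - T y) \<le> C * norm (x n - y)" for n
    using C[of "x n - y"] bounded_ops_diff[OF T K x(1) x(2)] csubspaceD[OF K] x by simp
  then have "((\<lambda>n. T (x n) - T y) \<longlongrightarrow> 0) F"
    by (intro Lim_null_comparison[OF always_eventually *]) blast
  then show ?thesis by (rule LIM_zero_cancel)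
qed

lemma bounded_ops_closed_preimage:
  assumes T: "T \<in> bounded_ops K" and K: "csubspace K" "closed K" and S: "closed S"
  shows "closed {x \<in> K. T x \<in> S}"
  unfolding closed_sequential_limits
proof (intro allI impI, elim conjE)
  fix x l assume x: "\<forall>n. x n \<in> {x \<in> K. T x \<in> S}" and l: "x \<longlonglongrightarrow> l"
  then have "l \<in> K" using K(2) unfolding closed_sequential_limits by blast
  moreover have "(\<lambda>n. T (x n)) \<longlonglongrightarrow> T l" by (rule bounded_ops_tendsto[OF T K(1)]) (use x l \<open>l \<in> K\<close> in auto)
  then have "T l \<in> S" by (rule closed_sequentially[OF S, rotated]) (use x in auto)
  ultimately show "l \<in> {x \<in> K. T x \<in> S}" by blast
qed

lemma bounded_ops_comp:
  assumes "S \<in> bounded_ops K" "T \<in> bounded_ops K" "csubspace K" shows "S \<circ> T \<in> bounded_ops K"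
proof -
  obtain C where C: "\<And>x. x \<in> K \<Longrightarrow> norm (S x) \<le> C * norm x" using bounded_ops_bound[OF assms(1)] by blast
  obtain D where D: "\<And>x. x \<in> K \<Longrightarrow> norm (T x) \<le> D * norm x" using bounded_ops_bound[OF assms(2)] by blast
  have "norm (S (T x)) \<le> (\<bar>C\<bar> * \<bar>D\<bar>) * norm x" if "x \<in> K" for x
  proof -
    have "norm (S (T x)) \<le> C * norm (T x)" using C bounded_opsD(1)[OF assms(2) that] by blast
    also have "\<dots> \<le> \<bar>C\<bar> * norm (T x)" by (intro mult_right_mono) auto
    also have "\<dots> \<le> \<bar>C\<bar> * (\<bar>D\<bar> * norm x)"
    proof (rule mult_left_mono)
      have "norm (T x) \<le> D * norm x" by (rule D[OF that])
      also have "\<dots> \<le> \<bar>D\<bar> * norm x" by (intro mult_right_mono) auto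
      finally show "norm (T x) \<le> \<bar>D\<bar> * norm x" .
    qed simp
    finally show ?thesis by (simp add: mult.assoc)
  qed
  then have "\<exists>C. \<forall>x\<in>K. norm ((S \<circ> T) x) \<le> C * norm x" by auto
  then show ?thesis
    using bounded_ops_zero[OF assms(1,3)] bounded_opsD[OF assms(1)] bounded_opsD[OF assms(2)]
    by (simp add: bounded_ops_def[of K])
qed

lemma bounded_ops_scale:
  assumes T: "T \<in> bounded_ops K" and K: "csubspace K"
  shows "(\<lambda>x. c *\<^sub>C T x) \<in> bounded_ops K"
proof -
  obtain D where D: "\<And>x. x \<in> K \<Longrightarrow> norm (T x) \<le> D * norm x" using bounded_ops_bound[OF T] by blast
  have "norm (c *\<^sub>C T x) \<le> (cmod c * D) * norm x" if "x \<in> K" for x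
    using mult_left_mono[OF D[OF that], of "cmod c"] by (simp add: norm_scaleC mult.assoc)
  then have "\<exists>C. \<forall>x\<in>K. norm (c *\<^sub>C T x) \<le> C * norm x" by blast
  then show ?thesis using bounded_opsD[OF T] csubspaceD(3)[OF K]
    by (simp add: bounded_ops_def[of K] scaleC_add_right scaleC_scaleC mult.commute)
qed

lemma bounded_ops_plus:
  assumes S: "S \<in> bounded_ops K" and T: "T \<in> bounded_ops K" and K: "csubspace K"
  shows "(\<lambda>x. S x + T x) \<in> bounded_ops K"
proof -
  obtain C where C: "\<And>x. x \<in> K \<Longrightarrow> norm (S x) \<le> C * norm x" using bounded_ops_bound[OF S] by blast
  obtain D where D: "\<And>x. x \<in> K \<Longrightarrow> norm (T x) \<le> D * norm x" using bounded_ops_bound[OF T] by blast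
  have "norm (S x + T x) \<le> (C + D) * norm x" if "x \<in> K" for x
    using norm_triangle_ineq[of "S x" "T x"] C[OF that] D[OF that] by (simp add: distrib_right)
  then have "\<exists>C. \<forall>x\<in>K. norm (S x + T x) \<le> C * norm x" by blast
  then show ?thesis using bounded_opsD[OF S] bounded_opsD[OF T] csubspaceD(2)[OF K]
    by (simp add: bounded_ops_def[of K] scaleC_add_right)
qed

lemma op_id_bounded: "csubspace K \<Longrightarrow> op_id K \<in> bounded_ops K"
  by (auto simp: op_id_def op_restrict_def bounded_ops_def csubspaceD intro!: exI[of _ 1])

lemma bounded_ops_eqI:
  assumes "S \<in> bounded_ops K" "T \<in> bounded_ops K" "csubspace K"
    "\<And>x y. x \<in> K \<Longrightarrow> y \<in> K \<Longrightarrow> cinner (S x) y = cinner (T x) y"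
  shows "S = T"
proof
  fix x
  show "S x = T x"
  proof (cases "x \<in> K")
    case True
    then have "S x - T x \<in> K" using assms by (simp add: bounded_opsD csubspaceD)
    then have "S x - T x = 0"
      by (rule cinner_eq_zero_all[of K, rotated]) (use True assms(4) in \<open>simp add: cinner_diff_left\<close>)
    then show ?thesis by simp
  qed (simp add: bounded_opsD(2)[OF assms(1)] bounded_opsD(2)[OF assms(2)])
qed

lemma Hausdorff_weak_op_topology:
  assumes "csubspace K" shows "Hausdorff_space (weak_op_topology K)"
  unfolding Hausdorff_space_def topspace_weak_op_topology
proof (intro allI impI, elim conjE)
  fix S T assume ST: "S \<in> bounded_ops K" "T \<in> bounded_ops K" "S \<noteq> T"
  then obtain x y where xy: "x \<in> K" "y \<in> K" "cinner (S x) y \<noteq> cinner (T x) y"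
    using bounded_ops_eqI[OF _ _ assms] by blast
  then obtain U V where UV: "open U" "open V" "cinner (S x) y \<in> U" "cinner (T x) y \<in> V" "U \<inter> V = {}"
    by (meson hausdorff)
  let ?p = "\<lambda>W. {R \<in> bounded_ops K. cinner (R x) y \<in> W}"
  have "openin (weak_op_topology K) (?p W)" if "open W" for W
    using continuous_map_weak_op_component[OF xy(1,2)] that by (simp add: continuous_map_def)
  then show "\<exists>U V. openin (weak_op_topology K) U \<and> openin (weak_op_topology K) V \<and> S \<in> U \<and> T \<in> V \<and> disjnt U V"
    using UV ST by (intro exI[of _ "?p U"] exI[of _ "?p V"]) (auto simp: disjnt_def)
qed

section \<open>Vectors and operators on the GNS spaces\<close>

lemma gns_embed_add: "gns_embed (f + g) = gns_embed f + gns_embed g"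
  by (simp add: gns_embed_def plus_gns_total.abs_eq pd_equiv_refl pd_Cauchy_const)

lemma gns_embed_scale: "gns_embed (pd_scale c f) = c *\<^sub>C gns_embed f"
  by (simp add: gns_embed_def scaleC_gns_total_def gns_scaleC.abs_eq pd_equiv_refl pd_Cauchy_const)

lemma gns_embed_zero [simp]: "gns_embed 0 = 0"
  using gns_embed_diff[of 0 0] by simp

lemma gns_embed_sum: "gns_embed (\<Sum>i\<in>A. f i) = (\<Sum>i\<in>A. gns_embed (f i))"
  by (induction A rule: infinite_finite_induct) (auto simp: gns_embed_add)

lemma gns_embed_expand:
  "gns_embed f = (\<Sum>a\<in>Poly_Mapping.keys f. Poly_Mapping.lookup f a *\<^sub>C gns_vec (fst a) (snd a))"
proof -
  have "f = (\<Sum>a\<in>Poly_Mapping.keys f. pd_scale (Poly_Mapping.lookup f a) (Poly_Mapping.single a 1))"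
    by (rule poly_mapping_eqI)
       (simp add: lookup_sum lookup_single when_def in_keys_iff if_distrib cong: if_cong)
  then have "gns_embed f =
      gns_embed (\<Sum>a\<in>Poly_Mapping.keys f. pd_scale (Poly_Mapping.lookup f a) (Poly_Mapping.single a 1))"
    by simp
  then show ?thesis by (simp add: gns_embed_sum gns_embed_scale gns_vec_def)
qed

lemma gns_embed_sequence: obtains f where "(\<lambda>n. gns_embed (f n)) \<longlonglongrightarrow> x"
proof -
  have "\<exists>f. norm (x - gns_embed f) < inverse (real (Suc n))" for n
    by (rule gns_embed_dense[of "inverse (real (Suc n))" x]) auto
  then have "\<exists>f. \<forall>n. norm (x - gns_embed (f n)) < inverse (real (Suc n))" by (intro choice) blast
  then obtain f where f: "\<And>n. norm (x - gns_embed (f n)) < inverse (real (Suc n))" by blast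
  have "(\<lambda>n. norm (x - gns_embed (f n))) \<longlonglongrightarrow> 0"
    by (rule Lim_null_comparison[OF always_eventually LIMSEQ_inverse_real_of_nat])
       (use f in \<open>simp add: less_imp_le\<close>)
  then have "(\<lambda>n. norm (gns_embed (f n) - x)) \<longlonglongrightarrow> 0" by (simp only: norm_minus_commute)
  then have "(\<lambda>n. gns_embed (f n)) \<longlonglongrightarrow> x" by (rule LIM_zero_cancel[OF tendsto_norm_zero_cancel])
  then show thesis by (rule that)
qed

lemma closure_gns_embed: "closure (range gns_embed) = UNIV"
proof -
  have "x \<in> closure (range gns_embed)" for x :: "'g::group_add gns_total"
  proof -
    obtain f where "(\<lambda>n. gns_embed (f n)) \<longlonglongrightarrow> x" by (rule gns_embed_sequence)
    then show ?thesis unfolding closure_sequential by (intro exI[of _ "\<lambda>n. gns_embed (f n)"]) simp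
  qed
  then show ?thesis by blast
qed

lemma gns_vec_orthogonal: "u \<noteq> v \<Longrightarrow> cinner (gns_vec u s) (gns_vec v t) = 0"
  by (simp add: cinner_gns_vec)

text \<open>Each GNS space is universal for the kernels that it dominates: the map that sends \<open>gns_vec w s\<close> to
  \<open>x s\<close> is contractive on the span and extends by continuity. Letting it vanish on the other GNS
  spaces, which are orthogonal to that of \<open>w\<close>, defines it on the whole direct sum. With \<open>x = gns_vec w\<close>
  it is the projection onto the GNS space of \<open>w\<close>.\<close>

theorem gns_contraction_exists:
  fixes x :: "'g::group_add \<Rightarrow> 'h::complex_hilbert"
  assumes dom: "\<And>F c. finite F \<Longrightarrow> norm (\<Sum>s\<in>F. c s *\<^sub>C x s) \<le> norm (\<Sum>s\<in>F. c s *\<^sub>C gns_vec w s)"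
  obtains V :: "'g gns_total \<Rightarrow> 'h"
  where "\<And>y z. V (y + z) = V y + V z" "\<And>c y. V (c *\<^sub>C y) = c *\<^sub>C V y"
    "\<And>y. norm (V y) \<le> norm y" "\<And>s. V (gns_vec w s) = x s"
    "\<And>u s. u \<noteq> w \<Longrightarrow> V (gns_vec u s) = 0"
proof -
  define S where "S f = {s. (w, s) \<in> Poly_Mapping.keys f}" for f :: "'g pd_free"
  define V0 where "V0 f = (\<Sum>s\<in>S f. Poly_Mapping.lookup f (w, s) *\<^sub>C x s)" for f
  have fin: "finite (S f)" for f
  proof -
    have "S f \<subseteq> snd ` Poly_Mapping.keys f" by (force simp: S_def)
    then show ?thesis by (rule finite_subset) simp
  qed
  have V0_superset: "V0 f = (\<Sum>s\<in>B. Poly_Mapping.lookup f (w, s) *\<^sub>C x s)"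
    if "finite B" "S f \<subseteq> B" for f B
    unfolding V0_def using that by (intro sum.mono_neutral_left) (auto simp: S_def in_keys_iff)
  have V0_add: "V0 (f + g) = V0 f + V0 g" for f g
  proof -
    have "S (f + g) \<subseteq> S f \<union> S g" using keys_add[of f g] by (auto simp: S_def)
    then show ?thesis
      by (simp add: V0_superset[of "S f \<union> S g"] fin lookup_add scaleC_add_left sum.distrib)
  qed
  have V0_scale: "V0 (pd_scale c f) = c *\<^sub>C V0 f" for c f
  proof -
    have "S (pd_scale c f) \<subseteq> S f" using keys_pd_scale[of c f] by (auto simp: S_def)
    then show ?thesis
      by (simp add: V0_superset[of "S f"] fin scaleC_scaleC[symmetric] scaleC_sum_right)
  qed
  have V0_diff: "V0 (f - g) = V0 f - V0 g" for f g
    using V0_add[of f "pd_scale (-1) g"] V0_scale[of "-1" g]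
    by (simp add: pd_scale_minus1 scaleC_minus_one)
  have V0_norm: "norm (V0 f) \<le> norm (gns_embed f)" for f
  proof -
    let ?K = "Poly_Mapping.keys f" and ?l = "Poly_Mapping.lookup f"
    let ?e = "\<lambda>a. ?l a *\<^sub>C gns_vec (fst a) (snd a)"
    define A where "A = {a\<in>?K. fst a = w}"
    define B where "B = {a\<in>?K. fst a \<noteq> w}"
    have "?K = A \<union> B" "A \<inter> B = {}" "finite A" "finite B" by (auto simp: A_def B_def)
    then have split: "gns_embed f = sum ?e A + sum ?e B"
      unfolding gns_embed_expand by (simp add: sum.union_disjoint)
    (* The part of f over w is orthogonal to the rest, hence no longer than f. *)
    have "A = Pair w ` S f" by (force simp: A_def S_def)
    then have "sum ?e A = (\<Sum>s\<in>S f. ?l (w, s) *\<^sub>C gns_vec w s)"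
      by (simp add: sum.reindex inj_on_def)
    then have "norm (V0 f) \<le> norm (sum ?e A)" unfolding V0_def using dom[OF fin] by simp
    moreover have "cinner (sum ?e A) (sum ?e B) = 0"
      by (auto simp: cinner_sum_left cinner_sum_right cinner_scaleC_left cinner_scaleC_right
          A_def B_def intro!: sum.neutral gns_vec_orthogonal)
    then have "(norm (sum ?e A))\<^sup>2 \<le> (norm (gns_embed f))\<^sup>2"
      unfolding split by (simp add: norm_add_square)
    then have "norm (sum ?e A) \<le> norm (gns_embed f)" by (rule power2_le_imp_le) simp
    ultimately show ?thesis by linarith
  qed
  (* The bound makes V0 f depend only on the class of f, and Lipschitz. *)
  define V1 where "V1 y = V0 (SOME f. gns_embed f = y)" for y
  have V1: "V1 (gns_embed f) = V0 f" for f
  proof -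
    let ?g = "SOME g. gns_embed g = gns_embed f"
    have "gns_embed ?g = gns_embed f" by (rule someI) (rule refl)
    then have "norm (V0 ?g - V0 f) \<le> 0"
      using V0_norm[of "?g - f"] by (simp add: V0_diff gns_embed_diff)
    then show ?thesis by (simp add: V1_def)
  qed
  have "uniformly_continuous_on (range gns_embed) V1"
    unfolding uniformly_continuous_on_def
  proof (intro allI impI)
    fix e :: real assume "e > 0"
    then show "\<exists>d>0. \<forall>x\<in>range gns_embed. \<forall>x'\<in>range gns_embed. dist x' x < d \<longrightarrow> dist (V1 x') (V1 x) < e"
      using V0_norm by (intro exI[of _ e])
        (auto simp: V1 dist_norm simp flip: V0_diff gns_embed_diff intro: order.strict_trans1)
  qed
  then obtain V where uc: "uniformly_continuous_on (closure (range gns_embed)) V"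
    and V1V: "\<And>y. y \<in> range gns_embed \<Longrightarrow> V1 y = V y"
    using uniformly_continuous_on_extension_on_closure by metis
  have V: "V (gns_embed f) = V0 f" for f using V1V[of "gns_embed f"] V1 by simp
  have "isCont V y" for y
    using uniformly_continuous_imp_continuous[OF uc]
    unfolding closure_gns_embed by (simp add: continuous_on_eq_continuous_at)
  then have tendsto: "y \<longlonglongrightarrow> l \<Longrightarrow> (\<lambda>n. V (y n)) \<longlonglongrightarrow> V l" for y :: "nat \<Rightarrow> _" and l
    using isCont_tendsto_compose by blast
  show thesis
  proof (rule that)
    fix y z :: "'g gns_total" and c
    obtain f where f: "(\<lambda>n. gns_embed (f n)) \<longlonglongrightarrow> y" by (rule gns_embed_sequence)
    obtain g where g: "(\<lambda>n. gns_embed (g n)) \<longlonglongrightarrow> z" by (rule gns_embed_sequence)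
    have "(\<lambda>n. V (gns_embed (f n + g n))) \<longlonglongrightarrow> V (y + z)"
      unfolding gns_embed_add by (intro tendsto tendsto_intros f g)
    moreover have "(\<lambda>n. V (gns_embed (f n + g n))) \<longlonglongrightarrow> V y + V z"
      using tendsto_add[OF tendsto[OF f] tendsto[OF g]] by (simp add: V V0_add)
    ultimately show "V (y + z) = V y + V z" by (rule LIMSEQ_unique)
    have "(\<lambda>n. V (gns_embed (pd_scale c (f n)))) \<longlonglongrightarrow> V (c *\<^sub>C y)"
      unfolding gns_embed_scale by (intro tendsto tendsto_intros f)
    moreover have "(\<lambda>n. V (gns_embed (pd_scale c (f n)))) \<longlonglongrightarrow> c *\<^sub>C V y"
      using tendsto_scaleC[OF tendsto[OF f], of c] by (simp add: V V0_scale)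
    ultimately show "V (c *\<^sub>C y) = c *\<^sub>C V y" by (rule LIMSEQ_unique)
    show "norm (V y) \<le> norm y"
      by (rule LIMSEQ_le[OF tendsto_norm[OF tendsto[OF f]] tendsto_norm[OF f]])
         (auto simp: V V0_norm)
  next
    fix u s
    have keys: "S (Poly_Mapping.single (u, s) 1) = (if u = w then {s} else {})"
      by (auto simp: S_def)
    show "V (gns_vec w s) = x s"
      unfolding gns_vec_def V V0_def using keys by (cases "u = w") (auto simp: S_def)
    show "u \<noteq> w \<Longrightarrow> V (gns_vec u s) = 0"
      unfolding gns_vec_def V V0_def keys by simp
  qed
qed

lemma csubspace_closure:
  assumes D: "csubspace (D :: 'h::complex_hilbert set)" shows "csubspace (closure D)"
  unfolding csubspace_def
proof (intro conjI ballI allI)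
  show "0 \<in> closure D" using csubspaceD(1)[OF D] closure_subset by blast
  fix y assume "y \<in> closure D"
  then obtain Y where Y: "\<And>n. Y n \<in> D" "Y \<longlonglongrightarrow> y" unfolding closure_sequential by blast
  have "(\<lambda>n. c *\<^sub>C Y n) \<longlonglongrightarrow> c *\<^sub>C y" for c by (intro tendsto_intros Y)
  then show "c *\<^sub>C y \<in> closure D" for c
    unfolding closure_sequential using csubspaceD(3)[OF D Y(1)] by (intro exI[of _ "\<lambda>n. c *\<^sub>C Y n"]) simp
  fix z assume "z \<in> closure D"
  then obtain Z where Z: "\<And>n. Z n \<in> D" "Z \<longlonglongrightarrow> z" unfolding closure_sequential by blast
  have "(\<lambda>n. Y n + Z n) \<longlonglongrightarrow> y + z" by (intro tendsto_intros Y Z)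
  then show "y + z \<in> closure D"
    unfolding closure_sequential using csubspaceD(2)[OF D Y(1) Z(1)]
    by (intro exI[of _ "\<lambda>n. Y n + Z n"]) simp
qed

lemma closed_cspan_range_approx:
  fixes v :: "'i \<Rightarrow> 'h::complex_hilbert"
  assumes "z \<in> closed_cspan (range v)" "e > 0"
  obtains F c where "finite F" "norm (z - (\<Sum>s\<in>F. c s *\<^sub>C v s)) < e"
proof -
  define D where "D = {\<Sum>s\<in>F. c s *\<^sub>C v s | F c. finite F}"
  have D_I: "finite F \<Longrightarrow> (\<Sum>s\<in>F. c s *\<^sub>C v s) \<in> D" for F c by (auto simp: D_def)
  have D_add: "y + z \<in> D" if yz: "y \<in> D" "z \<in> D" for y z
  proof -
    obtain F c G d where y: "y = (\<Sum>s\<in>F. c s *\<^sub>C v s)" "finite F" and z: "z = (\<Sum>s\<in>G. d s *\<^sub>C v s)" "finite G"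
      using yz unfolding D_def by blast
    have 1: "y = (\<Sum>s\<in>F \<union> G. (if s \<in> F then c s else 0) *\<^sub>C v s)"
      unfolding y using y z by (intro sum.mono_neutral_cong_left) auto
    have 2: "z = (\<Sum>s\<in>F \<union> G. (if s \<in> G then d s else 0) *\<^sub>C v s)"
      unfolding z using y z by (intro sum.mono_neutral_cong_left) auto
    show ?thesis
      unfolding 1 2 sum.distrib[symmetric] scaleC_add_left[symmetric] using y z by (intro D_I) simp
  qed
  have D_scale: "a *\<^sub>C y \<in> D" if "y \<in> D" for y a
  proof -
    obtain F c where "y = (\<Sum>s\<in>F. c s *\<^sub>C v s)" "finite F" using \<open>y \<in> D\<close> unfolding D_def by blast
    then show ?thesis using D_I[of F "\<lambda>s. a * c s"] by (simp add: scaleC_sum_right scaleC_scaleC)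
  qed
  have "csubspace D"
    unfolding csubspace_def using D_I[of "{}"] D_add D_scale by simp
  then have "csubspace (closure D)" by (rule csubspace_closure)
  moreover have "v s \<in> closure D" for s
    using D_I[of "{s}" "\<lambda>_. 1"] closure_subset by auto
  then have "range v \<subseteq> closure D" by blast
  ultimately have "z \<in> closure D" using closed_cspan_least[of "closure D"] assms(1) by blast
  then obtain y where y: "y \<in> D" "dist y z < e" using assms(2) closure_approachable by blast
  obtain F c where "y = (\<Sum>s\<in>F. c s *\<^sub>C v s)" "finite F" using y(1) unfolding D_def by blast
  then show thesis using that[of F c] y(2) by (simp add: dist_norm norm_minus_commute)
qed

lemma gns_shift_add: "gns_shift t (x + y) = gns_shift t x + gns_shift t y"
proof transfer
  fix t :: 'a and X Y :: "nat \<Rightarrow> 'a pd_free"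
  assume "pd_equiv X X" "pd_equiv Y Y"
  then have "pd_Cauchy (\<lambda>n. pd_shift t (X n + Y n))"
    by (intro pd_Cauchy_shift pd_Cauchy_add) (auto simp: pd_equiv_def)
  moreover have "pd_shift t (f + g) = pd_shift t f + pd_shift t g" for f g :: "'a pd_free"
    by (rule poly_mapping_eqI) (auto simp: lookup_add)
  ultimately show "pd_equiv (\<lambda>n. pd_shift t (X n + Y n)) (\<lambda>n. pd_shift t (X n) + pd_shift t (Y n))"
    by (simp add: pd_equiv_refl)
qed

lemma gns_shift_scaleC: "gns_shift t (c *\<^sub>C x) = c *\<^sub>C gns_shift t x"
  unfolding scaleC_gns_total_def
proof transfer
  fix t :: 'a and c and X :: "nat \<Rightarrow> 'a pd_free"
  assume "pd_equiv X X"
  then have "pd_Cauchy (\<lambda>n. pd_shift t (pd_scale c (X n)))"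
    by (intro pd_Cauchy_shift pd_Cauchy_scale) (auto simp: pd_equiv_def)
  moreover have "pd_shift t (pd_scale c f) = pd_scale c (pd_shift t f)" for f :: "'a pd_free"
    by (rule poly_mapping_eqI) auto
  ultimately show "pd_equiv (\<lambda>n. pd_shift t (pd_scale c (X n))) (\<lambda>n. pd_scale c (pd_shift t (X n)))"
    by (simp add: pd_equiv_refl)
qed

lemma norm_gns_shift: "norm (gns_shift t x) = norm x"
  using arg_cong[OF cinner_gns_shift[of t x x], of Re] by (simp add: Re_cinner_self)

lemma bounded_linear_gns_shift: "bounded_linear (gns_shift t)"
proof
  fix x y :: "'a gns_total" and r
  show "gns_shift t (x + y) = gns_shift t x + gns_shift t y" by (rule gns_shift_add)
  show "gns_shift t (r *\<^sub>R x) = r *\<^sub>R gns_shift t x"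
    by (metis gns_shift_scaleC scaleC_of_real)
  show "\<exists>K. \<forall>x. norm (gns_shift t x) \<le> norm x * K" by (rule exI[of _ 1]) (simp add: norm_gns_shift)
qed

text \<open>The combinations of the vectors \<open>gns_vec u s\<close> are dense, so a closed linear condition, such as
  the equality of two bounded linear maps, needs to be checked on these vectors only.\<close>

lemma gns_total_induct [case_names vec add scale closed]:
  assumes "\<And>u s. P (gns_vec u s)" "\<And>x y. P x \<Longrightarrow> P y \<Longrightarrow> P (x + y)" "\<And>c x. P x \<Longrightarrow> P (c *\<^sub>C x)"
    "closed {x. P x}"
  shows "P (x :: 'g::group_add gns_total)"
proof -
  obtain f where f: "(\<lambda>n. gns_embed (f n)) \<longlonglongrightarrow> x" by (rule gns_embed_sequence)
  have P0: "P 0" using assms(3)[OF assms(1), of 0] by simp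
  have "P (\<Sum>a\<in>A. c a *\<^sub>C gns_vec (fst a) (snd a))" for A and c :: "_ \<Rightarrow> complex"
    by (induction A rule: infinite_finite_induct) (use P0 assms in auto)
  then have "gns_embed (f n) \<in> {x. P x}" for n unfolding gns_embed_expand by simp
  then have "x \<in> {x. P x}" by (rule closed_sequentially[OF assms(4) _ f])
  then show ?thesis by simp
qed

lemma gns_shift_zero: "gns_shift 0 x = x"
proof (induction x rule: gns_total_induct)
  case closed
  show ?case by (intro closed_Collect_eq continuous_on_id linear_continuous_on bounded_linear_gns_shift)
qed (auto simp: gns_shift_vec gns_shift_add gns_shift_scaleC)

lemma gns_shift_plus: "gns_shift (s + t) x = gns_shift s (gns_shift t x)"
proof (induction x rule: gns_total_induct)
  case closed
  show ?case
    by (intro closed_Collect_eq linear_continuous_on bounded_linear_gns_shift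
        bounded_linear_compose[OF bounded_linear_gns_shift bounded_linear_gns_shift])
qed (auto simp: gns_shift_vec gns_shift_add gns_shift_scaleC add.assoc)

section \<open>Unitary representations and their coefficients\<close>

lemma continuous_map_cmult:
  "continuous_map \<tau> euclidean f \<Longrightarrow> continuous_map \<tau> euclidean (\<lambda>s. c * f s :: complex)"
  by (simp add: continuous_map_euclidean_tendsto_iff tendsto_mult_left)

lemma continuous_map_cadd:
  "continuous_map \<tau> euclidean f \<Longrightarrow> continuous_map \<tau> euclidean g \<Longrightarrow>
    continuous_map \<tau> euclidean (\<lambda>s. f s + g s :: complex)"
  by (simp add: continuous_map_euclidean_tendsto_iff tendsto_add)

lemma continuous_map_cmult2:
  "continuous_map \<tau> euclidean f \<Longrightarrow> continuous_map \<tau> euclidean g \<Longrightarrow>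
    continuous_map \<tau> euclidean (\<lambda>s. f s * g s :: complex)"
  by (simp add: continuous_map_euclidean_tendsto_iff tendsto_mult)

text \<open>The coefficient functions depend on the vector uniformly over the group, and uniform limits of
  continuous functions are continuous.\<close>

lemma closed_continuous_coefficients:
  fixes h :: "'h::complex_hilbert \<Rightarrow> 's \<Rightarrow> complex"
  assumes lip: "\<And>x y s. cmod (h x s - h y s) \<le> C * norm (x - y)"
  shows "closed {x. continuous_map \<tau> euclidean (h x)}"
  unfolding closed_sequential_limits
proof (intro allI impI, elim conjE)
  fix X x assume X: "\<forall>n. X n \<in> {x. continuous_map \<tau> euclidean (h x)}" and lim: "X \<longlonglongrightarrow> x"
  have "continuous_map \<tau> euclidean (h x)"
  proof (rule continuous_map_approx)
    fix e :: real assume e: "e > 0"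
    have "(\<lambda>n. C * norm (x - X n)) \<longlonglongrightarrow> C * norm (x - x)" by (intro tendsto_intros lim)
    then have "(\<lambda>n. C * norm (x - X n)) \<longlonglongrightarrow> 0" by simp
    then have "\<forall>\<^sub>F n in sequentially. C * norm (x - X n) < e" using e by (rule order_tendstoD)
    then obtain n where "C * norm (x - X n) < e" using eventually_happens' by force
    then have "dist (h x s) (h (X n) s) \<le> e" for s
      using lip[of x s "X n"] by (simp add: dist_norm)
    then show "\<exists>g. continuous_map \<tau> euclidean g \<and> (\<forall>s. dist (h x s) (g s) \<le> e)"
      using X by blast
  qed
  then show "x \<in> {x. continuous_map \<tau> euclidean (h x)}" by simp
qed

lemma unitary_repD:
  assumes "unitary_rep \<tau> K \<pi>"
  shows "csubspace K" "closed K" "\<pi> s \<in> bounded_ops K" "x \<in> K \<Longrightarrow> \<pi> 0 x = x"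
    "\<pi> (s + t) = \<pi> s \<circ> \<pi> t" "x \<in> K \<Longrightarrow> y \<in> K \<Longrightarrow> cinner (\<pi> s x) (\<pi> s y) = cinner x y"
    "x \<in> K \<Longrightarrow> norm (\<pi> s x) = norm x" "x \<in> K \<Longrightarrow> \<pi> s x \<in> K"
    "x \<in> K \<Longrightarrow> y \<in> K \<Longrightarrow> cinner (\<pi> s x) y = cinner x (\<pi> (- s) y)"
    "x \<in> K \<Longrightarrow> y \<in> K \<Longrightarrow> continuous_map \<tau> euclidean (\<lambda>s. cinner (\<pi> s x) y)"
proof -
  show 1: "csubspace K" "closed K" "\<And>s. \<pi> s \<in> bounded_ops K"
    "\<And>s t. \<pi> (s + t) = \<pi> s \<circ> \<pi> t" "\<And>s x y. x \<in> K \<Longrightarrow> y \<in> K \<Longrightarrow> cinner (\<pi> s x) (\<pi> s y) = cinner x y"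
    using assms by (auto simp: unitary_rep_def)
  show 0: "\<And>x. x \<in> K \<Longrightarrow> \<pi> 0 x = x"
    using assms by (auto simp: unitary_rep_def op_id_def op_restrict_def)
  show K: "\<And>s x. x \<in> K \<Longrightarrow> \<pi> s x \<in> K" using 1(3) by (rule bounded_opsD)
  show "x \<in> K \<Longrightarrow> norm (\<pi> s x) = norm x"
    using arg_cong[OF 1(5)[of x x s], of Re] by (simp add: Re_cinner_self)
  show "x \<in> K \<Longrightarrow> y \<in> K \<Longrightarrow> continuous_map \<tau> euclidean (\<lambda>s. cinner (\<pi> s x) y)"
    using assms by (auto simp: unitary_rep_def continuous_map_weak_op_iff)
  assume xy: "x \<in> K" "y \<in> K"
  have "y = \<pi> s (\<pi> (- s) y)"
    using fun_cong[OF 1(4)[of s "- s"], of y] 0[OF xy(2)] by simp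
  then show "cinner (\<pi> s x) y = cinner x (\<pi> (- s) y)"
    using 1(5)[OF xy(1) K[OF xy(2)], of s "- s"] by simp
qed

text \<open>This identity makes a diagonal coefficient positive definite and, later on, the map from its GNS
  space into the space of the representation isometric.\<close>

lemma coefficient_gram:
  assumes "unitary_rep \<tau> K \<pi>" "\<xi> \<in> K"
  shows "coefficient \<pi> \<xi> \<xi> (- t + s) = cinner (\<pi> s \<xi>) (\<pi> t \<xi>)"
proof -
  note rep = unitary_repD[OF assms(1)]
  show ?thesis
    using rep(9)[OF rep(8)[OF assms(2), of s] assms(2), of "- t"] fun_cong[OF rep(5)[of "- t" s], of \<xi>]
    by (simp add: coefficient_def)
qed

lemma coefficient_cont_pos_def:
  assumes "unitary_rep \<tau> K \<pi>" "\<xi> \<in> K"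
  shows "coefficient \<pi> \<xi> \<xi> \<in> cont_pos_def \<tau>"
  unfolding cont_pos_def_def
proof (intro CollectI conjI)
  show "pos_def (coefficient \<pi> \<xi> \<xi>)"
    unfolding pos_def_def coefficient_gram[OF assms] norm_sum_scaleC_square[symmetric] by simp
  show "continuous_map \<tau> euclidean (coefficient \<pi> \<xi> \<xi>)"
    unfolding coefficient_def by (rule unitary_repD(10)[OF assms(1)]) (use assms in auto)
qed

lemma fs_zero: "(\<lambda>s. 0) \<in> fs_algebra \<tau>"
  unfolding fs_algebra_def by (intro CollectI exI[of _ "{}"]) simp

lemma fs_base: "v \<in> cont_pos_def \<tau> \<Longrightarrow> v \<in> fs_algebra \<tau>"
  unfolding fs_algebra_def by (intro CollectI exI[of _ "{v}"] exI[of _ "\<lambda>_. 1"]) simp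

lemma fs_scale: assumes "u \<in> fs_algebra \<tau>" shows "(\<lambda>s. c * u s) \<in> fs_algebra \<tau>"
proof -
  obtain F d where F: "finite F" "F \<subseteq> cont_pos_def \<tau>" "u = (\<lambda>s. \<Sum>v\<in>F. d v * v s)"
    using assms unfolding fs_algebra_def by blast
  then show ?thesis
    unfolding fs_algebra_def
    by (intro CollectI exI[of _ F] exI[of _ "\<lambda>v. c * d v"]) (simp add: sum_distrib_left mult.assoc)
qed

lemma fs_add: assumes "u \<in> fs_algebra \<tau>" "v \<in> fs_algebra \<tau>" shows "(\<lambda>s. u s + v s) \<in> fs_algebra \<tau>"
proof -
  obtain F c where F: "finite F" "F \<subseteq> cont_pos_def \<tau>" "u = (\<lambda>s. \<Sum>v\<in>F. c v * v s)"
    using assms(1) unfolding fs_algebra_def by blast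
  obtain G d where G: "finite G" "G \<subseteq> cont_pos_def \<tau>" "v = (\<lambda>s. \<Sum>v\<in>G. d v * v s)"
    using assms(2) unfolding fs_algebra_def by blast
  have 1: "(\<Sum>v\<in>F. c v * v s) = (\<Sum>v\<in>F \<union> G. (if v \<in> F then c v else 0) * v s)" for s
    using F G by (intro sum.mono_neutral_cong_left) auto
  have 2: "(\<Sum>v\<in>G. d v * v s) = (\<Sum>v\<in>F \<union> G. (if v \<in> G then d v else 0) * v s)" for s
    using F G by (intro sum.mono_neutral_cong_left) auto
  show ?thesis
    unfolding fs_algebra_def F(3) G(3) 1 2 sum.distrib[symmetric] distrib_right[symmetric]
    by (intro CollectI exI[of _ "F \<union> G"]
        exI[of _ "\<lambda>v. (if v \<in> F then c v else 0) + (if v \<in> G then d v else 0)"]) (use F G in simp)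
qed

lemma fs_sum:
  "(\<And>i. i \<in> A \<Longrightarrow> f i \<in> fs_algebra \<tau>) \<Longrightarrow> (\<lambda>s. \<Sum>i\<in>A. f i s) \<in> fs_algebra \<tau>"
proof (induction A rule: infinite_finite_induct)
  case (insert i A)
  then show ?case using fs_add[of "f i" \<tau> "\<lambda>s. \<Sum>i\<in>A. f i s"] by simp
qed (simp_all add: fs_zero)

lemma coefficient_polarisation:
  assumes "unitary_rep \<tau> K \<pi>" "\<xi> \<in> K" "\<eta> \<in> K"
  shows "coefficient \<pi> \<xi> \<eta> s = (\<Sum>a\<in>{1, \<i>, -1, -\<i>}. a / 4 * coefficient \<pi> (\<xi> + a *\<^sub>C \<eta>) (\<xi> + a *\<^sub>C \<eta>) s)"
proof -
  note rep = unitary_repD[OF assms(1)]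
  have expand: "coefficient \<pi> (\<xi> + a *\<^sub>C \<eta>) (\<xi> + a *\<^sub>C \<eta>) s
      = cinner (\<pi> s \<xi>) \<xi> + cnj a * cinner (\<pi> s \<xi>) \<eta> + a * cinner (\<pi> s \<eta>) \<xi> + a * cnj a * cinner (\<pi> s \<eta>) \<eta>" for a
    using assms rep(1,3)
    by (simp add: coefficient_def bounded_opsD(3,4)[OF rep(3)] csubspaceD cinner_add_left cinner_add_right
        cinner_scaleC_left cinner_scaleC_right distrib_left)
  have "(\<Sum>a\<in>{1, \<i>, -1, -\<i>}. a / 4 * (A + cnj a * B + a * C + a * cnj a * D)) = B" for A B C D
    by (simp add: algebra_simps complex_eq_iff)
  then show ?thesis unfolding expand by (simp only: coefficient_def)
qed

text \<open>By polarisation a coefficient is a combination of four diagonal ones.\<close>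

lemma coefficient_in_fs_algebra:
  assumes "unitary_rep \<tau> K \<pi>" "\<xi> \<in> K" "\<eta> \<in> K"
  shows "coefficient \<pi> \<xi> \<eta> \<in> fs_algebra \<tau>"
proof -
  have "(\<lambda>s. \<Sum>a\<in>{1, \<i>, -1, -\<i>}. a / 4 * coefficient \<pi> (\<xi> + a *\<^sub>C \<eta>) (\<xi> + a *\<^sub>C \<eta>) s) \<in> fs_algebra \<tau>"
  proof (intro fs_sum fs_scale fs_base coefficient_cont_pos_def[OF assms(1)])
    fix a show "\<xi> + a *\<^sub>C \<eta> \<in> K" using assms unitary_repD(1)[OF assms(1)] by (simp add: csubspaceD)
  qed
  then show ?thesis
    by (simp only: coefficient_polarisation[OF assms, abs_def, symmetric] eta_contract_eq)
qed

subsection \<open>Products of positive definite functions\<close>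

text \<open>Schur's product theorem. Projecting the Gram vectors off one of them splits the Gram matrix
  into a matrix of rank one and a Gram matrix with one vector less.\<close>

lemma Schur_product:
  fixes e :: "'i \<Rightarrow> 'h::complex_hilbert"
  assumes N: "\<And>F d. finite F \<Longrightarrow> (\<Sum>s\<in>F. \<Sum>t\<in>F. d s * cnj (d t) * N s t) \<in> \<real>\<^sub>\<ge>\<^sub>0"
    and "finite F"
  shows "(\<Sum>s\<in>F. \<Sum>t\<in>F. N s t * cinner (e s) (e t)) \<in> \<real>\<^sub>\<ge>\<^sub>0"
  using assms(2)
proof (induction F arbitrary: e)
  case (insert x F)
  let ?r = "complex_of_real (norm (e x))"
  (* For e x = 0 the quotients are 0 by convention, and e' = e has the same property e' x = 0. *)
  define a where "a s = cinner (e s) (e x) / ?r" for s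
  define e' where "e' s = e s - (a s / ?r) *\<^sub>C e x" for s
  have "cinner (e s) (e t) = cinner (e' s) (e' t) + a s * cnj (a t)" for s t
  proof (cases "e x = 0")
    case False
    then have r: "?r \<noteq> 0" by simp
    have 1: "cinner (e s) (e x) = a s * ?r" "cinner (e x) (e t) = cnj (a t) * ?r"
      using r cinner_commute[of "e x" "e t"] by (simp_all add: a_def)
    have 2: "cinner (e x) (e x) = ?r * ?r" by (simp add: cinner_self power2_eq_square)
    show ?thesis
      unfolding e'_def
      by (simp add: cinner_diff_left cinner_diff_right cinner_scaleC_left cinner_scaleC_right 1 2)
         (use r in \<open>simp add: field_simps\<close>)
  qed (simp add: e'_def a_def)
  then have "(\<Sum>s\<in>insert x F. \<Sum>t\<in>insert x F. N s t * cinner (e s) (e t))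
    = (\<Sum>s\<in>insert x F. \<Sum>t\<in>insert x F. N s t * cinner (e' s) (e' t))
      + (\<Sum>s\<in>insert x F. \<Sum>t\<in>insert x F. a s * cnj (a t) * N s t)"
    by (simp only: distrib_left sum.distrib mult_ac)
  moreover have "e' x = 0"
    by (cases "e x = 0") (simp_all add: e'_def a_def cinner_self power2_eq_square)
  then have "(\<Sum>s\<in>insert x F. \<Sum>t\<in>insert x F. N s t * cinner (e' s) (e' t))
    = (\<Sum>s\<in>F. \<Sum>t\<in>F. N s t * cinner (e' s) (e' t))"
    using insert.hyps by simp
  ultimately show ?case
    using insert.IH[of e'] N[of "insert x F" a] insert.hyps(1) by (simp only: nonneg_Reals_add_I finite_insert)
qed simp

lemma pos_def_mult:
  fixes u v :: "'g::group_add \<Rightarrow> complex"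
  assumes "pos_def u" "pos_def v" shows "pos_def (\<lambda>s. u s * v s)"
  unfolding pos_def_def
proof (intro allI impI)
  fix F :: "'g set" and c :: "'g \<Rightarrow> complex" assume F: "finite F"
  have "(\<Sum>s\<in>F. \<Sum>t\<in>F. (c s * cnj (c t) * u (- t + s)) * cinner (gns_vec v s) (gns_vec v t)) \<in> \<real>\<^sub>\<ge>\<^sub>0"
  proof (rule Schur_product[where N = "\<lambda>s t. c s * cnj (c t) * u (- t + s)", OF _ F])
    fix A :: "'g set" and d :: "'g \<Rightarrow> complex" assume "finite A"
    then have "(\<Sum>s\<in>A. \<Sum>t\<in>A. (d s * c s) * cnj (d t * c t) * u (- t + s)) \<in> \<real>\<^sub>\<ge>\<^sub>0"
      using assms(1)[unfolded pos_def_def, rule_format, of A "\<lambda>s. d s * c s"] by simp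
    then show "(\<Sum>s\<in>A. \<Sum>t\<in>A. d s * cnj (d t) * (c s * cnj (c t) * u (- t + s))) \<in> \<real>\<^sub>\<ge>\<^sub>0"
      by (simp add: mult_ac)
  qed
  then show "(\<Sum>s\<in>F. \<Sum>t\<in>F. c s * cnj (c t) * (u (- t + s) * v (- t + s))) \<in> \<real>\<^sub>\<ge>\<^sub>0"
    using assms(2) by (simp add: cinner_gns_vec mult.assoc)
qed

lemma cont_pos_def_mult:
  "u \<in> cont_pos_def \<tau> \<Longrightarrow> v \<in> cont_pos_def \<tau> \<Longrightarrow> (\<lambda>s. u s * v s) \<in> cont_pos_def \<tau>"
  by (simp add: cont_pos_def_def pos_def_mult continuous_map_cmult2)

lemma fs_mult:
  assumes "u \<in> fs_algebra \<tau>" "v \<in> fs_algebra \<tau>" shows "(\<lambda>s. u s * v s) \<in> fs_algebra \<tau>"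
proof -
  obtain F c where F: "finite F" "F \<subseteq> cont_pos_def \<tau>" "u = (\<lambda>s. \<Sum>v\<in>F. c v * v s)"
    using assms(1) unfolding fs_algebra_def by blast
  obtain G d where G: "finite G" "G \<subseteq> cont_pos_def \<tau>" "v = (\<lambda>s. \<Sum>v\<in>G. d v * v s)"
    using assms(2) unfolding fs_algebra_def by blast
  have "u s * v s = (\<Sum>x\<in>F. \<Sum>y\<in>G. c x * d y * (x s * y s))" for s
    unfolding F(3) G(3) sum_product by (simp add: mult_ac)
  moreover have "(\<lambda>s. \<Sum>x\<in>F. \<Sum>y\<in>G. c x * d y * (x s * y s)) \<in> fs_algebra \<tau>"
    using F(2) G(2) by (intro fs_sum fs_scale fs_base cont_pos_def_mult) auto
  ultimately show ?thesis by simp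
qed

section \<open>The universal representation\<close>

lemma gns_shift_0 [simp]: "gns_shift t 0 = 0"
  and gns_shift_diff: "gns_shift t (x - y) = gns_shift t x - gns_shift t y"
  using linear_0 linear_diff bounded_linear.linear[OF bounded_linear_gns_shift] by blast+

lemma gns_space_subset: "u \<in> cont_pos_def \<tau> \<Longrightarrow> gns_space u \<subseteq> univ_space \<tau>"
  unfolding univ_space_def using closed_cspan_superset[of "\<Union>u\<in>cont_pos_def \<tau>. gns_space u"] by blast

lemma gns_vec_in_gns_space: "gns_vec u s \<in> gns_space u"
  unfolding gns_space_def using closed_cspan_superset[of "range (gns_vec u)"] by blast

lemma gns_vec_in_univ_space: "u \<in> cont_pos_def \<tau> \<Longrightarrow> gns_vec u s \<in> univ_space \<tau>"
  using gns_space_subset gns_vec_in_gns_space by blast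

lemma csubspace_univ_space: "csubspace (univ_space \<tau>)"
  and closed_univ_space: "closed (univ_space \<tau>)"
  unfolding univ_space_def by (rule csubspace_closed_cspan closed_closed_cspan)+

lemma univ_space_least:
  assumes "csubspace L" "closed L" "\<And>u s. u \<in> cont_pos_def \<tau> \<Longrightarrow> gns_vec u s \<in> L"
  shows "univ_space \<tau> \<subseteq> L"
  unfolding univ_space_def
proof (intro closed_cspan_least assms(1,2) UN_least)
  fix u assume "u \<in> cont_pos_def \<tau>"
  then show "gns_space u \<subseteq> L"
    unfolding gns_space_def by (intro closed_cspan_least assms(1,2)) (use assms(3) in auto)
qed

lemma univ_space_induct [consumes 1, case_names vec zero add scale closed]:
  assumes "x \<in> univ_space \<tau>" "\<And>u s. u \<in> cont_pos_def \<tau> \<Longrightarrow> P (gns_vec u s)" "P 0"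
    "\<And>x y. P x \<Longrightarrow> P y \<Longrightarrow> P (x + y)" "\<And>c x. P x \<Longrightarrow> P (c *\<^sub>C x)" "closed {x. P x}"
  shows "P x"
  using univ_space_least[of "{x. P x}" \<tau>] assms by (auto simp: csubspace_def)

lemma gns_shift_in_univ_space: "x \<in> univ_space \<tau> \<Longrightarrow> gns_shift s x \<in> univ_space \<tau>"
proof (induction x rule: univ_space_induct)
  case zero
  show ?case using csubspaceD(1)[OF csubspace_univ_space] by simp
next
  case closed
  have "closed (gns_shift s -` univ_space \<tau>)"
    by (intro closed_vimage closed_univ_space linear_continuous_on bounded_linear_gns_shift)
  then show ?case by (simp add: vimage_def)
qed (auto simp: gns_shift_vec gns_shift_add gns_shift_scaleC csubspaceD[OF csubspace_univ_space]
      intro: gns_vec_in_univ_space)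

lemma univ_rep_apply: "x \<in> univ_space \<tau> \<Longrightarrow> univ_rep \<tau> s x = gns_shift s x"
  by (simp add: univ_rep_def op_restrict_def)

lemma univ_rep_bounded: "univ_rep \<tau> s \<in> bounded_ops (univ_space \<tau>)"
proof -
  have "\<exists>C. \<forall>x\<in>univ_space \<tau>. norm (univ_rep \<tau> s x) \<le> C * norm x"
    by (intro exI[of _ 1]) (simp add: univ_rep_apply norm_gns_shift)
  then show ?thesis
    by (auto simp: bounded_ops_def univ_rep_def op_restrict_def gns_shift_in_univ_space gns_shift_add
        gns_shift_scaleC csubspaceD[OF csubspace_univ_space])
qed

lemma continuous_map_shift:
  assumes "group_topology \<tau>" "continuous_map \<tau> euclidean u"
  shows "continuous_map \<tau> euclidean (\<lambda>s. u (b + (s + a)))"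
proof -
  have top: "topspace \<tau> = UNIV" and add: "continuous_map (prod_topology \<tau> \<tau>) \<tau> (\<lambda>(s, t). s + t)"
    using assms(1) by (auto simp: group_topology_def)
  have "continuous_map \<tau> (prod_topology \<tau> \<tau>) (\<lambda>s. (s, a))"
    using top by (simp add: continuous_map_pairwise o_def)
  from continuous_map_compose[OF this add] have 1: "continuous_map \<tau> \<tau> (\<lambda>s. s + a)"
    by (simp add: o_def)
  have "continuous_map \<tau> (prod_topology \<tau> \<tau>) (\<lambda>s. (b, s))"
    using top by (simp add: continuous_map_pairwise o_def)
  from continuous_map_compose[OF this add] have 2: "continuous_map \<tau> \<tau> (\<lambda>s. b + s)"
    by (simp add: o_def)
  from continuous_map_compose[OF continuous_map_compose[OF 1 2] assms(2)] show ?thesis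
    by (simp add: o_def)
qed

text \<open>On the generators the coefficients are translates of continuous positive definite functions or
  zero; the general case follows by density, first in the second argument and then in the first.\<close>

lemma univ_rep_continuous:
  fixes \<tau> :: "'g::group_add topology"
  assumes "group_topology \<tau>" "x \<in> univ_space \<tau>"
  shows "continuous_map \<tau> euclidean (\<lambda>s. cinner (gns_shift s x) y)"
  using assms(2)
proof (induction x arbitrary: y rule: univ_space_induct)
  case (vec u a)
  show ?case
  proof (induction y rule: gns_total_induct)
    case (vec v b)
    show ?case
      using continuous_map_shift[OF assms(1), of u "- b" a] \<open>u \<in> cont_pos_def \<tau>\<close>
      by (auto simp: gns_shift_vec cinner_gns_vec cont_pos_def_def)
  next
    case closed
    show ?case
    proof (rule closed_continuous_coefficients)
      fix x y s
      show "cmod (cinner (gns_shift s (gns_vec u a)) x - cinner (gns_shift s (gns_vec u a)) y)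
        \<le> norm (gns_vec u a) * norm (x - y)"
        using cinner_Cauchy_Schwarz[of "gns_shift s (gns_vec u a)" "x - y"]
        by (simp add: cinner_diff_right norm_gns_shift)
    qed
  qed (auto simp: cinner_add_right cinner_scaleC_right intro!: continuous_map_cadd continuous_map_cmult)
next
  case zero
  show ?case by simp
next
  case closed
  have "closed {x. continuous_map \<tau> euclidean (\<lambda>s. cinner (gns_shift s x) y)}" for y
  proof (rule closed_continuous_coefficients)
    fix x x' :: "'g gns_total" and s
    have "gns_shift s x - gns_shift s x' = gns_shift s (x - x')"
      by (simp add: gns_shift_diff)
    then show "cmod (cinner (gns_shift s x) y - cinner (gns_shift s x') y) \<le> norm y * norm (x - x')"
      using cinner_Cauchy_Schwarz[of "gns_shift s (x - x')" y]
      by (simp add: norm_gns_shift mult.commute flip: cinner_diff_left)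
  qed
  then show ?case by (rule closed_Collect_all)
qed (auto simp: gns_shift_add gns_shift_scaleC cinner_add_left cinner_scaleC_left
      intro!: continuous_map_cadd continuous_map_cmult)

lemma univ_rep_add: "univ_rep \<tau> (s + t) = univ_rep \<tau> s \<circ> univ_rep \<tau> t"
  by (rule ext) (auto simp: univ_rep_def op_restrict_def gns_shift_plus gns_shift_in_univ_space)

lemma unitary_univ_rep:
  assumes "group_topology \<tau>" shows "unitary_rep \<tau> (univ_space \<tau>) (univ_rep \<tau>)"
proof -
  have "univ_rep \<tau> 0 = op_id (univ_space \<tau>)"
    by (rule ext) (simp add: univ_rep_def op_restrict_def op_id_def gns_shift_zero)
  then show ?thesis
    unfolding unitary_rep_def continuous_map_weak_op_iff
    using univ_rep_bounded univ_rep_add univ_rep_continuous[OF assms]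
    by (auto simp: csubspace_univ_space closed_univ_space univ_rep_apply cinner_gns_shift)
qed

text \<open>The cyclic vectors of distinct positive definite functions lie in orthogonal invariant subspaces,
  so a linear combination of such functions is a single coefficient of the universal representation.\<close>

lemma sum_gns_coefficients:
  assumes F: "finite F" "F \<subseteq> cont_pos_def \<tau>"
  shows "coefficient (univ_rep \<tau>) (\<Sum>v\<in>F. c v *\<^sub>C gns_vec v 0) (\<Sum>v\<in>F. gns_vec v 0) s = (\<Sum>v\<in>F. c v * v s)"
proof -
  have shift: "univ_rep \<tau> s (\<Sum>v\<in>F. c v *\<^sub>C gns_vec v 0) = (\<Sum>v\<in>F. c v *\<^sub>C gns_vec v s)"
    using F(2) by (subst bounded_ops_sum[OF univ_rep_bounded csubspace_univ_space])
      (auto simp: univ_rep_apply gns_shift_vec gns_vec_in_univ_space subset_iff intro!: sum.cong)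
  have "coefficient (univ_rep \<tau>) (\<Sum>v\<in>F. c v *\<^sub>C gns_vec v 0) (\<Sum>v\<in>F. gns_vec v 0) s
    = (\<Sum>v\<in>F. \<Sum>w\<in>F. c v * cinner (gns_vec v s) (gns_vec w 0))"
    unfolding coefficient_def shift cinner_sum_left
    by (simp add: cinner_sum_right cinner_scaleC_left sum_distrib_left)
  also have "\<dots> = (\<Sum>v\<in>F. \<Sum>w\<in>F. if w = v then c v * v s else 0)"
    using F(2) by (intro sum.cong refl) (auto simp: cinner_gns_vec cont_pos_def_def)
  finally show ?thesis using F(1) by simp
qed

lemma fs_algebra_coefficient:
  assumes "u \<in> fs_algebra \<tau>"
  obtains \<xi> \<eta> where "\<xi> \<in> univ_space \<tau>" "\<eta> \<in> univ_space \<tau>" "u = coefficient (univ_rep \<tau>) \<xi> \<eta>"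
proof -
  obtain F c where F: "finite F" "F \<subseteq> cont_pos_def \<tau>" "u = (\<lambda>s. \<Sum>v\<in>F. c v * v s)"
    using assms(1) unfolding fs_algebra_def by blast
  have "u = coefficient (univ_rep \<tau>) (\<Sum>v\<in>F. c v *\<^sub>C gns_vec v 0) (\<Sum>v\<in>F. gns_vec v 0)"
    using sum_gns_coefficients[OF F(1,2)] F(3) by auto
  moreover have "(\<Sum>v\<in>F. c v *\<^sub>C gns_vec v 0) \<in> univ_space \<tau>" "(\<Sum>v\<in>F. gns_vec v 0) \<in> univ_space \<tau>"
    using F(2) by (auto intro!: csubspace_sum csubspaceD(3) csubspace_univ_space gns_vec_in_univ_space)
  ultimately show thesis using that by blast
qed

section \<open>The von Neumann algebra and the compactification\<close>

lemma commutantD: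
  assumes "T \<in> commutant K A"
  shows "T \<in> bounded_ops K" "S \<in> A \<Longrightarrow> T (S x) = S (T x)"
proof -
  show "T \<in> bounded_ops K" using assms by (simp add: commutant_def)
  assume "S \<in> A"
  then have "T \<circ> S = S \<circ> T" using assms by (simp add: commutant_def)
  then show "T (S x) = S (T x)" by (metis comp_apply)
qed

lemma commutantI:
  assumes "T \<in> bounded_ops K" "csubspace K" "A \<subseteq> bounded_ops K"
    "\<And>S x. S \<in> A \<Longrightarrow> x \<in> K \<Longrightarrow> T (S x) = S (T x)"
  shows "T \<in> commutant K A"
proof -
  have "T (S x) = S (T x)" if "S \<in> A" for S x
  proof (cases "x \<in> K")
    case False
    then show ?thesis
      using bounded_ops_zero[OF _ assms(2)] bounded_opsD(2) assms(1,3) that by (metis subsetD)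
  qed (use that assms(4) in blast)
  then show ?thesis using assms(1) by (auto simp: commutant_def fun_eq_iff)
qed

lemma group_vNI:
  assumes "T \<in> bounded_ops (univ_space \<tau>)"
    "\<And>S x. S \<in> commutant (univ_space \<tau>) (range (univ_rep \<tau>)) \<Longrightarrow> x \<in> univ_space \<tau> \<Longrightarrow> T (S x) = S (T x)"
  shows "T \<in> group_vN \<tau>"
  unfolding group_vN_def
  by (rule commutantI[OF assms(1) csubspace_univ_space _ assms(2)]) (auto dest: commutantD(1))

lemma group_vND:
  assumes "T \<in> group_vN \<tau>"
  shows "T \<in> bounded_ops (univ_space \<tau>)"
    "S \<in> commutant (univ_space \<tau>) (range (univ_rep \<tau>)) \<Longrightarrow> T (S x) = S (T x)"
  using assms commutantD unfolding group_vN_def by blast+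

lemma group_vN_univ_rep: "univ_rep \<tau> s \<in> group_vN \<tau>"
proof (rule group_vNI[OF univ_rep_bounded])
  fix S x assume "S \<in> commutant (univ_space \<tau>) (range (univ_rep \<tau>))"
  then show "univ_rep \<tau> s (S x) = S (univ_rep \<tau> s x)" using commutantD(2) by (metis rangeI)
qed

lemma group_vN_id: "op_id (univ_space \<tau>) \<in> group_vN \<tau>"
  by (rule group_vNI[OF op_id_bounded[OF csubspace_univ_space]])
     (auto simp: op_id_def op_restrict_def dest: commutantD(1) bounded_opsD(1))

lemma group_vN_comp:
  assumes "S \<in> group_vN \<tau>" "T \<in> group_vN \<tau>" shows "S \<circ> T \<in> group_vN \<tau>"
  by (rule group_vNI)
     (simp_all add: bounded_ops_comp csubspace_univ_space group_vND[OF assms(1)] group_vND[OF assms(2)])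

lemma group_vN_scale: assumes "T \<in> group_vN \<tau>" shows "(\<lambda>x. c *\<^sub>C T x) \<in> group_vN \<tau>"
proof (rule group_vNI)
  show "(\<lambda>x. c *\<^sub>C T x) \<in> bounded_ops (univ_space \<tau>)"
    by (rule bounded_ops_scale[OF group_vND(1)[OF assms] csubspace_univ_space])
  fix S x assume S: "S \<in> commutant (univ_space \<tau>) (range (univ_rep \<tau>))" "x \<in> univ_space \<tau>"
  then show "c *\<^sub>C T (S x) = S (c *\<^sub>C T x)"
    using bounded_opsD(4)[OF commutantD(1)[OF S(1)]] bounded_opsD(1)[OF group_vND(1)[OF assms]]
    by (simp add: group_vND(2)[OF assms])
qed

lemma group_vN_add:
  assumes "S \<in> group_vN \<tau>" "T \<in> group_vN \<tau>" shows "(\<lambda>x. S x + T x) \<in> group_vN \<tau>"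
proof (rule group_vNI)
  show "(\<lambda>x. S x + T x) \<in> bounded_ops (univ_space \<tau>)"
    by (intro bounded_ops_plus group_vND(1) assms csubspace_univ_space)
  fix R x assume R: "R \<in> commutant (univ_space \<tau>) (range (univ_rep \<tau>))" "x \<in> univ_space \<tau>"
  then show "S (R x) + T (R x) = R (S x + T x)"
    using bounded_opsD(3)[OF commutantD(1)[OF R(1)]] bounded_opsD(1)[OF group_vND(1)[OF assms(1)]]
      bounded_opsD(1)[OF group_vND(1)[OF assms(2)]]
    by (simp add: group_vND(2)[OF assms(1)] group_vND(2)[OF assms(2)])
qed

lemma group_vN_sum: "(\<lambda>x. \<Sum>s\<in>F. c s *\<^sub>C univ_rep \<tau> s x) \<in> group_vN \<tau>"
proof (induction F rule: infinite_finite_induct)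
  case (insert s F)
  then show ?case
    using group_vN_add[OF group_vN_scale[OF group_vN_univ_rep[of \<tau> s], of "c s"]] by simp
qed (use group_vN_scale[OF group_vN_id, of 0] in simp_all)

lemma univ_cpt_iff:
  "T \<in> univ_cpt \<tau> \<longleftrightarrow> T \<in> bounded_ops (univ_space \<tau>) \<and> (\<exists>\<F>. \<F> \<noteq> bot \<and>
    (\<forall>x\<in>univ_space \<tau>. \<forall>y\<in>univ_space \<tau>. ((\<lambda>s. cinner (univ_rep \<tau> s x) y) \<longlongrightarrow> cinner (T x) y) \<F>))"
  unfolding univ_cpt_def in_closure_of_range_iff limitin_weak_op_iff[OF univ_rep_bounded] by blast

lemma univ_cpt_contraction:
  assumes T: "T \<in> univ_cpt \<tau>" and x: "x \<in> univ_space \<tau>"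
  shows "norm (T x) \<le> norm x"
proof -
  obtain \<F> where F: "\<F> \<noteq> bot" "\<And>x y. x \<in> univ_space \<tau> \<Longrightarrow> y \<in> univ_space \<tau> \<Longrightarrow>
      ((\<lambda>s. cinner (univ_rep \<tau> s x) y) \<longlongrightarrow> cinner (T x) y) \<F>"
    and Tb: "T \<in> bounded_ops (univ_space \<tau>)"
    using T unfolding univ_cpt_iff by blast
  have Tx: "T x \<in> univ_space \<tau>" using bounded_opsD(1)[OF Tb x] .
  have "cmod (cinner (T x) (T x)) \<le> norm x * norm (T x)"
  proof (rule tendsto_upperbound[OF tendsto_norm[OF F(2)[OF x Tx]] _ F(1)], intro always_eventually allI)
    fix s show "cmod (cinner (univ_rep \<tau> s x) (T x)) \<le> norm x * norm (T x)"
      using cinner_Cauchy_Schwarz[of "univ_rep \<tau> s x" "T x"] x by (simp add: univ_rep_apply norm_gns_shift)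
  qed
  then have "norm (T x) * norm (T x) \<le> norm x * norm (T x)"
    by (simp add: cinner_self norm_power power2_eq_square norm_mult)
  then show ?thesis by (cases "norm (T x) = 0") auto
qed

text \<open>Elements of the commutant have adjoints by the Riesz theorem, so commuting with them is a
  condition that survives weak limits.\<close>

lemma univ_cpt_subset_group_vN: "univ_cpt \<tau> \<subseteq> group_vN \<tau>"
proof
  fix T assume T: "T \<in> univ_cpt \<tau>"
  let ?H = "univ_space \<tau>"
  obtain \<F> where F: "\<F> \<noteq> bot" "\<And>x y. x \<in> ?H \<Longrightarrow> y \<in> ?H \<Longrightarrow>
      ((\<lambda>s. cinner (univ_rep \<tau> s x) y) \<longlongrightarrow> cinner (T x) y) \<F>"
    and Tb: "T \<in> bounded_ops ?H"
    using T unfolding univ_cpt_iff by blast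
  show "T \<in> group_vN \<tau>"
  proof (rule group_vNI[OF Tb])
    fix S x assume S: "S \<in> commutant ?H (range (univ_rep \<tau>))" and x: "x \<in> ?H"
    have Sb: "S \<in> bounded_ops ?H" by (rule commutantD(1)[OF S])
    have Sx: "S x \<in> ?H" and Tx: "T x \<in> ?H" using bounded_opsD(1) Sb Tb x by blast+
    have eq: "cinner (T (S x)) y = cinner (S (T x)) y" if y: "y \<in> ?H" for y
    proof -
      obtain C where C: "\<forall>x\<in>?H. norm (S x) \<le> C * norm x" using bounded_ops_bound[OF Sb] by blast
      obtain y' where y': "y' \<in> ?H" "\<And>z. z \<in> ?H \<Longrightarrow> cinner (S z) y = cinner z y'"
      proof (rule Riesz_representation[OF csubspace_univ_space closed_univ_space,
            where f = "\<lambda>z. cinner (S z) y" and C = "C * norm y"])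
        fix z assume "z \<in> ?H"
        then have "norm (S z) * norm y \<le> (C * norm z) * norm y"
          using C by (intro mult_right_mono) auto
        then show "cmod (cinner (S z) y) \<le> C * norm y * norm z"
          using cinner_Cauchy_Schwarz[of "S z" y] by (simp add: mult_ac)
      qed (auto simp: bounded_opsD(3,4)[OF Sb] cinner_add_left cinner_scaleC_left)
      have "cinner (univ_rep \<tau> s (S x)) y = cinner (univ_rep \<tau> s x) y'" for s
        using y'(2)[OF bounded_opsD(1)[OF univ_rep_bounded x]] commutantD(2)[OF S, of "univ_rep \<tau> s" x, symmetric]
        by simp
      then have "((\<lambda>s. cinner (univ_rep \<tau> s (S x)) y) \<longlongrightarrow> cinner (T x) y') \<F>"
        using F(2)[OF x y'(1)] by simp
      then have "cinner (T (S x)) y = cinner (T x) y'"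
        by (rule tendsto_unique[OF F(1) F(2)[OF Sx y]])
      then show ?thesis using y'(2)[OF Tx] by simp
    qed
    have "T (S x) - S (T x) = 0"
      by (rule cinner_eq_zero_all[of ?H])
         (use eq bounded_opsD(1)[OF Tb Sx] bounded_opsD(1)[OF Sb Tx] in
            \<open>simp_all add: cinner_diff_left csubspaceD[OF csubspace_univ_space]\<close>)
    then show "T (S x) = S (T x)" by simp
  qed
qed

lemma univ_cpt_univ_rep: "univ_rep \<tau> s \<in> univ_cpt \<tau>"
  unfolding univ_cpt_def using closure_of_subset[of "range (univ_rep \<tau>)" "weak_op_topology (univ_space \<tau>)"]
    univ_rep_bounded by auto

lemma univ_cpt_comp_univ_rep:
  assumes "T \<in> univ_cpt \<tau>" shows "T \<circ> univ_rep \<tau> t \<in> univ_cpt \<tau>"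
proof -
  obtain \<F> where F: "\<F> \<noteq> bot" "\<And>x y. x \<in> univ_space \<tau> \<Longrightarrow> y \<in> univ_space \<tau> \<Longrightarrow>
      ((\<lambda>s. cinner (univ_rep \<tau> s x) y) \<longlongrightarrow> cinner (T x) y) \<F>"
    and Tb: "T \<in> bounded_ops (univ_space \<tau>)"
    using assms unfolding univ_cpt_iff by blast
  have "filtermap (\<lambda>s. s + t) \<F> \<noteq> bot" using F(1) by (simp add: filtermap_bot_iff)
  moreover have "((\<lambda>s. cinner (univ_rep \<tau> s x) y) \<longlongrightarrow> cinner ((T \<circ> univ_rep \<tau> t) x) y) (filtermap (\<lambda>s. s + t) \<F>)"
    if "x \<in> univ_space \<tau>" "y \<in> univ_space \<tau>" for x y
    using F(2)[OF bounded_opsD(1)[OF univ_rep_bounded[of \<tau> t] that(1)] that(2)]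
    by (simp add: filterlim_filtermap univ_rep_add)
  ultimately show ?thesis
    unfolding univ_cpt_iff using bounded_ops_comp[OF Tb univ_rep_bounded csubspace_univ_space] by blast
qed

section \<open>Ultraweak density\<close>

text \<open>A vector whose orbit is dominated by the kernel of \<open>w\<close> is the image of the cyclic vector of
  \<open>w\<close> under an intertwiner, and elements of the von Neumann algebra commute with it.\<close>

lemma gns_intertwiner_exists:
  fixes \<xi> :: "'g::group_add gns_total"
  assumes \<xi>: "\<xi> \<in> univ_space \<tau>"
    and dom: "\<And>F c. finite F \<Longrightarrow> norm (\<Sum>s\<in>F. c s *\<^sub>C gns_shift s \<xi>) \<le> norm (\<Sum>s\<in>F. c s *\<^sub>C gns_vec w s)"
  obtains V :: "'g gns_total \<Rightarrow> 'g gns_total"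
  where "bounded_linear V" "\<And>c y. V (c *\<^sub>C y) = c *\<^sub>C V y" "\<And>s. V (gns_vec w s) = gns_shift s \<xi>"
    "\<And>y. V y \<in> closed_cspan (range (\<lambda>s. gns_shift s \<xi>))"
    "\<And>T y. T \<in> group_vN \<tau> \<Longrightarrow> y \<in> univ_space \<tau> \<Longrightarrow> T (V y) = V (T y)"
proof -
  obtain V :: "'g gns_total \<Rightarrow> 'g gns_total" where add: "\<And>y z. V (y + z) = V y + V z"
    and scale: "\<And>c y. V (c *\<^sub>C y) = c *\<^sub>C V y" and bound: "\<And>y. norm (V y) \<le> norm y"
    and vec: "\<And>s. V (gns_vec w s) = gns_shift s \<xi>" and vec0: "\<And>u s. u \<noteq> w \<Longrightarrow> V (gns_vec u s) = 0"
  proof (rule gns_contraction_exists[of "\<lambda>s. gns_shift s \<xi>" w])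
    show "norm (\<Sum>s\<in>F. c s *\<^sub>C gns_shift s \<xi>) \<le> norm (\<Sum>s\<in>F. c s *\<^sub>C gns_vec w s)" if "finite F" for F c
      by (rule dom[OF that])
  qed blast
  have bl: "bounded_linear V"
    by (rule bounded_linear_intro[of V 1]) (use add scale bound in \<open>simp_all flip: scaleC_of_real\<close>)
  let ?H = "univ_space \<tau>" and ?O = "closed_cspan (range (\<lambda>s. gns_shift s \<xi>))"
  have orbit: "V y \<in> ?O" for y
  proof (induction y rule: gns_total_induct)
    case (vec u s)
    have "gns_shift s \<xi> \<in> ?O" "0 \<in> ?O"
      using closed_cspan_superset[of "range (\<lambda>s. gns_shift s \<xi>)"] csubspaceD(1)[OF csubspace_closed_cspan]
      by auto
    then show ?case by (cases "u = w") (simp_all add: \<open>\<And>s. V (gns_vec w s) = gns_shift s \<xi>\<close> vec0)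
  next
    case closed
    have "closed (V -` ?O)"
      by (intro closed_vimage closed_closed_cspan linear_continuous_on bl)
    then show ?case by (simp add: vimage_def)
  qed (auto simp: add scale csubspaceD[OF csubspace_closed_cspan])
  have "?O \<subseteq> ?H"
    by (rule closed_cspan_least[OF csubspace_univ_space closed_univ_space])
       (use gns_shift_in_univ_space[OF \<xi>] in auto)
  with orbit have VH: "V y \<in> ?H" for y by blast
  (* V intertwines on the generators, hence everywhere, and so belongs to the commutant. *)
  have shift: "V (gns_shift t y) = gns_shift t (V y)" for t y
  proof (induction y rule: gns_total_induct)
    case (vec u s)
    show ?case
      by (cases "u = w") (simp_all add: gns_shift_vec \<open>\<And>s. V (gns_vec w s) = gns_shift s \<xi>\<close> vec0 gns_shift_plus)
  next
    case closed
    show ?case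
      by (intro closed_Collect_eq linear_continuous_on bounded_linear_compose[OF bl]
          bounded_linear_compose[OF bounded_linear_gns_shift] bounded_linear_gns_shift bl)
  qed (auto simp: add scale gns_shift_add gns_shift_scaleC)
  have "\<exists>C. \<forall>y\<in>?H. norm (op_restrict ?H V y) \<le> C * norm y"
    using bound by (intro exI[of _ 1]) (simp add: op_restrict_def)
  then have "op_restrict ?H V \<in> bounded_ops ?H"
    unfolding bounded_ops_def
    by (simp add: op_restrict_def add scale VH csubspaceD[OF csubspace_univ_space])
  then have "op_restrict ?H V \<in> commutant ?H (range (univ_rep \<tau>))"
    using univ_rep_bounded shift VH
    by (intro commutantI csubspace_univ_space)
       (auto simp: op_restrict_def univ_rep_apply gns_shift_in_univ_space)
  then have "T (V y) = V (T y)" if "T \<in> group_vN \<tau>" "y \<in> ?H" for T y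
    using group_vND(2)[OF that(1), of "op_restrict ?H V" y] that(2) bounded_opsD(1)[OF group_vND(1)[OF that(1)]]
    by (simp add: op_restrict_def)
  with bl scale vec orbit that show thesis by blast
qed

text \<open>The projection onto the GNS space is an intertwiner, so \<open>T\<close> commutes with it.\<close>

lemma group_vN_gns_space:
  assumes u: "u \<in> cont_pos_def \<tau>" and T: "T \<in> group_vN \<tau>"
  shows "T (gns_vec u s) \<in> gns_space u"
proof -
  have dom: "norm (\<Sum>s\<in>F. c s *\<^sub>C gns_shift s (gns_vec u 0)) \<le> norm (\<Sum>s\<in>F. c s *\<^sub>C gns_vec u s)" for F c
    by (simp add: gns_shift_vec)
  obtain V where V: "\<And>s. V (gns_vec u s) = gns_shift s (gns_vec u 0)"
    "\<And>y. V y \<in> closed_cspan (range (\<lambda>s. gns_shift s (gns_vec u 0)))"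
    "\<And>T y. T \<in> group_vN \<tau> \<Longrightarrow> y \<in> univ_space \<tau> \<Longrightarrow> T (V y) = V (T y)"
    by (rule gns_intertwiner_exists[OF gns_vec_in_univ_space[OF u] dom]) blast
  have "T (gns_vec u s) = V (T (gns_vec u s))"
    using V(3)[OF T gns_vec_in_univ_space[OF u, of s]] V(1)[of s] by (simp add: gns_shift_vec)
  also have "\<dots> \<in> gns_space u" using V(2) by (simp add: gns_space_def gns_shift_vec)
  finally show ?thesis .
qed

text \<open>The difference between \<open>T\<close> and a combination of group elements commutes with the intertwiners
  that carry the cyclic vector of \<open>w\<close> to the vectors \<open>x j\<close>. The bound \<open>dom\<close>, assumed for combinations
  of the orbits, extends to the closed span of the orbit of the cyclic vector, where \<open>T\<close> moves it.\<close>

lemma group_vN_dominated: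
  fixes \<tau> :: "'g::group_add topology"
  assumes w: "w \<in> cont_pos_def \<tau>" and T: "T \<in> group_vN \<tau>" and J: "finite J"
    and x: "\<And>j. j \<in> J \<Longrightarrow> x j \<in> univ_space \<tau>"
    and dom: "\<And>F c. finite F \<Longrightarrow> (\<Sum>j\<in>J. (norm (\<Sum>s\<in>F. c s *\<^sub>C gns_shift s (x j)))\<^sup>2)
      \<le> (norm (\<Sum>s\<in>F. c s *\<^sub>C gns_vec w s))\<^sup>2"
    and F: "finite F"
  shows "(\<Sum>j\<in>J. (norm (T (x j) - (\<Sum>s\<in>F. c s *\<^sub>C gns_shift s (x j))))\<^sup>2)
    \<le> (norm (T (gns_vec w 0) - (\<Sum>s\<in>F. c s *\<^sub>C gns_vec w s)))\<^sup>2"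
proof -
  have "\<exists>V. bounded_linear V \<and> (\<forall>c y. V (c *\<^sub>C y) = c *\<^sub>C V y) \<and> (\<forall>s. V (gns_vec w s) = gns_shift s (x j))
      \<and> (\<forall>y\<in>univ_space \<tau>. T (V y) = V (T y))" if j: "j \<in> J" for j
  proof -
    have "norm (\<Sum>s\<in>A. d s *\<^sub>C gns_shift s (x j)) \<le> norm (\<Sum>s\<in>A. d s *\<^sub>C gns_vec w s)" if "finite A" for A d
    proof (rule power2_le_imp_le)
      have "(norm (\<Sum>s\<in>A. d s *\<^sub>C gns_shift s (x j)))\<^sup>2 \<le> (\<Sum>j\<in>J. (norm (\<Sum>s\<in>A. d s *\<^sub>C gns_shift s (x j)))\<^sup>2)"
        using j J by (intro member_le_sum) auto
      also have "\<dots> \<le> (norm (\<Sum>s\<in>A. d s *\<^sub>C gns_vec w s))\<^sup>2" by (rule dom[OF that])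
      finally show "(norm (\<Sum>s\<in>A. d s *\<^sub>C gns_shift s (x j)))\<^sup>2 \<le> (norm (\<Sum>s\<in>A. d s *\<^sub>C gns_vec w s))\<^sup>2" .
    qed simp
    then show ?thesis
    proof (rule gns_intertwiner_exists[OF x[OF j]])
      fix V assume "bounded_linear V" "\<And>c y. V (c *\<^sub>C y) = c *\<^sub>C V y"
        "\<And>s. V (gns_vec w s) = gns_shift s (x j)"
        "\<And>T y. T \<in> group_vN \<tau> \<Longrightarrow> y \<in> univ_space \<tau> \<Longrightarrow> T (V y) = V (T y)"
      then show ?thesis using T by (intro exI[of _ V]) simp
    qed
  qed
  then obtain V where V: "\<And>j. j \<in> J \<Longrightarrow> bounded_linear (V j)"
    "\<And>j c y. j \<in> J \<Longrightarrow> V j (c *\<^sub>C y) = c *\<^sub>C V j y"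
    "\<And>j s. j \<in> J \<Longrightarrow> V j (gns_vec w s) = gns_shift s (x j)"
    "\<And>j y. j \<in> J \<Longrightarrow> y \<in> univ_space \<tau> \<Longrightarrow> T (V j y) = V j (T y)"
    by metis
  have V_sum: "V j (\<Sum>s\<in>A. d s *\<^sub>C gns_vec w s) = (\<Sum>s\<in>A. d s *\<^sub>C gns_shift s (x j))" if "j \<in> J" for j A d
    using V(2,3)[OF that] by (simp add: linear_sum[OF bounded_linear.linear[OF V(1)[OF that]]])
  define z where "z = T (gns_vec w 0) - (\<Sum>s\<in>F. c s *\<^sub>C gns_vec w s)"
  have Vz: "V j z = T (x j) - (\<Sum>s\<in>F. c s *\<^sub>C gns_shift s (x j))" if "j \<in> J" for j
    using V(4)[OF that gns_vec_in_univ_space[OF w], of 0] V(3)[OF that, of 0]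
    by (simp add: z_def linear_diff[OF bounded_linear.linear[OF V(1)[OF that]]] V_sum[OF that] gns_shift_zero)
  define S where "S = {y. (\<Sum>j\<in>J. (norm (V j y))\<^sup>2) \<le> (norm y)\<^sup>2}"
  have "closed S"
    unfolding S_def by (intro closed_Collect_le continuous_intros linear_continuous_on V(1))
  moreover have "\<exists>y\<in>S. dist y z < e" if "e > 0" for e
  proof -
    have "z \<in> gns_space w"
      unfolding z_def using group_vN_gns_space[OF w T] gns_vec_in_gns_space
        csubspace_closed_cspan[of "range (gns_vec w)"]
      by (auto simp: gns_space_def intro!: csubspaceD csubspace_sum)
    then obtain A d where A: "finite A" "norm (z - (\<Sum>s\<in>A. d s *\<^sub>C gns_vec w s)) < e"
      unfolding gns_space_def by (rule closed_cspan_range_approx[OF _ \<open>e > 0\<close>])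
    then have "(\<Sum>s\<in>A. d s *\<^sub>C gns_vec w s) \<in> S"
      unfolding S_def using dom[OF A(1), of d] by (simp add: V_sum)
    with A(2) show ?thesis by (auto simp: dist_norm norm_minus_commute)
  qed
  ultimately have "z \<in> S" using closed_approachable by blast
  then show ?thesis by (simp add: S_def Vz z_def[symmetric])
qed

lemma cont_pos_def_sum:
  assumes "\<And>i. i \<in> A \<Longrightarrow> u i \<in> cont_pos_def \<tau>" shows "(\<lambda>s. \<Sum>i\<in>A. u i s) \<in> cont_pos_def \<tau>"
  using assms
proof (induction A rule: infinite_finite_induct)
  case (insert i A)
  then have 1: "u i \<in> cont_pos_def \<tau>" "(\<lambda>s. \<Sum>i\<in>A. u i s) \<in> cont_pos_def \<tau>" by auto
  then have "pos_def (\<lambda>s. u i s + (\<Sum>i\<in>A. u i s))"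
    unfolding cont_pos_def_def pos_def_def by (simp add: distrib_left sum.distrib nonneg_Reals_add_I)
  with 1 insert.hyps show ?case by (simp add: cont_pos_def_def continuous_map_cadd)
qed (simp_all add: cont_pos_def_def pos_def_def)

text \<open>This is the diagonal coefficient of the vector \<open>x\<close> in the countable multiple of the universal
  representation.\<close>

definition l2_coefficient :: "(nat \<Rightarrow> 'g::group_add gns_total) \<Rightarrow> 'g \<Rightarrow> complex" where
  "l2_coefficient x s = suminf (\<lambda>n. cinner (gns_shift s (x n)) (x n))"

lemma l2_coefficient_summable:
  assumes "summable (\<lambda>n. (norm (x n))\<^sup>2)"
  shows "summable (\<lambda>n. cinner (gns_shift s (x n)) (x n))"
proof (rule summable_comparison_test'[OF assms])
  fix n show "norm (cinner (gns_shift s (x n)) (x n)) \<le> (norm (x n))\<^sup>2"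
    using cinner_Cauchy_Schwarz[of "gns_shift s (x n)" "x n"] by (simp add: norm_gns_shift power2_eq_square)
qed

lemma l2_coefficient_sums:
  assumes "summable (\<lambda>n. (norm (x n))\<^sup>2)"
  shows "(\<lambda>n. complex_of_real ((norm (\<Sum>s\<in>F. c s *\<^sub>C gns_shift s (x n)))\<^sup>2)) sums
    (\<Sum>s\<in>F. \<Sum>t\<in>F. c s * cnj (c t) * l2_coefficient x (- t + s))"
proof -
  have gram: "cinner (gns_shift s y) (gns_shift t y) = cinner (gns_shift (- t + s) y) y" for s t and y :: "'a gns_total"
    using cinner_gns_shift[of "- t" "gns_shift s y" "gns_shift t y"]
    by (simp add: gns_shift_plus[symmetric] gns_shift_zero)
  show ?thesis
    unfolding norm_sum_scaleC_square gram l2_coefficient_def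
    by (intro sums_sum sums_mult summable_sums l2_coefficient_summable assms)
qed

lemma l2_coefficient_cont_pos_def:
  assumes "group_topology \<tau>" "range x \<subseteq> univ_space \<tau>" "summable (\<lambda>n. (norm (x n))\<^sup>2)"
  shows "l2_coefficient x \<in> cont_pos_def \<tau>"
  unfolding cont_pos_def_def
proof (intro CollectI conjI)
  show "pos_def (l2_coefficient x)"
    unfolding pos_def_def
  proof (intro allI impI)
    fix F c
    note S = l2_coefficient_sums[OF assms(3), of c F]
    have "0 \<le> Re (\<Sum>s\<in>F. \<Sum>t\<in>F. c s * cnj (c t) * l2_coefficient x (- t + s))"
      by (rule sums_le[OF _ sums_zero sums_Re[OF S]]) (simp only: Re_complex_of_real zero_le_power2)
    moreover have "(\<lambda>_::nat. 0) sums Im (\<Sum>s\<in>F. \<Sum>t\<in>F. c s * cnj (c t) * l2_coefficient x (- t + s))"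
      using sums_Im[OF S] by (simp only: Im_complex_of_real)
    then have "Im (\<Sum>s\<in>F. \<Sum>t\<in>F. c s * cnj (c t) * l2_coefficient x (- t + s)) = 0"
      by (rule sums_unique2) (rule sums_zero)
    ultimately show "(\<Sum>s\<in>F. \<Sum>t\<in>F. c s * cnj (c t) * l2_coefficient x (- t + s)) \<in> \<real>\<^sub>\<ge>\<^sub>0"
      by (simp only: complex_nonneg_Reals_iff)
  qed
  have lim: "uniform_limit UNIV (\<lambda>n s. \<Sum>i<n. cinner (gns_shift s (x i)) (x i)) (l2_coefficient x) sequentially"
    unfolding l2_coefficient_def
  proof (rule Weierstrass_m_test[OF _ assms(3)])
    fix n and s :: 'a
    show "norm (cinner (gns_shift s (x n)) (x n)) \<le> (norm (x n))\<^sup>2"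
      using cinner_Cauchy_Schwarz[of "gns_shift s (x n)" "x n"] by (simp add: norm_gns_shift power2_eq_square)
  qed
  show "continuous_map \<tau> euclidean (l2_coefficient x)"
  proof (rule continuous_map_approx)
    fix e :: real assume "e > 0"
    then have "\<forall>\<^sub>F n in sequentially. \<forall>s\<in>UNIV. dist (\<Sum>i<n. cinner (gns_shift s (x i)) (x i)) (l2_coefficient x s) < e"
      by (rule uniform_limitD[OF lim])
    then obtain n where n: "\<forall>s. dist (\<Sum>i<n. cinner (gns_shift s (x i)) (x i)) (l2_coefficient x s) < e"
      using eventually_happens'[OF sequentially_bot] by blast
    have "continuous_map \<tau> euclidean (\<lambda>s. \<Sum>i<m. cinner (gns_shift s (x i)) (x i))" for m
    proof (induction m)
      case (Suc m)
      then show ?case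
        using assms(2) by (auto intro!: continuous_map_cadd univ_rep_continuous[OF assms(1)])
    qed simp
    with n show "\<exists>g. continuous_map \<tau> euclidean g \<and> (\<forall>s. dist (l2_coefficient x s) (g s) \<le> e)"
      by (intro exI[of _ "\<lambda>s. \<Sum>i<n. cinner (gns_shift s (x i)) (x i)"])
         (auto simp: dist_commute less_imp_le)
  qed
qed

text \<open>The square summable version of von Neumann's density theorem. Where the classical proof amplifies
  the representation, this one uses universality: the diagonal coefficients of the sequences add up
  to a continuous positive definite function \<open>w\<close>, whose GNS space is already part of the universal
  space. The entries of the sequences are then images of the cyclic vector of \<open>w\<close> under intertwiners,
  and \<open>T\<close> moves that vector within its GNS space, which is the closed span of its orbit.\<close>

theorem group_vN_density:
  fixes \<tau> :: "'g::group_add topology"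
  assumes gt: "group_topology \<tau>" and T: "T \<in> group_vN \<tau>" and Y: "finite Y"
    and l2: "\<And>x. x \<in> Y \<Longrightarrow> range x \<subseteq> univ_space \<tau>" "\<And>x. x \<in> Y \<Longrightarrow> summable (\<lambda>n. (norm (x n))\<^sup>2)"
    and e: "e > 0"
  obtains F c where "finite F"
    "\<And>x N. x \<in> Y \<Longrightarrow> (\<Sum>n<N. (norm (T (x n) - (\<Sum>s\<in>F. c s *\<^sub>C gns_shift s (x n))))\<^sup>2) \<le> e"
proof -
  define w where "w s = (\<Sum>x\<in>Y. l2_coefficient x s)" for s
  have w: "w \<in> cont_pos_def \<tau>"
    unfolding w_def by (intro cont_pos_def_sum l2_coefficient_cont_pos_def gt l2)
  have dom: "(\<Sum>(x,n)\<in>Y\<times>{..<N}. (norm (\<Sum>s\<in>F. c s *\<^sub>C gns_shift s (x n)))\<^sup>2)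
      \<le> (norm (\<Sum>s\<in>F. c s *\<^sub>C gns_vec w s))\<^sup>2" for F c N
  proof -
    have "(\<Sum>n<N. (norm (\<Sum>s\<in>F. c s *\<^sub>C gns_shift s (x n)))\<^sup>2)
        \<le> Re (\<Sum>s\<in>F. \<Sum>t\<in>F. c s * cnj (c t) * l2_coefficient x (- t + s))" if "x \<in> Y" for x
    proof -
      have S: "(\<lambda>n. (norm (\<Sum>s\<in>F. c s *\<^sub>C gns_shift s (x n)))\<^sup>2) sums
          Re (\<Sum>s\<in>F. \<Sum>t\<in>F. c s * cnj (c t) * l2_coefficient x (- t + s))"
        using sums_Re[OF l2_coefficient_sums[OF l2(2)[OF that], of c F]]
        by (simp only: Re_complex_of_real)
      show ?thesis
        unfolding sums_unique[OF S] by (rule sum_le_suminf[OF sums_summable[OF S]]) simp_all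
    qed
    then have "(\<Sum>(x,n)\<in>Y\<times>{..<N}. (norm (\<Sum>s\<in>F. c s *\<^sub>C gns_shift s (x n)))\<^sup>2)
        \<le> (\<Sum>x\<in>Y. Re (\<Sum>s\<in>F. \<Sum>t\<in>F. c s * cnj (c t) * l2_coefficient x (- t + s)))"
      unfolding sum.cartesian_product[symmetric] by (intro sum_mono) auto
    also have "\<dots> = Re (\<Sum>s\<in>F. \<Sum>t\<in>F. c s * cnj (c t) * w (- t + s))"
      unfolding w_def sum_distrib_left Re_sum[symmetric]
      by (subst sum.swap, rule arg_cong[of _ _ Re], intro sum.cong refl, rule sum.swap)
    also have "\<dots> = (norm (\<Sum>s\<in>F. c s *\<^sub>C gns_vec w s))\<^sup>2"
      using w arg_cong[OF norm_sum_scaleC_square[of c "gns_vec w" F], of Re]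
      by (simp add: cinner_gns_vec cont_pos_def_def)
    finally show ?thesis .
  qed
  have "T (gns_vec w 0) \<in> closed_cspan (range (gns_vec w))"
    using group_vN_gns_space[OF w T] by (simp add: gns_space_def)
  moreover have "sqrt e > 0" using e by simp
  ultimately obtain F c where F: "finite F" "norm (T (gns_vec w 0) - (\<Sum>s\<in>F. c s *\<^sub>C gns_vec w s)) < sqrt e"
    by (rule closed_cspan_range_approx)
  have small: "(norm (T (gns_vec w 0) - (\<Sum>s\<in>F. c s *\<^sub>C gns_vec w s)))\<^sup>2 \<le> e"
    using power_mono[OF less_imp_le[OF F(2)], of 2] e by simp
  show thesis
  proof (rule that[OF F(1)])
    fix x N assume x: "x \<in> Y"
    let ?d = "\<lambda>x n. (norm (T (x n) - (\<Sum>s\<in>F. c s *\<^sub>C gns_shift s (x n))))\<^sup>2"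
    have "(\<Sum>n<N. ?d x n) \<le> (\<Sum>x\<in>Y. \<Sum>n<N. ?d x n)"
      using x Y by (intro member_le_sum) (auto intro: sum_nonneg)
    also have "\<dots> = (\<Sum>j\<in>Y\<times>{..<N}. ?d (fst j) (snd j))"
      unfolding sum.cartesian_product by (simp add: case_prod_beta)
    also have "\<dots> \<le> (norm (T (gns_vec w 0) - (\<Sum>s\<in>F. c s *\<^sub>C gns_vec w s)))\<^sup>2"
    proof (rule group_vN_dominated[OF w T])
      show "(\<Sum>j\<in>Y\<times>{..<N}. (norm (\<Sum>s\<in>F. c s *\<^sub>C gns_shift s (fst j (snd j))))\<^sup>2)
          \<le> (norm (\<Sum>s\<in>F. c s *\<^sub>C gns_vec w s))\<^sup>2" for F c
        using dom[where N = N and F = F and c = c] by (simp add: case_prod_beta)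
    qed (use l2(1) Y F(1) in \<open>auto simp: image_subset_iff\<close>)
    finally show "(\<Sum>n<N. ?d x n) \<le> e" using small by linarith
  qed
qed

section \<open>The pairing with the Fourier-Stieltjes algebra\<close>

text \<open>This is the Cauchy-Schwarz inequality for square summable sequences of vectors.\<close>

lemma ultraweak_functional_diff_le:
  fixes x y :: "nat \<Rightarrow> 'h::complex_hilbert"
  assumes K: "csubspace K" and S: "S \<in> bounded_ops K" and T: "T \<in> bounded_ops K"
    and x: "range x \<subseteq> K" "summable (\<lambda>n. (norm (x n))\<^sup>2)"
    and y: "summable (\<lambda>n. (norm (y n))\<^sup>2)"
    and small: "\<And>N. (\<Sum>n<N. (norm (T (x n) - S (x n)))\<^sup>2) \<le> e"
  shows "dist (suminf (\<lambda>n. cinner (S (x n)) (y n))) (suminf (\<lambda>n. cinner (T (x n)) (y n)))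
    \<le> sqrt e * sqrt (suminf (\<lambda>n. (norm (y n))\<^sup>2))"
proof -
  have summable: "summable (\<lambda>n. cinner (R (x n)) (y n))" if R: "R \<in> bounded_ops K" for R
  proof -
    obtain C where C: "\<forall>x\<in>K. norm (R x) \<le> C * norm x" using bounded_ops_bound[OF R] by blast
    have "summable (\<lambda>n. \<bar>C\<bar> * ((norm (x n))\<^sup>2 + (norm (y n))\<^sup>2))"
      by (intro summable_mult summable_add x y)
    then show ?thesis
    proof (rule summable_comparison_test')
      fix n
      have "x n \<in> K" using x(1) by blast
      then have "norm (R (x n)) \<le> \<bar>C\<bar> * norm (x n)"
        using C mult_right_mono[OF abs_ge_self[of C] norm_ge_zero[of "x n"]] by fastforce
      then have "norm (R (x n)) * norm (y n) \<le> \<bar>C\<bar> * (norm (x n) * norm (y n))"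
        using mult_right_mono[of _ _ "norm (y n)"] by (fastforce simp: mult.assoc)
      also have "\<dots> \<le> \<bar>C\<bar> * ((norm (x n))\<^sup>2 + (norm (y n))\<^sup>2)"
      proof (rule mult_left_mono)
        have "0 \<le> (norm (x n) - norm (y n))\<^sup>2 + (norm (x n))\<^sup>2 + (norm (y n))\<^sup>2" by simp
        then show "norm (x n) * norm (y n) \<le> (norm (x n))\<^sup>2 + (norm (y n))\<^sup>2"
          by (simp add: power2_diff)
      qed simp
      finally show "norm (cinner (R (x n)) (y n)) \<le> \<bar>C\<bar> * ((norm (x n))\<^sup>2 + (norm (y n))\<^sup>2)"
        using cinner_Cauchy_Schwarz[of "R (x n)" "y n"] by linarith
    qed
  qed
  let ?d = "\<lambda>n. T (x n) - S (x n)"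
  have sums: "(\<lambda>n. cinner (?d n) (y n)) sums
      (suminf (\<lambda>n. cinner (T (x n)) (y n)) - suminf (\<lambda>n. cinner (S (x n)) (y n)))"
    unfolding cinner_diff_left by (intro sums_diff summable_sums summable S T)
  have "norm (\<Sum>n<N. cinner (?d n) (y n)) \<le> sqrt e * sqrt (suminf (\<lambda>n. (norm (y n))\<^sup>2))" for N
  proof -
    have "norm (\<Sum>n<N. cinner (?d n) (y n)) \<le> (\<Sum>n<N. norm (?d n) * norm (y n))"
      by (intro sum_norm_le cinner_Cauchy_Schwarz)
    also have "\<dots> \<le> L2_set (\<lambda>n. norm (?d n)) {..<N} * L2_set (\<lambda>n. norm (y n)) {..<N}"
      using L2_set_mult_ineq[of "\<lambda>n. norm (?d n)" "\<lambda>n. norm (y n)" "{..<N}"] by simp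
    also have "\<dots> \<le> sqrt e * sqrt (suminf (\<lambda>n. (norm (y n))\<^sup>2))"
      unfolding L2_set_def
      by (intro mult_mono real_sqrt_le_mono small sum_le_suminf y) (auto intro: sum_nonneg order_trans[OF _ small[of 0]])
    finally show ?thesis .
  qed
  then have "norm (suminf (\<lambda>n. cinner (T (x n)) (y n)) - suminf (\<lambda>n. cinner (S (x n)) (y n)))
      \<le> sqrt e * sqrt (suminf (\<lambda>n. (norm (y n))\<^sup>2))"
    using tendsto_norm[OF sums[unfolded sums_def]] by (intro LIMSEQ_le_const2) auto
  then show ?thesis by (simp add: dist_norm norm_minus_commute)
qed

text \<open>The vector \<open>\<xi>\<close> is included so that one combination of group elements can be compared both with an
  ultraweakly continuous functional and with the vector functional of \<open>\<xi>\<close>.\<close>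

lemma ultraweak_approximation:
  fixes \<tau> :: "'g::group_add topology"
  assumes gt: "group_topology \<tau>" and T: "T \<in> group_vN \<tau>" and \<xi>: "\<xi> \<in> univ_space \<tau>"
    and U: "openin (ultraweak_topology (univ_space \<tau>)) U" "T \<in> U" and r: "r > 0"
  obtains F c where "(\<lambda>x. \<Sum>s\<in>F. c s *\<^sub>C univ_rep \<tau> s x) \<in> U" "finite F"
    "norm (T \<xi> - (\<Sum>s\<in>F. c s *\<^sub>C univ_rep \<tau> s \<xi>)) \<le> r"
proof -
  let ?H = "univ_space \<tau>"
  let ?\<phi> = "\<lambda>x y T. suminf (\<lambda>n. cinner (T (x n)) (y n))"
  let ?adm = "\<lambda>x y :: nat \<Rightarrow> 'g gns_total. range x \<subseteq> ?H \<and> range y \<subseteq> ?H \<and>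
    summable (\<lambda>n. (norm (x n))\<^sup>2) \<and> summable (\<lambda>n. (norm (y n))\<^sup>2)"
  obtain Y d where Y: "finite Y" "Y \<subseteq> {?\<phi> x y | x y. ?adm x y}" "d > 0"
    and YU: "\<And>S. S \<in> bounded_ops ?H \<Longrightarrow> (\<And>f. f \<in> Y \<Longrightarrow> dist (f S) (f T) < d) \<Longrightarrow> S \<in> U"
  proof (rule openin_initial_topology_nbhd[OF U[unfolded ultraweak_topology_def]])
    fix Y e
    assume *: "finite Y" "Y \<subseteq> {?\<phi> x y | x y. ?adm x y}" "0 < e"
      "\<And>S. S \<in> bounded_ops ?H \<Longrightarrow> (\<And>f. f \<in> Y \<Longrightarrow> dist (f S) (f T) < e) \<Longrightarrow> S \<in> U"
    show thesis by (rule that[OF *])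
  qed
  have "\<forall>f\<in>Y. \<exists>p. f = ?\<phi> (fst p) (snd p) \<and> ?adm (fst p) (snd p)"
  proof
    fix f assume "f \<in> Y"
    then have "f \<in> {?\<phi> x y | x y. ?adm x y}" by (rule subsetD[OF Y(2)])
    then show "\<exists>p. f = ?\<phi> (fst p) (snd p) \<and> ?adm (fst p) (snd p)"
      unfolding mem_Collect_eq
    proof (elim exE)
      fix x y assume "f = ?\<phi> x y \<and> ?adm x y"
      then show ?thesis by (intro exI[of _ "(x, y)"]) (simp only: fst_conv snd_conv)
    qed
  qed
  from bchoice[OF this] obtain p where
    p: "\<forall>f\<in>Y. f = ?\<phi> (fst (p f)) (snd (p f)) \<and> ?adm (fst (p f)) (snd (p f))" by (rule exE)
  define X Z where "X f = fst (p f)" and "Z f = snd (p f)" for f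
  have XZ_all: "\<forall>f\<in>Y. f = ?\<phi> (X f) (Z f) \<and> ?adm (X f) (Z f)"
    using p unfolding X_def Z_def .
  have \<phi>_eq: "f = ?\<phi> (X f) (Z f)" and adm: "?adm (X f) (Z f)" if "f \<in> Y" for f
    using bspec[OF XZ_all that] by (rule conjunct1, rule conjunct2)
  have XZ: "range (X f) \<subseteq> ?H" "range (Z f) \<subseteq> ?H"
    "summable (\<lambda>n. (norm (X f n))\<^sup>2)" "summable (\<lambda>n. (norm (Z f n))\<^sup>2)" if "f \<in> Y" for f
    using adm[OF that] by blast+
  (* The vector \<xi> enters the density theorem as a sequence with one nonzero entry. *)
  define x0 where "x0 n = (if n = 0 then \<xi> else 0)" for n :: nat
  have x0: "range x0 \<subseteq> ?H" "summable (\<lambda>n. (norm (x0 n))\<^sup>2)"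
  proof -
    show "range x0 \<subseteq> ?H" using \<xi> csubspaceD(1)[OF csubspace_univ_space] by (auto simp: x0_def)
    show "summable (\<lambda>n. (norm (x0 n))\<^sup>2)" by (rule summable_finite[of "{0}"]) (auto simp: x0_def)
  qed
  define M where "M = (\<Sum>f\<in>Y. sqrt (suminf (\<lambda>n. (norm (Z f n))\<^sup>2)))"
  have Z_nonneg: "0 \<le> sqrt (suminf (\<lambda>n. (norm (Z f n))\<^sup>2))" if "f \<in> Y" for f
    using XZ(4)[OF that] by (simp add: suminf_nonneg)
  have M: "0 \<le> M" "\<And>f. f \<in> Y \<Longrightarrow> sqrt (suminf (\<lambda>n. (norm (Z f n))\<^sup>2)) \<le> M"
    unfolding M_def using Y(1) Z_nonneg by (auto intro!: sum_nonneg member_le_sum)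
  (* M bounds the second factor in Cauchy-Schwarz for all functionals at once, and e M < d. *)
  define e where "e = min (d / (1 + M)) r"
  have e: "e > 0" using Y(3) M(1) r by (simp add: e_def)
  have eM: "e * M < d"
  proof -
    have "e * M \<le> d / (1 + M) * M" using M(1) by (intro mult_right_mono) (auto simp: e_def)
    also have "\<dots> < d" using Y(3) M(1) by (simp add: field_simps)
    finally show ?thesis .
  qed
  obtain F c where F: "finite F" and small: "\<And>x N. x \<in> insert x0 (X ` Y) \<Longrightarrow>
      (\<Sum>n<N. (norm (T (x n) - (\<Sum>s\<in>F. c s *\<^sub>C gns_shift s (x n))))\<^sup>2) \<le> e\<^sup>2"
  proof (rule group_vN_density[OF gt T, of "insert x0 (X ` Y)" "e\<^sup>2"])
    show "finite (insert x0 (X ` Y))" using Y(1) by simp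
    show "range x \<subseteq> ?H" if "x \<in> insert x0 (X ` Y)" for x using that x0(1) XZ(1) by blast
    show "summable (\<lambda>n. (norm (x n))\<^sup>2)" if "x \<in> insert x0 (X ` Y)" for x
      using that x0(2) XZ(3) by blast
    show "e\<^sup>2 > 0" using e by simp
    fix F c
    assume *: "finite F" "\<And>x N. x \<in> insert x0 (X ` Y) \<Longrightarrow>
      (\<Sum>n<N. (norm (T (x n) - (\<Sum>s\<in>F. c s *\<^sub>C gns_shift s (x n))))\<^sup>2) \<le> e\<^sup>2"
    show thesis by (rule that[OF *])
  qed
  define S where "S = (\<lambda>x. \<Sum>s\<in>F. c s *\<^sub>C univ_rep \<tau> s x)"
  have S_vN: "S \<in> group_vN \<tau>" unfolding S_def by (rule group_vN_sum)
  have S_apply: "S x = (\<Sum>s\<in>F. c s *\<^sub>C gns_shift s x)" if "x \<in> ?H" for x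
    unfolding S_def using that by (simp add: univ_rep_apply)
  have "S \<in> U"
  proof (rule YU[OF group_vND(1)[OF S_vN]])
    fix f assume f: "f \<in> Y"
    note adm = XZ[OF f] and f_eq = \<phi>_eq[OF f]
    have "(\<Sum>n<N. (norm (T (X f n) - S (X f n)))\<^sup>2) \<le> e\<^sup>2" for N
      using small[of "X f" N] f adm S_apply by (simp add: image_subset_iff)
    from this have "dist (?\<phi> (X f) (Z f) S) (?\<phi> (X f) (Z f) T) \<le> sqrt (e\<^sup>2) * sqrt (suminf (\<lambda>n. (norm (Z f n))\<^sup>2))"
      by (rule ultraweak_functional_diff_le[OF csubspace_univ_space
            group_vND(1)[OF S_vN] group_vND(1)[OF T] adm(1,3,4)])
    also have "\<dots> \<le> e * M" using M(2)[OF f] e by (simp add: mult_left_mono)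
    finally have "dist (?\<phi> (X f) (Z f) S) (?\<phi> (X f) (Z f) T) < d" using eM by linarith
    then show "dist (f S) (f T) < d" using fun_cong[OF f_eq, of S] fun_cong[OF f_eq, of T] by simp
  qed
  moreover have "norm (T \<xi> - S \<xi>) \<le> r"
  proof -
    have "(norm (T \<xi> - S \<xi>))\<^sup>2 \<le> e\<^sup>2" using small[of x0 1] \<xi> by (simp add: x0_def S_apply)
    then have "norm (T \<xi> - S \<xi>) \<le> e" by (rule power2_le_imp_le) (use e in simp)
    then show ?thesis by (simp add: e_def)
  qed
  ultimately show thesis using that F unfolding S_def by blast
qed

lemma normal_extension_sum:
  assumes rep: "unitary_rep \<tau> K \<pi>" and N: "normal_extension \<tau> K \<pi> \<Phi>" and F: "finite F"
  shows "\<Phi> (\<lambda>x. \<Sum>s\<in>F. c s *\<^sub>C univ_rep \<tau> s x) = (\<lambda>x. \<Sum>s\<in>F. c s *\<^sub>C \<pi> s x)"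
  using F
proof induction
  case empty
  have scale: "\<Phi> (\<lambda>x. a *\<^sub>C S x) = (\<lambda>x. a *\<^sub>C \<Phi> S x)" if "S \<in> group_vN \<tau>" for a S
    using N that by (simp add: normal_extension_def)
  show ?case using scale[OF group_vN_id, of 0] by simp
next
  case (insert s F)
  have scale: "\<Phi> (\<lambda>x. a *\<^sub>C S x) = (\<lambda>x. a *\<^sub>C \<Phi> S x)" if "S \<in> group_vN \<tau>" for a S
    using N that by (simp add: normal_extension_def)
  have add: "\<Phi> (\<lambda>x. R x + S x) = (\<lambda>x. \<Phi> R x + \<Phi> S x)" if "R \<in> group_vN \<tau>" "S \<in> group_vN \<tau>" for R S
    using N that by (simp add: normal_extension_def)
  have "\<Phi> (univ_rep \<tau> s) = \<pi> s" using N by (simp add: normal_extension_def)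
  then show ?case
    using insert add[OF group_vN_scale[OF group_vN_univ_rep[of \<tau> s], of "c s"] group_vN_sum[where F = F and c = c and \<tau> = \<tau>]]
      scale[OF group_vN_univ_rep[of \<tau> s], of "c s"] by simp
qed

text \<open>A vector functional is one of the functionals defining the ultraweak topology, for sequences with
  one nonzero entry.\<close>

lemma normal_extension_functional:
  assumes rep: "unitary_rep \<tau> K \<pi>" and N: "normal_extension \<tau> K \<pi> \<Phi>" and "\<xi> \<in> K" "\<eta> \<in> K"
  shows "continuous_map (subtopology (ultraweak_topology (univ_space \<tau>)) (group_vN \<tau>)) euclidean
    (\<lambda>T. cinner (\<Phi> T \<xi>) \<eta>)"
proof -
  let ?x = "\<lambda>n::nat. if n = 0 then \<xi> else 0" and ?y = "\<lambda>n::nat. if n = 0 then \<eta> else 0"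
  let ?f = "\<lambda>T. suminf (\<lambda>n. cinner (T (?x n)) (?y n))"
  have 0: "0 \<in> K" using unitary_repD(1)[OF rep] csubspaceD(1) by blast
  have sq: "summable (\<lambda>n. (norm (?x n))\<^sup>2)" "summable (\<lambda>n. (norm (?y n))\<^sup>2)"
    by (rule summable_finite[of "{0}"]; auto)+
  have "continuous_map (ultraweak_topology K) euclidean ?f"
    unfolding ultraweak_topology_def
    using assms(3,4) 0 sq by (intro continuous_map_initial_topology_component CollectI exI[of _ ?x] exI[of _ ?y]) auto
  moreover have "?f = (\<lambda>T. cinner (T \<xi>) \<eta>)"
  proof
    fix T
    show "?f T = cinner (T \<xi>) \<eta>" by (subst suminf_finite[of "{0}"]) auto
  qed
  ultimately have f: "continuous_map (ultraweak_topology K) euclidean (\<lambda>T. cinner (T \<xi>) \<eta>)" by simp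
  have "continuous_map (subtopology (ultraweak_topology (univ_space \<tau>)) (group_vN \<tau>))
       (subtopology (ultraweak_topology K) (commutant K (commutant K (range \<pi>)))) \<Phi>"
    using N by (simp add: normal_extension_def)
  then have "continuous_map (subtopology (ultraweak_topology (univ_space \<tau>)) (group_vN \<tau>)) (ultraweak_topology K) \<Phi>"
    by (simp add: continuous_map_in_subtopology)
  from continuous_map_compose[OF this f] show ?thesis by (simp add: o_def)
qed

text \<open>Both sides are ultraweakly continuous in \<open>T\<close> and agree on combinations of group elements, which
  are dense. This is what makes the values of \<open>fs_pairing\<close> and \<open>fs_action\<close> independent of the way in
  which a function is written as a coefficient.\<close>

theorem pairing_unique:
  fixes \<tau> :: "'g::group_add topology" and K :: "'h::complex_hilbert set"
  assumes gt: "group_topology \<tau>" and T: "T \<in> group_vN \<tau>"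
    and \<xi>\<eta>: "\<xi> \<in> univ_space \<tau>" "\<eta> \<in> univ_space \<tau>"
    and rep: "unitary_rep \<tau> K \<pi>" and N: "normal_extension \<tau> K \<pi> \<Phi>" and K: "\<xi>' \<in> K" "\<eta>' \<in> K"
    and eq: "coefficient (univ_rep \<tau>) \<xi> \<eta> = coefficient \<pi> \<xi>' \<eta>'"
  shows "cinner (\<Phi> T \<xi>') \<eta>' = cinner (T \<xi>) \<eta>"
proof -
  let ?f = "\<lambda>T. cinner (\<Phi> T \<xi>') \<eta>'"
  have "dist (?f T) (cinner (T \<xi>) \<eta>) \<le> e" if e: "e > 0" for e
  proof -
    let ?U = "subtopology (ultraweak_topology (univ_space \<tau>)) (group_vN \<tau>)"
    have top: "topspace ?U = group_vN \<tau>"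
      using group_vND(1) by (auto simp: ultraweak_topology_def)
    have "openin ?U {S \<in> topspace ?U. ?f S \<in> ball (?f T) (e / 2)}"
      by (rule openin_continuous_map_preimage[OF normal_extension_functional[OF rep N K]]) simp
    then obtain V where V: "openin (ultraweak_topology (univ_space \<tau>)) V"
      "{S \<in> group_vN \<tau>. ?f S \<in> ball (?f T) (e / 2)} = V \<inter> group_vN \<tau>"
      unfolding top openin_subtopology by blast
    have "T \<in> {S \<in> group_vN \<tau>. ?f S \<in> ball (?f T) (e / 2)}" using T e by simp
    then have "T \<in> V" unfolding V(2) by blast
    have r: "e / (2 * (norm \<eta> + 1)) > 0" using e by (simp add: add_nonneg_pos)
    obtain F c where F: "(\<lambda>x. \<Sum>s\<in>F. c s *\<^sub>C univ_rep \<tau> s x) \<in> V" "finite F"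
      "norm (T \<xi> - (\<Sum>s\<in>F. c s *\<^sub>C univ_rep \<tau> s \<xi>)) \<le> e / (2 * (norm \<eta> + 1))"
      by (rule ultraweak_approximation[OF gt T \<xi>\<eta>(1) V(1) \<open>T \<in> V\<close> r])
    let ?S = "\<lambda>x. \<Sum>s\<in>F. c s *\<^sub>C univ_rep \<tau> s x"
    have "dist (?f T) (?f ?S) < e / 2" 
    proof -
      have "?S \<in> V \<inter> group_vN \<tau>" using F(1) group_vN_sum by blast
      then show ?thesis unfolding V(2)[symmetric] by simp
    qed
    moreover have fS: "?f ?S = cinner (?S \<xi>) \<eta>"
    proof -
      have "cinner (\<pi> s \<xi>') \<eta>' = cinner (univ_rep \<tau> s \<xi>) \<eta>" for s
        using fun_cong[OF eq, of s] by (simp add: coefficient_def)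
      then show ?thesis
        by (simp add: normal_extension_sum[OF rep N F(2)] cinner_sum_left cinner_scaleC_left)
    qed
    moreover have "dist (?f ?S) (cinner (T \<xi>) \<eta>) \<le> e / 2"
      unfolding fS
    proof -
      have "cmod (cinner (T \<xi> - ?S \<xi>) \<eta>) \<le> norm (T \<xi> - ?S \<xi>) * norm \<eta>" by (rule cinner_Cauchy_Schwarz)
      also have "\<dots> \<le> e / (2 * (norm \<eta> + 1)) * (norm \<eta> + 1)"
        by (intro mult_mono F(3)) (use r in auto)
      also have "\<dots> = e / 2"
      proof -
        have cancel: "e / (2 * m) * m = e / 2" if "m \<noteq> 0" for m using that by simp
        have "norm \<eta> + 1 \<noteq> 0" using norm_ge_zero[of \<eta>] by linarith
        then show ?thesis by (rule cancel)
      qed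
      finally show "dist (cinner (?S \<xi>) \<eta>) (cinner (T \<xi>) \<eta>) \<le> e / 2"
        by (simp add: dist_norm cinner_diff_left norm_minus_commute)
    qed
    ultimately show ?thesis
      using dist_triangle[of "?f T" "cinner (T \<xi>) \<eta>" "?f ?S"] by linarith
  qed
  then have "dist (?f T) (cinner (T \<xi>) \<eta>) \<le> 0" by (rule field_le_epsilon[of _ 0, simplified])
  then show ?thesis by simp
qed

lemma normal_extension_identity: "normal_extension \<tau> (univ_space \<tau>) (univ_rep \<tau>) (\<lambda>T. T)"
  unfolding normal_extension_def group_vN_def[symmetric] by simp

lemma fs_pairing_coefficient:
  fixes \<tau> :: "'g::group_add topology"
  assumes gt: "group_topology \<tau>" and T: "T \<in> group_vN \<tau>"
    and \<xi>\<eta>: "\<xi> \<in> univ_space \<tau>" "\<eta> \<in> univ_space \<tau>"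
  shows "fs_pairing \<tau> (coefficient (univ_rep \<tau>) \<xi> \<eta>) T = cinner (T \<xi>) \<eta>"
  unfolding fs_pairing_def
proof (rule the_equality)
  show "\<exists>(K :: 'g gns_total set) \<pi> \<Phi> \<xi>' \<eta>'. unitary_rep \<tau> K \<pi> \<and> normal_extension \<tau> K \<pi> \<Phi> \<and> \<xi>' \<in> K \<and> \<eta>' \<in> K \<and>
     coefficient (univ_rep \<tau>) \<xi> \<eta> = coefficient \<pi> \<xi>' \<eta>' \<and> cinner (T \<xi>) \<eta> = cinner (\<Phi> T \<xi>') \<eta>'"
    using unitary_univ_rep[OF gt] normal_extension_identity \<xi>\<eta>
    by (intro exI[of _ "univ_space \<tau>"] exI[of _ "univ_rep \<tau>"] exI[of _ "\<lambda>T. T"] exI[of _ \<xi>] exI[of _ \<eta>]) simp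
qed (use pairing_unique[OF gt T \<xi>\<eta>] in metis)

lemma fs_action_coefficient:
  fixes \<tau> :: "'g::group_add topology"
  assumes gt: "group_topology \<tau>" and Z: "Z \<in> group_vN \<tau>"
    and \<xi>\<eta>: "\<xi> \<in> univ_space \<tau>" "\<eta> \<in> univ_space \<tau>"
  shows "fs_action \<tau> Z (coefficient (univ_rep \<tau>) \<xi> \<eta>) = coefficient (univ_rep \<tau>) (Z \<xi>) \<eta>"
  unfolding fs_action_def
proof (rule the_equality)
  show "\<exists>(K :: 'g gns_total set) \<pi> \<Phi> \<xi>' \<eta>'. unitary_rep \<tau> K \<pi> \<and> normal_extension \<tau> K \<pi> \<Phi> \<and> \<xi>' \<in> K \<and> \<eta>' \<in> K \<and>
     coefficient (univ_rep \<tau>) \<xi> \<eta> = coefficient \<pi> \<xi>' \<eta>' \<and>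
     coefficient (univ_rep \<tau>) (Z \<xi>) \<eta> = coefficient \<pi> (\<Phi> Z \<xi>') \<eta>'"
    using unitary_univ_rep[OF gt] normal_extension_identity \<xi>\<eta>
    by (intro exI[of _ "univ_space \<tau>"] exI[of _ "univ_rep \<tau>"] exI[of _ "\<lambda>T. T"] exI[of _ \<xi>] exI[of _ \<eta>]) simp
next
  fix v
  assume "\<exists>(K :: 'g gns_total set) \<pi> \<Phi> \<xi>' \<eta>'. unitary_rep \<tau> K \<pi> \<and> normal_extension \<tau> K \<pi> \<Phi> \<and> \<xi>' \<in> K \<and> \<eta>' \<in> K \<and>
     coefficient (univ_rep \<tau>) \<xi> \<eta> = coefficient \<pi> \<xi>' \<eta>' \<and> v = coefficient \<pi> (\<Phi> Z \<xi>') \<eta>'"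
  then obtain K :: "'g gns_total set" and \<pi> \<Phi> \<xi>' \<eta>' where *: "unitary_rep \<tau> K \<pi>" "normal_extension \<tau> K \<pi> \<Phi>"
    "\<xi>' \<in> K" "\<eta>' \<in> K" "coefficient (univ_rep \<tau>) \<xi> \<eta> = coefficient \<pi> \<xi>' \<eta>'" "v = coefficient \<pi> (\<Phi> Z \<xi>') \<eta>'"
    by blast
  show "v = coefficient (univ_rep \<tau>) (Z \<xi>) \<eta>"
  proof
    fix s
    have "\<Phi> (univ_rep \<tau> s \<circ> Z) = \<Phi> (univ_rep \<tau> s) \<circ> \<Phi> Z" "\<Phi> (univ_rep \<tau> s) = \<pi> s"
      using *(2) group_vN_univ_rep[of \<tau> s] Z by (simp_all add: normal_extension_def)
    then show "v s = coefficient (univ_rep \<tau>) (Z \<xi>) \<eta> s"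
      using pairing_unique[OF gt group_vN_comp[OF group_vN_univ_rep[of \<tau> s] Z] \<xi>\<eta> *(1-5)]
      by (simp add: *(6) coefficient_def)
  qed
qed

section \<open>The norm of the Fourier-Stieltjes algebra\<close>

lemma cinner_gns_space_orthogonal:
  assumes "u \<noteq> v" "z \<in> gns_space u" shows "cinner z (gns_vec v t) = 0"
  using assms(2) unfolding gns_space_def
proof (induction z rule: closed_cspan_induct)
  case (base z)
  then show ?case using gns_vec_orthogonal[OF assms(1)] by auto
next
  case closed
  show ?case by (intro closed_Collect_eq continuous_intros)
qed (auto simp: cinner_add_left cinner_scaleC_left)

text \<open>Elements of the von Neumann algebra preserve the mutually orthogonal GNS spaces, so no mixed terms
  occur. The right-hand side is linear in the coefficients \<open>c\<close>, and thereby the pairing in its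
  first argument.\<close>

lemma fs_pairing_sum:
  assumes gt: "group_topology \<tau>" and T: "T \<in> group_vN \<tau>" and F: "finite F" "F \<subseteq> cont_pos_def \<tau>"
  shows "fs_pairing \<tau> (\<lambda>s. \<Sum>v\<in>F. c v * v s) T = (\<Sum>v\<in>F. c v * cinner (T (gns_vec v 0)) (gns_vec v 0))"
proof -
  let ?\<xi> = "\<Sum>v\<in>F. c v *\<^sub>C gns_vec v 0" and ?\<eta> = "\<Sum>v\<in>F. gns_vec v 0"
  have vec: "gns_vec v 0 \<in> univ_space \<tau>" if "v \<in> F" for v using F(2) that by (auto intro: gns_vec_in_univ_space)
  have H: "?\<xi> \<in> univ_space \<tau>" "?\<eta> \<in> univ_space \<tau>"
    using vec by (auto intro!: csubspace_sum csubspaceD(3) csubspace_univ_space)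
  have "fs_pairing \<tau> (\<lambda>s. \<Sum>v\<in>F. c v * v s) T = fs_pairing \<tau> (coefficient (univ_rep \<tau>) ?\<xi> ?\<eta>) T"
    using sum_gns_coefficients[OF F] by (metis ext)
  also have "\<dots> = cinner (T ?\<xi>) ?\<eta>" by (rule fs_pairing_coefficient[OF gt T H])
  also have "T ?\<xi> = (\<Sum>v\<in>F. c v *\<^sub>C T (gns_vec v 0))"
    by (rule bounded_ops_sum[OF group_vND(1)[OF T] csubspace_univ_space vec])
  also have "cinner \<dots> ?\<eta> = (\<Sum>v\<in>F. \<Sum>w\<in>F. c v * cinner (T (gns_vec v 0)) (gns_vec w 0))"
    unfolding cinner_sum_left by (simp add: cinner_sum_right cinner_scaleC_left sum_distrib_left)
  also have "\<dots> = (\<Sum>v\<in>F. \<Sum>w\<in>F. if w = v then c v * cinner (T (gns_vec v 0)) (gns_vec v 0) else 0)"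
  proof (intro sum.cong refl)
    fix v w assume "v \<in> F"
    then have "T (gns_vec v 0) \<in> gns_space v" using F(2) group_vN_gns_space[OF _ T] by blast
    then have "cinner (T (gns_vec v 0)) (gns_vec w 0) = 0" if "w \<noteq> v"
      using cinner_gns_space_orthogonal that by metis
    then show "c v * cinner (T (gns_vec v 0)) (gns_vec w 0)
        = (if w = v then c v * cinner (T (gns_vec v 0)) (gns_vec v 0) else 0)"
      by auto
  qed
  finally show ?thesis using F(1) by simp
qed

lemma fs_pairing_add:
  assumes gt: "group_topology \<tau>" and T: "T \<in> group_vN \<tau>" and u: "u \<in> fs_algebra \<tau>" and v: "v \<in> fs_algebra \<tau>"
  shows "fs_pairing \<tau> (\<lambda>s. u s + v s) T = fs_pairing \<tau> u T + fs_pairing \<tau> v T"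
proof -
  obtain F c where F: "finite F" "F \<subseteq> cont_pos_def \<tau>" "u = (\<lambda>s. \<Sum>v\<in>F. c v * v s)"
    using u unfolding fs_algebra_def by blast
  obtain G d where G: "finite G" "G \<subseteq> cont_pos_def \<tau>" "v = (\<lambda>s. \<Sum>v\<in>G. d v * v s)"
    using v unfolding fs_algebra_def by blast
  let ?c = "\<lambda>v. if v \<in> F then c v else 0" and ?d = "\<lambda>v. if v \<in> G then d v else 0"
  have FG: "finite (F \<union> G)" "F \<union> G \<subseteq> cont_pos_def \<tau>" using F G by auto
  have 1: "u = (\<lambda>s. \<Sum>v\<in>F \<union> G. ?c v * v s)" and 2: "v = (\<lambda>s. \<Sum>v\<in>F \<union> G. ?d v * v s)"
    unfolding F(3) G(3) using F G by (auto intro!: ext sum.mono_neutral_cong_left)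
  have 3: "(\<lambda>s. u s + v s) = (\<lambda>s. \<Sum>v\<in>F \<union> G. (?c v + ?d v) * v s)"
    unfolding 1 2 distrib_right sum.distrib by (rule refl)
  show ?thesis
    unfolding 3 fs_pairing_sum[OF gt T FG] unfolding 1 2 fs_pairing_sum[OF gt T FG]
    by (simp only: distrib_right sum.distrib)
qed

lemma fs_pairing_scale:
  assumes gt: "group_topology \<tau>" and T: "T \<in> group_vN \<tau>" and u: "u \<in> fs_algebra \<tau>"
  shows "fs_pairing \<tau> (\<lambda>s. a * u s) T = a * fs_pairing \<tau> u T"
proof -
  obtain F c where F: "finite F" "F \<subseteq> cont_pos_def \<tau>" "u = (\<lambda>s. \<Sum>v\<in>F. c v * v s)"
    using u unfolding fs_algebra_def by blast
  have "(\<lambda>s. a * u s) = (\<lambda>s. \<Sum>v\<in>F. (a * c v) * v s)"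
    unfolding F(3) by (simp add: sum_distrib_left mult.assoc)
  then show ?thesis
    using fs_pairing_sum[OF gt T F(1,2), of "\<lambda>v. a * c v"] fs_pairing_sum[OF gt T F(1,2), of c]
    by (simp add: F(3) sum_distrib_left mult.assoc)
qed

lemma fs_pairing_univ_rep:
  assumes "group_topology \<tau>" "u \<in> fs_algebra \<tau>" shows "fs_pairing \<tau> u (univ_rep \<tau> s) = u s"
proof -
  obtain \<xi> \<eta> where "\<xi> \<in> univ_space \<tau>" "\<eta> \<in> univ_space \<tau>" "u = coefficient (univ_rep \<tau>) \<xi> \<eta>"
    using assms(2) by (rule fs_algebra_coefficient)
  then show ?thesis
    using fs_pairing_coefficient[OF assms(1) group_vN_univ_rep] by (simp add: coefficient_def)
qed

definition vN_ball :: "'g::group_add topology \<Rightarrow> ('g gns_total \<Rightarrow> 'g gns_total) set" where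
  "vN_ball \<tau> = {T \<in> group_vN \<tau>. \<forall>x\<in>univ_space \<tau>. norm (T x) \<le> norm x}"

lemma univ_rep_in_vN_ball: "univ_rep \<tau> s \<in> vN_ball \<tau>"
  by (simp add: vN_ball_def group_vN_univ_rep univ_rep_apply norm_gns_shift)

lemma fs_norm_upper:
  assumes gt: "group_topology \<tau>" and u: "u \<in> fs_algebra \<tau>" and T: "T \<in> vN_ball \<tau>"
  shows "cmod (fs_pairing \<tau> u T) \<le> fs_norm \<tau> u"
proof -
  obtain \<xi> \<eta> where \<xi>\<eta>: "\<xi> \<in> univ_space \<tau>" "\<eta> \<in> univ_space \<tau>" "u = coefficient (univ_rep \<tau>) \<xi> \<eta>"
    using u by (rule fs_algebra_coefficient)
  have "cmod (fs_pairing \<tau> u S) \<le> norm \<xi> * norm \<eta>" if S: "S \<in> vN_ball \<tau>" for S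
  proof -
    have "cmod (cinner (S \<xi>) \<eta>) \<le> norm (S \<xi>) * norm \<eta>" by (rule cinner_Cauchy_Schwarz)
    also have "\<dots> \<le> norm \<xi> * norm \<eta>" using S \<xi>\<eta>(1) by (intro mult_right_mono) (auto simp: vN_ball_def)
    finally show ?thesis using S fs_pairing_coefficient[OF gt _ \<xi>\<eta>(1,2)] by (simp add: \<xi>\<eta>(3) vN_ball_def)
  qed
  then have "bdd_above ((\<lambda>T. cmod (fs_pairing \<tau> u T)) ` vN_ball \<tau>)" by (rule bdd_aboveI2)
  then show ?thesis unfolding fs_norm_def vN_ball_def[symmetric] by (rule cSUP_upper[OF T])
qed

lemma fs_norm_least:
  "(\<And>T. T \<in> vN_ball \<tau> \<Longrightarrow> cmod (fs_pairing \<tau> u T) \<le> c) \<Longrightarrow> fs_norm \<tau> u \<le> c"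
  unfolding fs_norm_def vN_ball_def[symmetric]
  by (rule cSUP_least) (use univ_rep_in_vN_ball in auto)

section \<open>Central projections acting on the Fourier-Stieltjes algebra\<close>

locale central_projection =
  fixes \<tau> :: "'g::group_add topology" and Z :: "'g gns_total \<Rightarrow> 'g gns_total"
  assumes group_topology: "group_topology \<tau>"
    and in_vN: "Z \<in> group_vN \<tau>"
    and idem: "Z \<circ> Z = Z"
    and central: "univ_rep \<tau> s \<circ> Z = Z \<circ> univ_rep \<tau> s"
    and contraction: "x \<in> univ_space \<tau> \<Longrightarrow> norm (Z x) \<le> norm x"
begin

abbreviation H where "H \<equiv> univ_space \<tau>"
abbreviation Z_compl where "Z_compl \<equiv> \<lambda>x. op_id H x - Z x"
abbreviation component where "component \<equiv> fs_action \<tau> Z ` fs_algebra \<tau>"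
abbreviation co_component where "co_component \<equiv> fs_action \<tau> Z_compl ` fs_algebra \<tau>"

lemmas bounded = group_vND(1)[OF in_vN]
lemmas in_H = csubspaceD[OF csubspace_univ_space[of \<tau>]]

lemma Z_in_H: "x \<in> H \<Longrightarrow> Z x \<in> H"
  by (rule bounded_opsD(1)[OF bounded])

lemma Z_Z: "Z (Z x) = Z x"
  using fun_cong[OF idem, of x] by simp

lemma Z_shift: "x \<in> H \<Longrightarrow> Z (gns_shift s x) = gns_shift s (Z x)"
  using fun_cong[OF central, of s x] by (simp add: univ_rep_apply Z_in_H)

lemma orthogonal: "x \<in> H \<Longrightarrow> y \<in> H \<Longrightarrow> cinner (Z x) (y - Z y) = 0"
  by (rule idempotent_contraction_orthogonal[OF bounded csubspace_univ_space contraction idem])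

lemma selfadjoint:
  assumes "x \<in> H" "y \<in> H" shows "cinner (Z x) y = cinner x (Z y)"
proof -
  have "cinner (Z x) y = cinner (Z x) (Z y)" using orthogonal[OF assms] by (simp add: cinner_diff_right)
  moreover have "cinner (x - Z x) (Z y) = 0"
    by (subst cinner_commute) (simp add: orthogonal[OF assms(2,1)])
  then have "cinner x (Z y) = cinner (Z x) (Z y)" by (simp add: cinner_diff_left)
  ultimately show ?thesis by simp
qed

lemma vN_commute: "T \<in> group_vN \<tau> \<Longrightarrow> T (Z x) = Z (T x)"
  by (rule group_vND(2), assumption, rule commutantI[OF bounded csubspace_univ_space])
     (auto simp: univ_rep_bounded univ_rep_apply Z_in_H Z_shift)

lemma norm_split: "x \<in> H \<Longrightarrow> (norm x)\<^sup>2 = (norm (Z x))\<^sup>2 + (norm (x - Z x))\<^sup>2"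
  using norm_add_square[of "Z x" "x - Z x"] orthogonal[of x x] by simp

lemma complement: "central_projection \<tau> Z_compl"
proof
  have Zd: "Z (x - y) = Z x - Z y" if "x \<in> H" "y \<in> H" for x y
    by (rule bounded_ops_diff[OF bounded csubspace_univ_space that])
  have Z0: "Z 0 = 0" by (rule bounded_ops_zero[OF bounded csubspace_univ_space])
  have id: "op_id H x = (if x \<in> H then x else 0)" for x by (simp add: op_id_def op_restrict_def)
  have out: "Z x = 0" if "x \<notin> H" for x by (rule bounded_opsD(2)[OF bounded that])
  show "group_topology \<tau>" by (rule group_topology)
  show "Z_compl \<in> group_vN \<tau>"
    using group_vN_add[OF group_vN_id group_vN_scale[OF in_vN, of "-1"]] by (simp add: scaleC_minus_one)
  show "Z_compl \<circ> Z_compl = Z_compl"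
    by (rule ext) (auto simp: id out Z0 Zd Z_in_H Z_Z in_H)
  show "univ_rep \<tau> s \<circ> Z_compl = Z_compl \<circ> univ_rep \<tau> s" for s
  proof
    fix x
    show "(univ_rep \<tau> s \<circ> Z_compl) x = (Z_compl \<circ> univ_rep \<tau> s) x"
    proof (cases "x \<in> H")
      case True
      then show ?thesis
        by (simp add: id univ_rep_apply gns_shift_in_univ_space in_H Z_in_H Z_shift gns_shift_diff)
    next
      case False
      then show ?thesis
        using bounded_opsD(2)[OF univ_rep_bounded False] bounded_ops_zero[OF univ_rep_bounded csubspace_univ_space]
        by (simp add: id out Z0)
    qed
  qed
  show "norm (op_id H x - Z x) \<le> norm x" if "x \<in> H" for x
    using norm_split[OF that] that by (intro power2_le_imp_le[OF _ norm_ge_zero]) (simp add: id)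
qed

lemma action_coefficient:
  "\<xi> \<in> H \<Longrightarrow> \<eta> \<in> H \<Longrightarrow> fs_action \<tau> Z (coefficient (univ_rep \<tau>) \<xi> \<eta>) = coefficient (univ_rep \<tau>) (Z \<xi>) \<eta>"
  by (rule fs_action_coefficient[OF group_topology in_vN])

lemma coefficient_fs: "\<xi> \<in> H \<Longrightarrow> \<eta> \<in> H \<Longrightarrow> coefficient (univ_rep \<tau>) \<xi> \<eta> \<in> fs_algebra \<tau>"
  by (rule coefficient_in_fs_algebra[OF unitary_univ_rep[OF group_topology]])

lemma action_pairing:
  assumes "u \<in> fs_algebra \<tau>"
  shows "fs_action \<tau> Z u s = fs_pairing \<tau> u (univ_rep \<tau> s \<circ> Z)"
proof -
  obtain \<xi> \<eta> where *: "\<xi> \<in> H" "\<eta> \<in> H" "u = coefficient (univ_rep \<tau>) \<xi> \<eta>"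
    using assms by (rule fs_algebra_coefficient)
  show ?thesis
    unfolding *(3) action_coefficient[OF *(1,2)]
    by (simp add: coefficient_def fs_pairing_coefficient[OF group_topology
          group_vN_comp[OF group_vN_univ_rep in_vN] *(1,2), unfolded coefficient_def])
qed

lemma action_in_fs: "u \<in> fs_algebra \<tau> \<Longrightarrow> fs_action \<tau> Z u \<in> fs_algebra \<tau>"
  by (erule fs_algebra_coefficient) (simp add: action_coefficient coefficient_fs Z_in_H)

lemma action_action: "u \<in> fs_algebra \<tau> \<Longrightarrow> fs_action \<tau> Z (fs_action \<tau> Z u) = fs_action \<tau> Z u"
  by (erule fs_algebra_coefficient) (simp add: action_coefficient Z_in_H Z_Z)

lemma action_add:
  "u \<in> fs_algebra \<tau> \<Longrightarrow> v \<in> fs_algebra \<tau> \<Longrightarrow>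
    fs_action \<tau> Z (\<lambda>s. u s + v s) = (\<lambda>s. fs_action \<tau> Z u s + fs_action \<tau> Z v s)"
  by (rule ext) (simp add: action_pairing fs_add
      fs_pairing_add[OF group_topology group_vN_comp[OF group_vN_univ_rep in_vN]])

lemma action_scale:
  "u \<in> fs_algebra \<tau> \<Longrightarrow> fs_action \<tau> Z (\<lambda>s. c * u s) = (\<lambda>s. c * fs_action \<tau> Z u s)"
  by (rule ext) (simp add: action_pairing fs_scale
      fs_pairing_scale[OF group_topology group_vN_comp[OF group_vN_univ_rep in_vN]])

lemma image_action_eq: "component = {u \<in> fs_algebra \<tau>. fs_action \<tau> Z u = u}"
  using action_in_fs action_action by (auto simp: image_iff) metis

text \<open>As \<open>Z\<close> is selfadjoint and central, it can be applied to the second vector of a coefficient, too.\<close>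

lemma image_action_coefficient:
  assumes "u \<in> component"
  obtains \<xi> \<eta> where "\<xi> \<in> H" "\<eta> \<in> H" "Z \<xi> = \<xi>" "Z \<eta> = \<eta>" "u = coefficient (univ_rep \<tau>) \<xi> \<eta>"
proof -
  obtain v where "v \<in> fs_algebra \<tau>" and v: "u = fs_action \<tau> Z v" using assms by blast
  then obtain \<xi> \<eta> where *: "\<xi> \<in> H" "\<eta> \<in> H" "v = coefficient (univ_rep \<tau>) \<xi> \<eta>"
    by (elim fs_algebra_coefficient)
  have "u = coefficient (univ_rep \<tau>) (Z \<xi>) (Z \<eta>)"
  proof
    fix s
    have "cinner (gns_shift s (Z \<xi>)) \<eta> = cinner (Z (gns_shift s (Z \<xi>))) \<eta>"
      using *(1) by (simp add: Z_shift Z_in_H Z_Z)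
    also have "\<dots> = cinner (gns_shift s (Z \<xi>)) (Z \<eta>)"
      using *(1,2) by (intro selfadjoint gns_shift_in_univ_space Z_in_H)
    finally show "u s = coefficient (univ_rep \<tau>) (Z \<xi>) (Z \<eta>) s"
      using * by (simp add: v action_coefficient) (simp add: coefficient_def univ_rep_apply Z_in_H)
  qed
  then show thesis using that[of "Z \<xi>" "Z \<eta>"] * by (simp add: Z_in_H Z_Z)
qed

lemma subspace: "fs_subspace \<tau> component"
  unfolding fs_subspace_def image_action_eq
  using action_scale[OF fs_zero, of 0] by (auto simp: fs_zero fs_add fs_scale action_add action_scale)

lemma translation_invariant: "translation_invariant component"
  unfolding translation_invariant_def
proof (intro ballI allI)
  fix u t assume "u \<in> component"
  then obtain \<xi> \<eta> where *: "\<xi> \<in> H" "\<eta> \<in> H" "Z \<xi> = \<xi>" "u = coefficient (univ_rep \<tau>) \<xi> \<eta>"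
    by (elim image_action_coefficient)
  have shift: "coefficient (univ_rep \<tau>) x y \<in> component" if "x \<in> H" "y \<in> H" "Z x = x" for x y
    unfolding image_action_eq using that by (simp add: coefficient_fs action_coefficient)
  have "(\<lambda>s. u (s + t)) = coefficient (univ_rep \<tau>) (gns_shift t \<xi>) \<eta>"
    using *(1) unfolding *(4) coefficient_def
    by (simp add: univ_rep_apply gns_shift_in_univ_space gns_shift_plus)
  then have r: "(\<lambda>s. u (s + t)) \<in> component"
    using shift[of "gns_shift t \<xi>" \<eta>] * by (simp add: gns_shift_in_univ_space Z_shift)
  have "cinner (gns_shift t x) y = cinner x (gns_shift (- t) y)" for x y
    using cinner_gns_shift[of "- t" "gns_shift t x" y] by (simp add: gns_shift_plus[symmetric] gns_shift_zero)
  then have "(\<lambda>s. u (t + s)) = coefficient (univ_rep \<tau>) \<xi> (gns_shift (- t) \<eta>)"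
    using *(1) unfolding *(4) coefficient_def by (simp add: univ_rep_apply gns_shift_plus)
  then have l: "(\<lambda>s. u (t + s)) \<in> component"
    using shift[of \<xi> "gns_shift (- t) \<eta>"] * by (simp add: gns_shift_in_univ_space)
  show "(\<lambda>s. u (t + s)) \<in> component \<and> (\<lambda>s. u (s + t)) \<in> component"
    using l r by blast
qed

lemma univ_rep_Z_in_vN_ball: "univ_rep \<tau> s \<circ> Z \<in> vN_ball \<tau>"
  unfolding vN_ball_def using contraction group_vN_comp[OF group_vN_univ_rep in_vN]
  by (simp add: univ_rep_apply Z_in_H norm_gns_shift)

text \<open>The norm dominates the uniform norm, and also the uniform norm of the image under \<open>Z\<close>, because
  group elements multiplied by \<open>Z\<close> are contractions in the von Neumann algebra. Hence a limit of
  functions fixed by \<open>Z\<close> is the pointwise limit of these functions and of their images.\<close>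

lemma closed: "fs_closed \<tau> component"
  unfolding fs_closed_def
proof (intro allI impI, elim conjE)
  fix X u
  assume X: "range X \<subseteq> component" and u: "u \<in> fs_algebra \<tau>"
    and lim: "(\<lambda>n. fs_norm \<tau> (\<lambda>s. X n s - u s)) \<longlonglongrightarrow> 0"
  have Xn: "X n \<in> fs_algebra \<tau>" "fs_action \<tau> Z (X n) = X n" for n
    using X by (auto simp: image_action_eq)
  have diff: "(\<lambda>s. X n s - u s) \<in> fs_algebra \<tau>" for n
    using fs_add[OF Xn(1) fs_scale[OF u, of "-1"], of n] by simp
  have pair: "fs_pairing \<tau> (\<lambda>s. X n s - u s) T = fs_pairing \<tau> (X n) T - fs_pairing \<tau> u T" if "T \<in> group_vN \<tau>" for n T
    using fs_pairing_add[OF group_topology that Xn(1) fs_scale[OF u, of "-1"], of n]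
      fs_pairing_scale[OF group_topology that u, of "-1"] by simp
  have "fs_action \<tau> Z u s = u s" for s
  proof -
    have "cmod (X n s - u s) \<le> fs_norm \<tau> (\<lambda>s. X n s - u s)" for n
      using fs_norm_upper[OF group_topology diff univ_rep_in_vN_ball, of n s]
      by (simp add: fs_pairing_univ_rep[OF group_topology diff])
    then have "(\<lambda>n. X n s - u s) \<longlonglongrightarrow> 0" by (intro Lim_null_comparison[OF always_eventually lim]) blast
    then have 1: "(\<lambda>n. X n s) \<longlonglongrightarrow> u s" by (rule LIM_zero_cancel)
    have "cmod (X n s - fs_action \<tau> Z u s) \<le> fs_norm \<tau> (\<lambda>s. X n s - u s)" for n
      using fs_norm_upper[OF group_topology diff univ_rep_Z_in_vN_ball, of n s]
        pair[OF group_vN_comp[OF group_vN_univ_rep in_vN], of n s]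
      by (simp add: action_pairing[OF Xn(1), symmetric] action_pairing[OF u, symmetric] Xn(2))
    then have "(\<lambda>n. X n s - fs_action \<tau> Z u s) \<longlonglongrightarrow> 0"
      by (intro Lim_null_comparison[OF always_eventually lim]) blast
    then have "(\<lambda>n. X n s) \<longlonglongrightarrow> fs_action \<tau> Z u s" by (rule LIM_zero_cancel)
    then show ?thesis using 1 by (rule LIMSEQ_unique)
  qed
  then show "u \<in> component" using u by (auto simp: image_action_eq)
qed

lemma action_split:
  assumes "u \<in> fs_algebra \<tau>"
  shows "u = (\<lambda>s. fs_action \<tau> Z u s + fs_action \<tau> Z_compl u s)"
proof -
  interpret c: central_projection \<tau> Z_compl by (rule complement)
  obtain \<xi> \<eta> where *: "\<xi> \<in> H" "\<eta> \<in> H" "u = coefficient (univ_rep \<tau>) \<xi> \<eta>"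
    using assms by (rule fs_algebra_coefficient)
  show ?thesis
    unfolding *(3) action_coefficient[OF *(1,2)] c.action_coefficient[OF *(1,2)]
    using *(1) by (simp add: coefficient_def op_id_def op_restrict_def univ_rep_apply Z_in_H in_H
        gns_shift_diff cinner_diff_left)
qed

text \<open>The two components live on orthogonal invariant subspaces, so contractions \<open>T\<close> and \<open>S\<close> can be
  glued to the contraction \<open>T Z + S (1 - Z)\<close>. If \<open>T\<close> and \<open>S\<close> nearly attain the two norms, the glued
  operator, with phases that make both pairings nonnegative, nearly attains their sum.\<close>

lemma l1_norm:
  assumes u: "u \<in> component"
    and v: "v \<in> co_component"
  shows "fs_norm \<tau> (\<lambda>s. u s + v s) = fs_norm \<tau> u + fs_norm \<tau> v"
proof (rule antisym)
  interpret c: central_projection \<tau> Z_compl by (rule complement)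
  have u_fs: "u \<in> fs_algebra \<tau>" and v_fs: "v \<in> fs_algebra \<tau>"
    using u v unfolding image_action_eq c.image_action_eq by auto
  show "fs_norm \<tau> (\<lambda>s. u s + v s) \<le> fs_norm \<tau> u + fs_norm \<tau> v"
  proof (rule fs_norm_least)
    fix T assume T: "T \<in> vN_ball \<tau>"
    then have "fs_pairing \<tau> (\<lambda>s. u s + v s) T = fs_pairing \<tau> u T + fs_pairing \<tau> v T"
      by (intro fs_pairing_add[OF group_topology] u_fs v_fs) (simp add: vN_ball_def)
    then show "cmod (fs_pairing \<tau> (\<lambda>s. u s + v s) T) \<le> fs_norm \<tau> u + fs_norm \<tau> v"
      using fs_norm_upper[OF group_topology u_fs T] fs_norm_upper[OF group_topology v_fs T]
        norm_triangle_ineq[of "fs_pairing \<tau> u T" "fs_pairing \<tau> v T"] by simp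
  qed
  have glue: "cmod (fs_pairing \<tau> u T) + cmod (fs_pairing \<tau> v S) \<le> fs_norm \<tau> (\<lambda>s. u s + v s)"
    if T: "T \<in> vN_ball \<tau>" and S: "S \<in> vN_ball \<tau>" for T S
  proof -
    have TvN: "T \<in> group_vN \<tau>" and SvN: "S \<in> group_vN \<tau>" using T S by (simp_all add: vN_ball_def)
    obtain \<xi> \<eta> where \<xi>: "\<xi> \<in> H" "\<eta> \<in> H" "Z \<xi> = \<xi>" "u = coefficient (univ_rep \<tau>) \<xi> \<eta>"
      using u by (elim image_action_coefficient)
    obtain \<xi>' \<eta>' where \<xi>': "\<xi>' \<in> H" "\<eta>' \<in> H" "op_id H \<xi>' - Z \<xi>' = \<xi>'" "v = coefficient (univ_rep \<tau>) \<xi>' \<eta>'"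
      using v by (elim c.image_action_coefficient)
    have Z\<xi>': "Z \<xi>' = 0" using \<xi>'(1,3) by (simp add: op_id_def op_restrict_def)
    (* Both factors are phases, or 0 where the pairing vanishes. *)
    define a where "a = cnj (sgn (fs_pairing \<tau> u T))"
    define b where "b = cnj (sgn (fs_pairing \<tau> v S))"
    have phase: "cnj (sgn z) * z = complex_of_real (cmod z)" "cmod (cnj (sgn z)) \<le> 1" for z :: complex
    proof -
      have "cnj (sgn z) * z = cnj (sgn z) * (sgn z * complex_of_real (cmod z))"
        by (simp add: sgn_eq)
      also have "\<dots> = (sgn z * cnj (sgn z)) * complex_of_real (cmod z)" by simp
      also have "\<dots> = complex_of_real (cmod z)"
        by (cases "z = 0") (simp_all add: complex_norm_square[symmetric] norm_sgn)
      finally show "cnj (sgn z) * z = complex_of_real (cmod z)" .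
      show "cmod (cnj (sgn z)) \<le> 1" by (simp add: norm_sgn)
    qed
    define R where "R = (\<lambda>x. a *\<^sub>C (T \<circ> Z) x + b *\<^sub>C (S \<circ> Z_compl) x)"
    have RvN: "R \<in> group_vN \<tau>"
      unfolding R_def by (intro group_vN_add group_vN_scale group_vN_comp TvN SvN in_vN c.in_vN)
    have T0: "T 0 = 0" "S 0 = 0"
      using bounded_ops_zero[OF group_vND(1) csubspace_univ_space] TvN SvN by blast+
    have R_ball: "R \<in> vN_ball \<tau>"
      unfolding vN_ball_def
    proof (intro CollectI conjI ballI RvN)
      fix x assume x: "x \<in> H"
      then have Sx: "S x \<in> H" and Tx: "T x \<in> H" using bounded_opsD(1)[OF group_vND(1)] TvN SvN by blast+
      have R_x: "R x = a *\<^sub>C T (Z x) + b *\<^sub>C S (x - Z x)"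
        using x by (simp add: R_def op_id_def op_restrict_def)
      have "S (x - Z x) = S x - Z (S x)"
        using bounded_ops_diff[OF group_vND(1)[OF SvN] csubspace_univ_space x Z_in_H[OF x]] vN_commute[OF SvN]
        by simp
      then have "cinner (T (Z x)) (S (x - Z x)) = 0"
        using orthogonal[OF Tx Sx] vN_commute[OF TvN] by simp
      then have "(norm (R x))\<^sup>2 = (cmod a * norm (T (Z x)))\<^sup>2 + (cmod b * norm (S (x - Z x)))\<^sup>2"
        unfolding R_x norm_add_square by (simp add: cinner_scaleC_left cinner_scaleC_right norm_scaleC)
      also have "\<dots> \<le> (norm (Z x))\<^sup>2 + (norm (x - Z x))\<^sup>2"
      proof (intro add_mono power_mono)
        have "norm (T (Z x)) \<le> norm (Z x)" using T Z_in_H[OF x] by (simp add: vN_ball_def)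
        then show "cmod a * norm (T (Z x)) \<le> norm (Z x)"
          using mult_mono[OF phase(2) _ _ norm_ge_zero, of "norm (T (Z x))" "norm (Z x)" "fs_pairing \<tau> u T"]
          by (simp add: a_def)
        have "norm (S (x - Z x)) \<le> norm (x - Z x)" using S in_H(5)[OF x Z_in_H[OF x]] by (simp add: vN_ball_def)
        then show "cmod b * norm (S (x - Z x)) \<le> norm (x - Z x)"
          using mult_mono[OF phase(2) _ _ norm_ge_zero, of "norm (S (x - Z x))" "norm (x - Z x)" "fs_pairing \<tau> v S"]
          by (simp add: b_def)
      qed simp_all
      also have "\<dots> = (norm x)\<^sup>2" using norm_split[OF x] by simp
      finally show "norm (R x) \<le> norm x" by (rule power2_le_imp_le) simp
    qed
    have "R \<xi> = a *\<^sub>C T \<xi>" using \<xi> by (simp add: R_def op_id_def op_restrict_def T0)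
    then have 1: "fs_pairing \<tau> u R = a * fs_pairing \<tau> u T"
      using fs_pairing_coefficient[OF group_topology _ \<xi>(1,2)] RvN TvN by (simp add: \<xi>(4) cinner_scaleC_left)
    have "R \<xi>' = b *\<^sub>C S \<xi>'" using \<xi>' by (simp add: R_def Z\<xi>' op_id_def op_restrict_def T0)
    then have 2: "fs_pairing \<tau> v R = b * fs_pairing \<tau> v S"
      using fs_pairing_coefficient[OF group_topology _ \<xi>'(1,2)] RvN SvN by (simp add: \<xi>'(4) cinner_scaleC_left)
    have "fs_pairing \<tau> (\<lambda>s. u s + v s) R = complex_of_real (cmod (fs_pairing \<tau> u T) + cmod (fs_pairing \<tau> v S))"
      unfolding fs_pairing_add[OF group_topology RvN u_fs v_fs] 1 2 a_def b_def phase by simp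
    then have "cmod (fs_pairing \<tau> u T) + cmod (fs_pairing \<tau> v S) = cmod (fs_pairing \<tau> (\<lambda>s. u s + v s) R)"
      by (simp del: of_real_add)
    also have "\<dots> \<le> fs_norm \<tau> (\<lambda>s. u s + v s)"
      by (rule fs_norm_upper[OF group_topology fs_add[OF u_fs v_fs] R_ball])
    finally show ?thesis .
  qed
  have "fs_norm \<tau> u \<le> fs_norm \<tau> (\<lambda>s. u s + v s) - cmod (fs_pairing \<tau> v S)" if "S \<in> vN_ball \<tau>" for S
    by (rule fs_norm_least) (use glue[OF _ that] in \<open>simp add: le_diff_eq\<close>)
  then have "fs_norm \<tau> v \<le> fs_norm \<tau> (\<lambda>s. u s + v s) - fs_norm \<tau> u"
    by (intro fs_norm_least) (simp add: le_diff_eq add.commute)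
  then show "fs_norm \<tau> u + fs_norm \<tau> v \<le> fs_norm \<tau> (\<lambda>s. u s + v s)" by simp
qed

theorem l1_direct_sum:
  "l1_direct_sum \<tau> component co_component"
proof -
  let ?Z = Z_compl
  interpret c: central_projection \<tau> Z_compl by (rule complement)
  have "fs_algebra \<tau> = {\<lambda>s. u s + v s | u v. u \<in> component \<and> v \<in> co_component}"
  proof (intro equalityI subsetI)
    fix u assume "u \<in> fs_algebra \<tau>"
    then show "u \<in> {\<lambda>s. u s + v s | u v. u \<in> component \<and> v \<in> co_component}"
      using action_split[of u] by blast
  next
    fix u assume "u \<in> {\<lambda>s. u s + v s | u v. u \<in> component \<and> v \<in> co_component}"
    then show "u \<in> fs_algebra \<tau>" by (auto intro!: fs_add action_in_fs c.action_in_fs)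
  qed
  moreover have "component \<inter> co_component = {\<lambda>s. 0}"
  proof (intro equalityI subsetI)
    fix u assume u: "u \<in> component \<inter> co_component"
    then have *: "u \<in> fs_algebra \<tau>" "fs_action \<tau> Z u = u" "fs_action \<tau> ?Z u = u"
      unfolding image_action_eq c.image_action_eq by auto
    have "u s = u s + u s" for s using fun_cong[OF action_split[OF *(1)], of s] *(2,3) by simp
    then show "u \<in> {\<lambda>s. 0}" by auto
  next
    fix u :: "'g \<Rightarrow> complex" assume "u \<in> {\<lambda>s. 0}"
    then show "u \<in> component \<inter> co_component"
      using subspace c.subspace by (simp add: fs_subspace_def)
  qed
  ultimately show ?thesis
    unfolding l1_direct_sum_def using subspace c.subspace l1_norm by blast
qed

end

section \<open>The topology of a central idempotent\<close>

locale central_idempotent =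
  fixes \<tau>G :: "'g::group_add topology" and p :: "'g gns_total \<Rightarrow> 'g gns_total" and \<tau> :: "'g topology"
  assumes group_topology_G: "group_topology \<tau>G"
    and p: "p \<in> central_idempotents \<tau>G"
    and \<tau>_def: "\<tau> = idempotent_topology \<tau>G p"
begin

lemma p_cpt: "p \<in> univ_cpt \<tau>G"
  using p by (simp add: central_idempotents_def)

sublocale central_projection \<tau>G p
proof
  show "p \<in> group_vN \<tau>G" using p_cpt univ_cpt_subset_group_vN by blast
  show "p \<circ> p = p" "univ_rep \<tau>G s \<circ> p = p \<circ> univ_rep \<tau>G s" for s
    using p by (auto simp: central_idempotents_def)
qed (use group_topology_G univ_cpt_contraction[OF p_cpt] in auto)

lemma p_rep_cpt: "p \<circ> univ_rep \<tau>G s \<in> univ_cpt \<tau>G"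
  by (rule univ_cpt_comp_univ_rep[OF p_cpt])

lemma topspace_univ_cpt: "topspace (univ_cpt_topology \<tau>G) = univ_cpt \<tau>G"
  by (auto simp: univ_cpt_topology_def univ_cpt_iff)

lemma topspace_\<tau>: "topspace \<tau> = UNIV"
  unfolding \<tau>_def idempotent_topology_def topspace_pullback_topology topspace_univ_cpt
  using p_rep_cpt by auto

lemma continuous_p_coefficient:
  assumes x: "x \<in> H" and y: "y \<in> H"
  shows "continuous_map \<tau> euclidean (\<lambda>s. cinner (gns_shift s (p x)) y)"
proof -
  have "continuous_map (univ_cpt_topology \<tau>G) euclidean (\<lambda>T. cinner (T x) y)"
    unfolding univ_cpt_topology_def
    by (rule continuous_map_from_subtopology[OF continuous_map_weak_op_component[OF x y]])
  from continuous_map_pullback[OF this, of UNIV "\<lambda>s. p \<circ> univ_rep \<tau>G s"]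
  have "continuous_map \<tau> euclidean ((\<lambda>T. cinner (T x) y) \<circ> (\<lambda>s. p \<circ> univ_rep \<tau>G s))"
    unfolding \<tau>_def idempotent_topology_def .
  then show ?thesis using x by (simp add: o_def univ_rep_apply Z_shift)
qed

lemma coarser: "continuous_map \<tau> euclidean f \<Longrightarrow> continuous_map \<tau>G euclidean f"
proof -
  have "continuous_map \<tau>G (univ_cpt_topology \<tau>G) (\<lambda>s. p \<circ> univ_rep \<tau>G s)"
    unfolding univ_cpt_topology_def continuous_map_in_subtopology continuous_map_weak_op_iff
  proof (intro conjI ballI)
    show "p \<circ> univ_rep \<tau>G s \<in> bounded_ops H" for s using p_rep_cpt[of s] by (simp add: univ_cpt_iff)
    show "(\<lambda>s. p \<circ> univ_rep \<tau>G s) \<in> topspace \<tau>G \<rightarrow> univ_cpt \<tau>G" using p_rep_cpt by auto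
    fix x y assume "x \<in> H" "y \<in> H"
    then show "continuous_map \<tau>G euclidean (\<lambda>s. cinner ((p \<circ> univ_rep \<tau>G s) x) y)"
      using univ_rep_continuous[OF group_topology_G Z_in_H, of x y] by (simp add: univ_rep_apply Z_shift)
  qed
  moreover have "topspace \<tau>G = UNIV" using group_topology_G by (simp add: group_topology_def)
  ultimately have "continuous_map \<tau>G \<tau> (\<lambda>s. s)"
    unfolding \<tau>_def idempotent_topology_def by (intro continuous_map_pullback') (auto simp: o_def)
  moreover assume "continuous_map \<tau> euclidean f"
  ultimately show ?thesis using continuous_map_compose by (fastforce simp: o_def)
qed

text \<open>The hypothesis says that \<open>p \<circ> univ_rep \<tau>G (h s)\<close> converges weakly to \<open>p \<circ> univ_rep \<tau>G t\<close>; as \<open>\<tau>\<close> is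
  pulled back along this map, \<open>h\<close> converges to \<open>t\<close> in \<open>\<tau>\<close>.\<close>

lemma tendsto_of_continuous:
  assumes f: "continuous_map \<tau> euclidean f"
    and lim: "\<And>x y. x \<in> H \<Longrightarrow> y \<in> H \<Longrightarrow>
      ((\<lambda>s. cinner (p (gns_shift (h s) x)) y) \<longlongrightarrow> cinner (p (gns_shift t x)) y) \<F>"
  shows "((\<lambda>s. f (h s)) \<longlongrightarrow> f t) \<F>"
proof -
  have "limitin (weak_op_topology H) (\<lambda>s. p \<circ> univ_rep \<tau>G (h s)) (p \<circ> univ_rep \<tau>G t) \<F>"
    using lim p_rep_cpt by (subst limitin_weak_op_iff) (auto simp: univ_cpt_iff univ_rep_apply)
  then have W: "\<forall>\<^sub>F s in \<F>. p \<circ> univ_rep \<tau>G (h s) \<in> V"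
    if "openin (weak_op_topology H) V" "p \<circ> univ_rep \<tau>G t \<in> V" for V
    using that by (auto simp: limitin_def)
  have "limitin \<tau> h t \<F>"
    unfolding limitin_def
  proof (intro conjI allI impI)
    show "t \<in> topspace \<tau>" by (simp add: topspace_\<tau>)
    fix U assume U: "openin \<tau> U \<and> t \<in> U"
    then obtain V where V: "openin (univ_cpt_topology \<tau>G) V" "U = (\<lambda>s. p \<circ> univ_rep \<tau>G s) -` V \<inter> UNIV"
      unfolding \<tau>_def idempotent_topology_def openin_pullback_topology by blast
    then obtain V' where V': "openin (weak_op_topology H) V'" "V = V' \<inter> univ_cpt \<tau>G"
      unfolding univ_cpt_topology_def openin_subtopology by blast
    have "\<forall>\<^sub>F s in \<F>. p \<circ> univ_rep \<tau>G (h s) \<in> V'" using U V V' by (intro W) auto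
    then show "\<forall>\<^sub>F s in \<F>. h s \<in> U"
      by eventually_elim (simp add: V(2) V'(2) p_rep_cpt)
  qed
  from continuous_map_limit[OF f this] show ?thesis by (simp add: o_def)
qed

text \<open>Since \<open>p p = p\<close>, a filter along which the universal representation converges weakly to \<open>p\<close>
  converges to the unit in \<open>\<tau>\<close>; hence the name.\<close>

definition unit_filter :: "'g filter" where
  "unit_filter = (SOME \<F>. \<F> \<noteq> bot \<and>
    (\<forall>x\<in>H. \<forall>y\<in>H. ((\<lambda>s. cinner (univ_rep \<tau>G s x) y) \<longlongrightarrow> cinner (p x) y) \<F>))"

lemma unit_filter:
  shows "unit_filter \<noteq> bot"
    and "x \<in> H \<Longrightarrow> y \<in> H \<Longrightarrow> ((\<lambda>s. cinner (gns_shift s x) y) \<longlongrightarrow> cinner (p x) y) unit_filter"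
proof -
  have "\<exists>\<F>. \<F> \<noteq> bot \<and> (\<forall>x\<in>H. \<forall>y\<in>H. ((\<lambda>s. cinner (univ_rep \<tau>G s x) y) \<longlongrightarrow> cinner (p x) y) \<F>)"
    using p_cpt unfolding univ_cpt_iff by blast
  from someI_ex[OF this] have *: "unit_filter \<noteq> bot"
    "\<And>x y. x \<in> H \<Longrightarrow> y \<in> H \<Longrightarrow> ((\<lambda>s. cinner (univ_rep \<tau>G s x) y) \<longlongrightarrow> cinner (p x) y) unit_filter"
    unfolding unit_filter_def by blast+
  show "unit_filter \<noteq> bot" by (rule *)
  show "x \<in> H \<Longrightarrow> y \<in> H \<Longrightarrow> ((\<lambda>s. cinner (gns_shift s x) y) \<longlongrightarrow> cinner (p x) y) unit_filter"
    using *(2)[of x y] by (simp add: univ_rep_apply)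
qed

lemma cinner_shift_left: "cinner (gns_shift t x) y = cinner x (gns_shift (- t) y)"
  using cinner_gns_shift[of "- t" "gns_shift t x" y] by (simp add: gns_shift_plus[symmetric] gns_shift_zero)

lemma continuous_tendsto_unit:
  assumes "continuous_map \<tau> euclidean f"
  shows "((\<lambda>s. f (t + s)) \<longlongrightarrow> f t) unit_filter"
proof (rule tendsto_of_continuous[OF assms])
  fix x y assume x: "x \<in> H" and y: "y \<in> H"
  have "((\<lambda>s. cinner (gns_shift s (p x)) (gns_shift (- t) y)) \<longlongrightarrow> cinner (p (p x)) (gns_shift (- t) y)) unit_filter"
    by (intro unit_filter Z_in_H gns_shift_in_univ_space x y)
  moreover have "cinner (p (gns_shift (t + s) x)) y = cinner (gns_shift s (p x)) (gns_shift (- t) y)" for s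
    using cinner_shift_left[of t "gns_shift s (p x)" y] x by (simp add: Z_shift gns_shift_plus gns_shift_in_univ_space)
  moreover have "cinner (p (gns_shift t x)) y = cinner (p (p x)) (gns_shift (- t) y)"
    using cinner_shift_left[of t "p x" y] x by (simp add: Z_shift Z_Z)
  ultimately show "((\<lambda>s. cinner (p (gns_shift (t + s) x)) y) \<longlongrightarrow> cinner (p (gns_shift t x)) y) unit_filter"
    by simp
qed

lemma action_tendsto:
  assumes "u \<in> fs_algebra \<tau>G"
  shows "((\<lambda>s. u (t + s)) \<longlongrightarrow> fs_action \<tau>G p u t) unit_filter"
proof -
  obtain \<xi> \<eta> where *: "\<xi> \<in> H" "\<eta> \<in> H" "u = coefficient (univ_rep \<tau>G) \<xi> \<eta>"
    using assms by (rule fs_algebra_coefficient)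
  have "((\<lambda>s. cinner (gns_shift s \<xi>) (gns_shift (- t) \<eta>)) \<longlongrightarrow> cinner (p \<xi>) (gns_shift (- t) \<eta>)) unit_filter"
    by (intro unit_filter gns_shift_in_univ_space *)
  moreover have "u (t + s) = cinner (gns_shift s \<xi>) (gns_shift (- t) \<eta>)" for s
    using cinner_shift_left[of t "gns_shift s \<xi>" \<eta>] *(1)
    by (simp add: *(3) coefficient_def univ_rep_apply gns_shift_plus)
  moreover have "fs_action \<tau>G p u t = cinner (p \<xi>) (gns_shift (- t) \<eta>)"
    unfolding *(3) action_coefficient[OF *(1,2)]
    using cinner_shift_left[of t "p \<xi>" \<eta>] *(1) by (simp add: coefficient_def univ_rep_apply Z_in_H)
  ultimately show ?thesis by simp
qed

lemma action_eq_iff_continuous: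
  assumes u: "u \<in> fs_algebra \<tau>G"
  shows "fs_action \<tau>G p u = u \<longleftrightarrow> continuous_map \<tau> euclidean u"
proof
  obtain \<xi> \<eta> where *: "\<xi> \<in> H" "\<eta> \<in> H" "u = coefficient (univ_rep \<tau>G) \<xi> \<eta>"
    using u by (rule fs_algebra_coefficient)
  assume "fs_action \<tau>G p u = u"
  then have "u = coefficient (univ_rep \<tau>G) (p \<xi>) \<eta>" using action_coefficient[OF *(1,2)] *(3) by simp
  then show "continuous_map \<tau> euclidean u"
    using continuous_p_coefficient[OF *(1,2)] *(1) by (simp add: coefficient_def univ_rep_apply Z_in_H)
next
  assume "continuous_map \<tau> euclidean u"
  then show "fs_action \<tau>G p u = u"
    using tendsto_unique[OF unit_filter(1) action_tendsto[OF u] continuous_tendsto_unit] by blast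
qed

text \<open>The action of \<open>p\<close> is a pointwise limit of translations, and translations are multiplicative.\<close>

lemma action_mult:
  assumes "u \<in> fs_algebra \<tau>G" "v \<in> fs_algebra \<tau>G"
  shows "fs_action \<tau>G p (\<lambda>s. u s * v s) = (\<lambda>s. fs_action \<tau>G p u s * fs_action \<tau>G p v s)"
proof
  fix t
  show "fs_action \<tau>G p (\<lambda>s. u s * v s) t = fs_action \<tau>G p u t * fs_action \<tau>G p v t"
    by (rule tendsto_unique[OF unit_filter(1) action_tendsto[OF fs_mult[OF assms]]])
       (intro tendsto_mult action_tendsto assms)
qed

text \<open>Along the filter the coefficient tends to \<open>cinner (p \<xi>) \<xi>\<close>, and by continuity to its value at the
  unit, the square of the norm of \<open>\<xi>\<close>.\<close>

lemma fixed_of_continuous: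
  assumes \<xi>: "\<xi> \<in> H" and "continuous_map \<tau> euclidean (\<lambda>s. cinner (gns_shift s \<xi>) \<xi>)"
  shows "p \<xi> = \<xi>"
proof (rule eq_of_cinner_eq_norm_square)
  have "((\<lambda>s. cinner (gns_shift (0 + s) \<xi>) \<xi>) \<longlongrightarrow> cinner (gns_shift 0 \<xi>) \<xi>) unit_filter"
    by (rule continuous_tendsto_unit[OF assms(2)])
  then have "cinner (p \<xi>) \<xi> = cinner \<xi> \<xi>"
    using tendsto_unique[OF unit_filter(1) unit_filter(2)[OF \<xi> \<xi>]] by (simp add: gns_shift_zero)
  then show "cinner (p \<xi>) \<xi> = complex_of_real ((norm \<xi>)\<^sup>2)" by (simp only: cinner_self)
qed (rule contraction[OF \<xi>])

subsection \<open>Recovering the idempotent from its topology\<close>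

lemma cont_pos_def_coarser: "cont_pos_def \<tau> \<subseteq> cont_pos_def \<tau>G"
  using coarser by (auto simp: cont_pos_def_def)

lemma univ_space_coarser: "univ_space \<tau> \<subseteq> H"
  using cont_pos_def_coarser
  by (intro univ_space_least csubspace_univ_space closed_univ_space gns_vec_in_univ_space) auto

lemma univ_cpt_preserves:
  assumes T: "T \<in> group_vN \<tau>G" and x: "x \<in> univ_space \<tau>"
  shows "T x \<in> univ_space \<tau>"
proof -
  have "univ_space \<tau> \<subseteq> {x \<in> H. T x \<in> univ_space \<tau>}"
  proof (rule univ_space_least)
    show "csubspace {x \<in> H. T x \<in> univ_space \<tau>}"
      using bounded_ops_zero[OF group_vND(1)[OF T] csubspace_univ_space] bounded_opsD(3,4)[OF group_vND(1)[OF T]]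
        csubspaceD[OF csubspace_univ_space[of \<tau>]] csubspaceD[OF csubspace_univ_space[of \<tau>G]]
      by (auto simp: csubspace_def)
    show "closed {x \<in> H. T x \<in> univ_space \<tau>}"
      by (intro bounded_ops_closed_preimage[OF group_vND(1)[OF T]] csubspace_univ_space closed_univ_space)
    fix u s assume u: "u \<in> cont_pos_def \<tau>"
    then have "u \<in> cont_pos_def \<tau>G" using cont_pos_def_coarser by blast
    then show "gns_vec u s \<in> {x \<in> H. T x \<in> univ_space \<tau>}"
      using group_vN_gns_space[OF _ T] gns_space_subset[OF u] gns_vec_in_univ_space by blast
  qed
  with x show ?thesis by blast
qed

text \<open>Restriction to the smaller universal space is continuous and extends the representation there; the
  extension is unique because the group is dense and the weak operator topology is Hausdorff.\<close>

lemma univ_extension_eq: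
  assumes "T \<in> univ_cpt \<tau>G"
  shows "univ_extension \<tau>G \<tau> T = op_restrict (univ_space \<tau>) T"
proof -
  let ?R = "restrict (\<lambda>T. op_restrict (univ_space \<tau>) T) (univ_cpt \<tau>G)"
  have R_cont: "continuous_map (univ_cpt_topology \<tau>G) (univ_cpt_topology \<tau>) ?R"
    unfolding univ_cpt_topology_def[of \<tau>] continuous_map_in_subtopology continuous_map_weak_op_iff topspace_univ_cpt
  proof (intro conjI ballI)
    have bnd: "?R T \<in> bounded_ops (univ_space \<tau>)" if T: "T \<in> univ_cpt \<tau>G" for T
    proof -
      have "\<exists>C. \<forall>x\<in>univ_space \<tau>. norm (op_restrict (univ_space \<tau>) T x) \<le> C * norm x"
        using univ_cpt_contraction[OF T] univ_space_coarser
        by (intro exI[of _ 1]) (auto simp: op_restrict_def)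
      moreover have Tb: "T \<in> bounded_ops H" and TvN: "T \<in> group_vN \<tau>G"
        using T univ_cpt_iff univ_cpt_subset_group_vN by blast+
      ultimately show ?thesis
        using T bounded_opsD(3,4)[OF Tb] univ_cpt_preserves[OF TvN] univ_space_coarser
          csubspaceD[OF csubspace_univ_space[of \<tau>]]
        by (auto simp: bounded_ops_def op_restrict_def subset_iff)
    qed
    show "?R T \<in> bounded_ops (univ_space \<tau>)" if "T \<in> univ_cpt \<tau>G" for T by (rule bnd[OF that])
    show "?R \<in> univ_cpt \<tau>G \<rightarrow> univ_cpt \<tau>"
    proof (rule Pi_I)
      fix T assume T: "T \<in> univ_cpt \<tau>G"
      then obtain \<F> where F: "\<F> \<noteq> bot"
        "\<forall>x\<in>H. \<forall>y\<in>H. ((\<lambda>s. cinner (univ_rep \<tau>G s x) y) \<longlongrightarrow> cinner (T x) y) \<F>"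
        unfolding univ_cpt_iff by blast
      have "((\<lambda>s. cinner (univ_rep \<tau> s x) y) \<longlongrightarrow> cinner (?R T x) y) \<F>"
        if "x \<in> univ_space \<tau>" "y \<in> univ_space \<tau>" for x y
      proof -
        have "x \<in> H" "y \<in> H" using that univ_space_coarser by blast+
        then show ?thesis using F(2) that T by (simp add: univ_rep_apply op_restrict_def)
      qed
      then show "?R T \<in> univ_cpt \<tau>" unfolding univ_cpt_iff using bnd[OF T] F(1) by blast
    qed
    fix x y assume xy: "x \<in> univ_space \<tau>" "y \<in> univ_space \<tau>"
    then have "continuous_map (univ_cpt_topology \<tau>G) euclidean (\<lambda>T. cinner (T x) y)"
      unfolding univ_cpt_topology_def using univ_space_coarser
      by (intro continuous_map_from_subtopology continuous_map_weak_op_component) auto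
    then show "continuous_map (univ_cpt_topology \<tau>G) euclidean (\<lambda>T. cinner (?R T x) y)"
      by (rule continuous_map_eq) (use xy in \<open>simp add: topspace_univ_cpt op_restrict_def\<close>)
  qed
  have R_rep: "?R (univ_rep \<tau>G s) = univ_rep \<tau> s" for s
    using univ_space_coarser univ_cpt_univ_rep[of \<tau>G s]
    by (auto simp: fun_eq_iff op_restrict_def univ_rep_def)
  have "univ_extension \<tau>G \<tau> = ?R"
    unfolding univ_extension_def
  proof (rule the_equality)
    fix \<Phi>
    assume \<Phi>: "\<Phi> \<in> extensional (univ_cpt \<tau>G) \<and> continuous_map (univ_cpt_topology \<tau>G) (univ_cpt_topology \<tau>) \<Phi> \<and>
      (\<forall>s. \<Phi> (univ_rep \<tau>G s) = univ_rep \<tau> s)"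
    show "\<Phi> = ?R"
    proof
      fix T
      show "\<Phi> T = ?R T"
      proof (cases "T \<in> univ_cpt \<tau>G")
        case True
        have "univ_cpt \<tau>G \<inter> range (univ_rep \<tau>G) = range (univ_rep \<tau>G)" using univ_cpt_univ_rep by blast
        then have "T \<in> univ_cpt_topology \<tau>G closure_of range (univ_rep \<tau>G)"
          using True by (simp add: univ_cpt_topology_def closure_of_subtopology) (simp add: univ_cpt_def)
        moreover have "Hausdorff_space (univ_cpt_topology \<tau>)"
          unfolding univ_cpt_topology_def
          by (intro Hausdorff_space_subtopology Hausdorff_weak_op_topology csubspace_univ_space)
        moreover have "\<Phi> S = ?R S" if "S \<in> range (univ_rep \<tau>G)" for S
          using that
        proof
          fix s assume "S = univ_rep \<tau>G s"
          then show ?thesis using \<Phi> R_rep[of s] by (simp only:)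
        qed
        ultimately show ?thesis
          using \<Phi> R_cont forall_in_closure_of_eq[of T _ _ _ \<Phi> ?R] by blast
      next
        case False
        then show ?thesis using \<Phi> by (simp add: extensional_def)
      qed
    qed
  qed (use R_cont R_rep in auto)
  then show ?thesis using assms by simp
qed

lemma p_fixes_univ_space:
  assumes "x \<in> univ_space \<tau>" shows "p x = x"
proof -
  have "univ_space \<tau> \<subseteq> {x \<in> H. op_id H x - p x \<in> {0}}"
  proof (rule univ_space_least)
    interpret c: central_projection \<tau>G Z_compl by (rule complement)
    show "closed {x \<in> H. op_id H x - p x \<in> {0}}"
      by (intro bounded_ops_closed_preimage[OF c.bounded] csubspace_univ_space closed_univ_space) simp
    show "csubspace {x \<in> H. op_id H x - p x \<in> {0}}"
      using bounded_ops_zero[OF bounded csubspace_univ_space] bounded_opsD(3,4)[OF bounded] in_H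
      by (auto simp: csubspace_def op_id_def op_restrict_def)
    fix u s assume u: "u \<in> cont_pos_def \<tau>"
    then have H: "gns_vec u t \<in> H" for t using cont_pos_def_coarser gns_vec_in_univ_space by blast
    have "continuous_map \<tau> euclidean (\<lambda>s. cinner (gns_shift s (gns_vec u 0)) (gns_vec u 0))"
      using u by (simp add: cont_pos_def_def gns_coefficient)
    then have "p (gns_vec u 0) = gns_vec u 0" by (rule fixed_of_continuous[OF H])
    then have "p (gns_vec u s) = gns_vec u s"
      using Z_shift[OF H, of s 0] by (simp add: gns_shift_vec)
    then show "gns_vec u s \<in> {x \<in> H. op_id H x - p x \<in> {0}}"
      using H by (simp add: op_id_def op_restrict_def)
  qed
  with assms show ?thesis by (auto simp: op_id_def op_restrict_def)
qed

text \<open>A vector fixed by \<open>p\<close> has the same coefficient as a cyclic vector in the universal space of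
  \<open>\<tau>\<close>, so elements of the compactification that fix the latter fix the former.\<close>

lemma kernel_fixes:
  assumes T: "T \<in> univ_cpt \<tau>G" and id: "op_restrict (univ_space \<tau>) T = op_id (univ_space \<tau>)" and x: "x \<in> H"
  shows "T (p x) = p x"
proof (rule eq_of_cinner_eq_norm_square)
  let ?\<zeta> = "p x"
  define v where "v = coefficient (univ_rep \<tau>G) ?\<zeta> ?\<zeta>"
  have \<zeta>: "?\<zeta> \<in> H" by (rule Z_in_H[OF x])
  have v_shift: "v s = cinner (gns_shift s ?\<zeta>) ?\<zeta>" for s
    using \<zeta> by (simp add: v_def coefficient_def univ_rep_apply)
  have vG: "v \<in> cont_pos_def \<tau>G"
    unfolding v_def by (rule coefficient_cont_pos_def[OF unitary_univ_rep[OF group_topology_G] \<zeta>])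
  have v: "v \<in> cont_pos_def \<tau>"
    using vG continuous_p_coefficient[OF x \<zeta>] by (simp add: cont_pos_def_def v_shift[abs_def])
  let ?\<delta> = "gns_vec v 0"
  have \<delta>: "?\<delta> \<in> univ_space \<tau>" "?\<delta> \<in> H" using gns_vec_in_univ_space v vG by blast+
  have \<delta>_shift: "cinner (gns_shift s ?\<delta>) ?\<delta> = v s" for s
    using v by (simp add: cont_pos_def_def gns_coefficient)
  have "T ?\<delta> = ?\<delta>" using fun_cong[OF id, of ?\<delta>] \<delta> by (simp add: op_restrict_def op_id_def)
  obtain \<F> where F: "\<F> \<noteq> bot"
    "\<forall>x\<in>H. \<forall>y\<in>H. ((\<lambda>s. cinner (univ_rep \<tau>G s x) y) \<longlongrightarrow> cinner (T x) y) \<F>"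
    using T unfolding univ_cpt_iff by blast
  have "(v \<longlongrightarrow> cinner (T ?\<zeta>) ?\<zeta>) \<F>"
    using bspec[OF bspec[OF F(2) \<zeta>] \<zeta>] \<zeta> by (simp add: univ_rep_apply v_shift[abs_def])
  moreover have "(v \<longlongrightarrow> cinner (T ?\<delta>) ?\<delta>) \<F>"
    using bspec[OF bspec[OF F(2) \<delta>(2)] \<delta>(2)] \<delta> by (simp add: univ_rep_apply \<delta>_shift)
  ultimately have "cinner (T ?\<zeta>) ?\<zeta> = cinner (T ?\<delta>) ?\<delta>" by (rule tendsto_unique[OF F(1)])
  also have "\<dots> = v 0" using \<delta>_shift[of 0] \<open>T ?\<delta> = ?\<delta>\<close> by (simp add: gns_shift_zero)
  also have "\<dots> = complex_of_real ((norm ?\<zeta>)\<^sup>2)" by (simp only: v_shift gns_shift_zero cinner_self)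
  finally show "cinner (T ?\<zeta>) ?\<zeta> = complex_of_real ((norm ?\<zeta>)\<^sup>2)" .
qed (rule univ_cpt_contraction[OF T Z_in_H[OF x]])

text \<open>By the preceding lemmas \<open>p\<close> is a zero element of the semigroup, hence lies below each of its
  idempotents.\<close>

theorem topology_idempotent_eq: "topology_idempotent \<tau>G \<tau> = p"
proof -
  let ?S = "{T \<in> univ_cpt \<tau>G. univ_extension \<tau>G \<tau> T = op_id (univ_space \<tau>)}"
  have pS: "p \<in> ?S"
    using p_fixes_univ_space by (auto simp: p_cpt univ_extension_eq op_id_def op_restrict_def)
  have absorb: "T \<circ> p = p" "p \<circ> T = p" if "T \<in> ?S" for T
  proof -
    have T: "T \<in> univ_cpt \<tau>G" "op_restrict (univ_space \<tau>) T = op_id (univ_space \<tau>)"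
      using that univ_extension_eq by auto
    have TvN: "T \<in> group_vN \<tau>G" using T(1) univ_cpt_subset_group_vN by blast
    show *: "T \<circ> p = p"
    proof
      fix x show "(T \<circ> p) x = p x"
        using kernel_fixes[OF T, of x] bounded_opsD(2)[OF bounded, of x]
          bounded_ops_zero[OF group_vND(1)[OF TvN] csubspace_univ_space] by (cases "x \<in> H") auto
    qed
    show "p \<circ> T = p" using * vN_commute[OF TvN] by (auto simp: fun_eq_iff)
  qed
  show ?thesis
    unfolding topology_idempotent_def
  proof (rule the_equality)
    show "minimal_idempotent ?S p"
      unfolding minimal_idempotent_def
    proof (intro conjI ballI impI pS idem)
      fix q assume "q \<in> ?S" "q \<circ> q = q \<and> q \<circ> p = q \<and> p \<circ> q = q"
      then show "q = p" using absorb(1)[of q] by simp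
    qed
    fix q assume q: "minimal_idempotent ?S q"
    then have "q \<in> ?S" and min: "p \<circ> p = p \<and> p \<circ> q = p \<and> q \<circ> p = p \<longrightarrow> p = q"
      unfolding minimal_idempotent_def using pS by blast+
    then show "q = p" using absorb[of q] idem by simp
  qed
qed

end

section \<open>Representations without continuous subrepresentations\<close>

lemma unitary_rep_restrict:
  assumes rep: "unitary_rep \<tau> K \<pi>" and L: "csubspace L" "closed L" "L \<subseteq> K"
    and inv: "\<And>s x. x \<in> L \<Longrightarrow> \<pi> s x \<in> L"
    and cont: "\<And>x y. x \<in> L \<Longrightarrow> y \<in> L \<Longrightarrow> continuous_map \<tau>' euclidean (\<lambda>s. cinner (\<pi> s x) y)"
  shows "unitary_rep \<tau>' L (\<lambda>s. op_restrict L (\<pi> s))"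
proof -
  note repD = unitary_repD[OF rep]
  have bnd: "op_restrict L (\<pi> s) \<in> bounded_ops L" for s
  proof -
    have "\<exists>C. \<forall>x\<in>L. norm (op_restrict L (\<pi> s) x) \<le> C * norm x"
      using repD(7) L(3) by (intro exI[of _ 1]) (auto simp: op_restrict_def)
    then show ?thesis
      using inv bounded_opsD(3,4)[OF repD(3)] csubspaceD[OF L(1)] L(3)
      by (auto simp: bounded_ops_def op_restrict_def subset_iff)
  qed
  have "op_restrict L (\<pi> (s + t)) = op_restrict L (\<pi> s) \<circ> op_restrict L (\<pi> t)" for s t
    by (auto simp: fun_eq_iff op_restrict_def repD(5) inv bounded_ops_zero[OF repD(3) repD(1)])
  moreover have "op_restrict L (\<pi> 0) = op_id L"
    using L(3) repD(4) by (auto simp: fun_eq_iff op_restrict_def op_id_def)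
  moreover have "cinner (op_restrict L (\<pi> s) x) (op_restrict L (\<pi> s) y) = cinner x y" if "x \<in> L" "y \<in> L" for s x y
    using that L(3) repD(6)[of x y s] by (auto simp: op_restrict_def)
  moreover have "continuous_map \<tau>' (weak_op_topology L) (\<lambda>s. op_restrict L (\<pi> s))"
    unfolding continuous_map_weak_op_iff using bnd cont by (auto simp: op_restrict_def)
  ultimately show ?thesis unfolding unitary_rep_def using L bnd by auto
qed

context central_idempotent
begin

text \<open>A \<open>\<tau>\<close>-continuous coefficient is fixed by \<open>p\<close>, and the set of these functions is already known to be
  translation invariant.\<close>

lemma continuous_translate:
  assumes "unitary_rep \<tau>G K \<pi>" "x \<in> K" "y \<in> K" "continuous_map \<tau> euclidean (\<lambda>s. cinner (\<pi> s x) y)"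
  shows "continuous_map \<tau> euclidean (\<lambda>s. cinner (\<pi> (s + t) x) y)"
proof -
  have "coefficient \<pi> x y \<in> component"
    unfolding image_action_eq
    using coefficient_in_fs_algebra[OF assms(1-3)] action_eq_iff_continuous assms(4)
    by (simp add: coefficient_def)
  then have "(\<lambda>s. coefficient \<pi> x y (s + t)) \<in> component"
    using translation_invariant unfolding translation_invariant_def by blast
  then show ?thesis
    unfolding image_action_eq using action_eq_iff_continuous by (auto simp: coefficient_def)
qed

text \<open>The intertwiner from the GNS space of \<open>v\<close> into \<open>K\<close> is isometric there. It takes \<open>p\<close> applied to the
  cyclic vector to a vector of \<open>K\<close> whose coefficients are coefficients of vectors in the range of \<open>p\<close>,
  hence \<open>\<tau>\<close>-continuous. The vectors of \<open>K\<close> with \<open>\<tau>\<close>-continuous coefficients form a subrepresentation.\<close>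

lemma no_subrep_annihilates:
  fixes K :: "'h::complex_hilbert set"
  assumes rep: "unitary_rep \<tau>G K \<pi>" and no: "\<nexists>L. cont_subrep \<tau> K \<pi> L" and \<xi>: "\<xi> \<in> K"
  defines "v \<equiv> coefficient \<pi> \<xi> \<xi>"
  shows "p (gns_vec v 0) = 0"
proof -
  note repD = unitary_repD[OF rep]
  have vG: "v \<in> cont_pos_def \<tau>G" unfolding v_def by (rule coefficient_cont_pos_def[OF rep \<xi>])
  have gram: "cinner (gns_vec v s) (gns_vec v t) = cinner (\<pi> s \<xi>) (\<pi> t \<xi>)" for s t
    using vG coefficient_gram[OF rep \<xi>, of t s] by (simp add: cinner_gns_vec cont_pos_def_def v_def)
  have norm_eq: "norm (\<Sum>s\<in>F. c s *\<^sub>C \<pi> s \<xi>) = norm (\<Sum>s\<in>F. c s *\<^sub>C gns_vec v s)" for F c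
  proof -
    have "complex_of_real ((norm (\<Sum>s\<in>F. c s *\<^sub>C \<pi> s \<xi>))\<^sup>2) = complex_of_real ((norm (\<Sum>s\<in>F. c s *\<^sub>C gns_vec v s))\<^sup>2)"
      unfolding norm_sum_scaleC_square gram by (rule refl)
    then have "(norm (\<Sum>s\<in>F. c s *\<^sub>C \<pi> s \<xi>))\<^sup>2 = (norm (\<Sum>s\<in>F. c s *\<^sub>C gns_vec v s))\<^sup>2"
      by (simp only: of_real_eq_iff)
    then show ?thesis by (simp add: power2_eq_iff_nonneg)
  qed
  obtain V :: "'g gns_total \<Rightarrow> 'h" where add: "\<And>y z. V (y + z) = V y + V z"
    and scale: "\<And>c y. V (c *\<^sub>C y) = c *\<^sub>C V y" and bound: "\<And>y. norm (V y) \<le> norm y"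
    and vec: "\<And>s. V (gns_vec v s) = \<pi> s \<xi>"
  proof (rule gns_contraction_exists[of "\<lambda>s. \<pi> s \<xi>" v])
    show "norm (\<Sum>s\<in>F. c s *\<^sub>C \<pi> s \<xi>) \<le> norm (\<Sum>s\<in>F. c s *\<^sub>C gns_vec v s)" for F c
      by (simp add: norm_eq)
  qed blast
  have bl: "bounded_linear V"
    by (rule bounded_linear_intro[of V 1]) (use add scale bound in \<open>simp_all flip: scaleC_of_real\<close>)
  have V0: "V 0 = 0" using scale[of 0 0] by simp
  have isom: "cinner (V y) (V z) = cinner y z" if "y \<in> gns_space v" "z \<in> gns_space v" for y z
    using that(1) unfolding gns_space_def
  proof (induction y rule: closed_cspan_induct)
    case (base y)
    then obtain s where y: "y = gns_vec v s" by blast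
    show ?case
      using that(2) unfolding gns_space_def
    proof (induction z rule: closed_cspan_induct)
      case closed
      show ?case by (intro closed_Collect_eq continuous_intros linear_continuous_on bl)
    qed (auto simp: y vec gram add scale V0 cinner_add_right cinner_scaleC_right)
  next
    case closed
    show ?case by (intro closed_Collect_eq continuous_intros linear_continuous_on bl)
  qed (auto simp: add scale V0 cinner_add_left cinner_scaleC_left)
  have V_K: "V y \<in> K" if "y \<in> gns_space v" for y
    using that unfolding gns_space_def
  proof (induction y rule: closed_cspan_induct)
    case closed
    have "closed (V -` K)" by (intro closed_vimage repD(2) linear_continuous_on bl)
    then show ?case by (simp add: vimage_def)
  qed (auto simp: vec add scale V0 csubspaceD[OF repD(1)] intro!: repD(8) \<xi>)
  have shift: "cinner (V (gns_shift s y)) \<eta> = cinner (V y) (\<pi> (- s) \<eta>)" if "y \<in> gns_space v" "\<eta> \<in> K" for s y \<eta>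
    using that(1) unfolding gns_space_def
  proof (induction y rule: closed_cspan_induct)
    case (base y)
    then obtain t where "y = gns_vec v t" by blast
    then show ?case
      using repD(9)[OF repD(8)[OF \<xi>, of t] that(2), of s] by (simp add: gns_shift_vec vec repD(5))
  next
    case closed
    show ?case
      by (intro closed_Collect_eq continuous_intros linear_continuous_on bl
          bounded_linear_compose[OF bl bounded_linear_gns_shift])
  qed (auto simp: gns_shift_add gns_shift_scaleC add scale V0 cinner_add_left cinner_scaleC_left)
  define \<delta> where "\<delta> = p (gns_vec v 0)"
  have \<delta>: "\<delta> \<in> gns_space v" "\<delta> \<in> H" "p \<delta> = \<delta>"
    unfolding \<delta>_def using group_vN_gns_space[OF vG in_vN] gns_vec_in_univ_space[OF vG] Z_in_H Z_Z by auto
  define L where "L = {x \<in> K. \<forall>y\<in>K. continuous_map \<tau> euclidean (\<lambda>s. cinner (\<pi> s x) y)}"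
  have L_sub: "csubspace L"
    unfolding L_def csubspace_def using csubspaceD[OF repD(1)] bounded_ops_zero[OF repD(3) repD(1)]
    by (auto simp: bounded_opsD(3,4)[OF repD(3)] cinner_add_left cinner_scaleC_left
        intro!: continuous_map_cadd continuous_map_cmult)
  have "L = K \<inter> (\<Inter>y\<in>K. {x. continuous_map \<tau> euclidean (\<lambda>s. cinner x (\<pi> (- s) y))})"
    unfolding L_def using repD(9) by auto
  moreover have "closed {x. continuous_map \<tau> euclidean (\<lambda>s. cinner x (\<pi> (- s) y))}" if "y \<in> K" for y
  proof (rule closed_continuous_coefficients)
    fix x x' s
    show "cmod (cinner x (\<pi> (- s) y) - cinner x' (\<pi> (- s) y)) \<le> norm y * norm (x - x')"
      using cinner_Cauchy_Schwarz[of "x - x'" "\<pi> (- s) y"] repD(7)[OF that, of "- s"]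
      by (simp add: cinner_diff_left mult.commute)
  qed
  ultimately have L_closed: "closed L" using repD(2) by (simp add: closed_INT closed_Int)
  have L_inv: "\<pi> t x \<in> L" if "x \<in> L" for t x
    using that continuous_translate[OF rep, of x _ t] repD(8)[of x t] by (auto simp: L_def repD(5))
  have "L = {0}"
  proof (rule ccontr)
    assume "L \<noteq> {0}"
    moreover have "unitary_rep \<tau> L (\<lambda>s. op_restrict L (\<pi> s))"
      by (rule unitary_rep_restrict[OF rep L_sub L_closed]) (use L_inv in \<open>auto simp: L_def\<close>)
    moreover have "L \<subseteq> K" by (auto simp: L_def)
    ultimately show False using no by (auto simp: cont_subrep_def)
  qed
  moreover have "V \<delta> \<in> L"
    unfolding L_def
  proof (intro CollectI conjI ballI V_K \<delta>(1))
    fix \<eta> assume \<eta>: "\<eta> \<in> K"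
    (* The adjoint of V turns the coefficient into one of the universal representation. *)
    obtain \<eta>' where \<eta>': "\<eta>' \<in> H" "\<And>y. y \<in> H \<Longrightarrow> cinner (V y) \<eta> = cinner y \<eta>'"
    proof (rule Riesz_representation[OF csubspace_univ_space closed_univ_space,
          where f = "\<lambda>y. cinner (V y) \<eta>" and C = "norm \<eta>"])
      fix y
      show "cmod (cinner (V y) \<eta>) \<le> norm \<eta> * norm y"
        using cinner_Cauchy_Schwarz[of "V y" \<eta>] mult_right_mono[OF bound[of y] norm_ge_zero[of \<eta>]]
        by (simp add: mult.commute)
    qed (auto simp: add scale cinner_add_left cinner_scaleC_left)
    have "cinner (\<pi> s (V \<delta>)) \<eta> = cinner (gns_shift s (p \<delta>)) \<eta>'" for s
      using repD(9)[OF V_K[OF \<delta>(1)] \<eta>, of s] shift[OF \<delta>(1) \<eta>, of s] \<eta>'(2)[OF gns_shift_in_univ_space[OF \<delta>(2)]]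
      by (simp add: \<delta>(3))
    then show "continuous_map \<tau> euclidean (\<lambda>s. cinner (\<pi> s (V \<delta>)) \<eta>)"
      using continuous_p_coefficient[OF \<delta>(2) \<eta>'(1)] by simp
  qed
  ultimately have "V \<delta> = 0" by simp
  then have "cinner \<delta> \<delta> = 0" using isom[OF \<delta>(1,1)] by simp
  then show ?thesis unfolding \<delta>_def by (simp add: cinner_self)
qed

text \<open>The action of \<open>p\<close> annihilates the diagonal coefficients. By polarisation it annihilates all of
  them; working with limits along the filter spares an expansion of the action.\<close>

lemma no_subrep_coefficient:
  fixes K :: "'h::complex_hilbert set"
  assumes rep: "unitary_rep \<tau>G K \<pi>" and no: "\<nexists>L. cont_subrep \<tau> K \<pi> L" and \<xi>\<eta>: "\<xi> \<in> K" "\<eta> \<in> K"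
  shows "coefficient \<pi> \<xi> \<eta> \<in> co_component"
proof -
  interpret c: central_projection \<tau>G Z_compl by (rule complement)
  let ?u = "coefficient \<pi> \<xi> \<eta>"
  have u: "?u \<in> fs_algebra \<tau>G" by (rule coefficient_in_fs_algebra[OF rep \<xi>\<eta>])
  have diag: "((\<lambda>s. coefficient \<pi> x x (t + s)) \<longlongrightarrow> 0) unit_filter" if x: "x \<in> K" for x t
  proof -
    let ?v = "coefficient \<pi> x x"
    have vG: "?v \<in> cont_pos_def \<tau>G" by (rule coefficient_cont_pos_def[OF rep x])
    have \<delta>: "gns_vec ?v 0 \<in> H" by (rule gns_vec_in_univ_space[OF vG])
    have v: "?v = coefficient (univ_rep \<tau>G) (gns_vec ?v 0) (gns_vec ?v 0)"
    proof
      fix s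
      have "coefficient (univ_rep \<tau>G) (gns_vec ?v 0) (gns_vec ?v 0) s = cinner (gns_shift s (gns_vec ?v 0)) (gns_vec ?v 0)"
        using \<delta> by (simp add: coefficient_def[of "univ_rep \<tau>G"] univ_rep_apply)
      then show "?v s = coefficient (univ_rep \<tau>G) (gns_vec ?v 0) (gns_vec ?v 0) s"
        using vG by (simp add: gns_coefficient cont_pos_def_def)
    qed
    have "fs_action \<tau>G p ?v = coefficient (univ_rep \<tau>G) (p (gns_vec ?v 0)) (gns_vec ?v 0)"
      by (subst v) (rule action_coefficient[OF \<delta> \<delta>])
    then have "fs_action \<tau>G p ?v t = 0"
      using no_subrep_annihilates[OF rep no x] bounded_ops_zero[OF univ_rep_bounded[of \<tau>G] csubspace_univ_space]
      by (simp add: coefficient_def[of "univ_rep \<tau>G"])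
    then show ?thesis using action_tendsto[OF fs_base[OF vG], of t] by simp
  qed
  have "fs_action \<tau>G p ?u t = 0" for t
  proof -
    have "((\<lambda>s. \<Sum>a\<in>{1, \<i>, -1, -\<i>}. a / 4 * coefficient \<pi> (\<xi> + a *\<^sub>C \<eta>) (\<xi> + a *\<^sub>C \<eta>) (t + s))
        \<longlongrightarrow> (\<Sum>a\<in>{1, \<i>, -1, -\<i>}. a / 4 * 0)) unit_filter"
      using csubspaceD[OF unitary_repD(1)[OF rep]] \<xi>\<eta> by (intro tendsto_sum tendsto_mult_left diag) auto
    then have "((\<lambda>s. ?u (t + s)) \<longlongrightarrow> 0) unit_filter"
      by (simp only: coefficient_polarisation[OF rep \<xi>\<eta>, symmetric] mult_zero_right sum.neutral_const)
    then show ?thesis by (rule tendsto_unique[OF unit_filter(1) action_tendsto[OF u]])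
  qed
  then have "fs_action \<tau>G Z_compl ?u = ?u" using action_split[OF u] by simp
  then show ?thesis using u unfolding c.image_action_eq by simp
qed

text \<open>The function is a coefficient of the universal representation on the kernel of \<open>p\<close>. A vector of a
  \<open>\<tau>\<close>-continuous subrepresentation would be fixed by \<open>p\<close>.\<close>

lemma complement_coefficient:
  assumes "u \<in> co_component"
  obtains K :: "'g gns_total set" and \<pi> \<xi> \<eta> where "unitary_rep \<tau>G K \<pi>" "\<xi> \<in> K" "\<eta> \<in> K"
    "\<nexists>L. cont_subrep \<tau> K \<pi> L" "u = coefficient \<pi> \<xi> \<eta>"
proof -
  interpret c: central_projection \<tau>G Z_compl by (rule complement)
  obtain \<xi> \<eta> where *: "\<xi> \<in> H" "\<eta> \<in> H" "op_id H \<xi> - p \<xi> = \<xi>" "op_id H \<eta> - p \<eta> = \<eta>"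
    "u = coefficient (univ_rep \<tau>G) \<xi> \<eta>"
    using assms by (rule c.image_action_coefficient)
  define K where "K = {x \<in> H. p x \<in> {0}}"
  have \<xi>\<eta>: "\<xi> \<in> K" "\<eta> \<in> K" using *(1-4) by (auto simp: K_def op_id_def op_restrict_def)
  have K: "csubspace K" "closed K" "K \<subseteq> H"
    using bounded_ops_zero[OF bounded csubspace_univ_space] bounded_opsD(3,4)[OF bounded] in_H
      bounded_ops_closed_preimage[OF bounded csubspace_univ_space closed_univ_space, of "{0}"]
    by (auto simp: K_def csubspace_def)
  have inv: "univ_rep \<tau>G s x \<in> K" if "x \<in> K" for s x
    using that by (auto simp: K_def univ_rep_apply gns_shift_in_univ_space Z_shift)
  let ?\<pi> = "\<lambda>s. op_restrict K (univ_rep \<tau>G s)"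
  have "unitary_rep \<tau>G K ?\<pi>"
    by (rule unitary_rep_restrict[OF unitary_univ_rep[OF group_topology_G] K inv])
       (use K(3) unitary_repD(10)[OF unitary_univ_rep[OF group_topology_G]] in auto)
  moreover have "\<nexists>L. cont_subrep \<tau> K ?\<pi> L"
  proof
    assume "\<exists>L. cont_subrep \<tau> K ?\<pi> L"
    then obtain L where L: "L \<subseteq> K" "L \<noteq> {0}" "unitary_rep \<tau> L (\<lambda>s. op_restrict L (?\<pi> s))"
      by (auto simp: cont_subrep_def)
    have "0 \<in> L" using csubspaceD(1)[OF unitary_repD(1)[OF L(3)]] .
    then obtain x where x: "x \<in> L" "x \<noteq> 0" using L(2) by blast
    then have xK: "x \<in> K" "x \<in> H" using L(1) K(3) by auto
    have "continuous_map \<tau> euclidean (\<lambda>s. cinner (gns_shift s x) x)"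
      using unitary_repD(10)[OF L(3) x(1) x(1)] x(1) xK by (simp add: op_restrict_def univ_rep_apply)
    then have "p x = x" by (rule fixed_of_continuous[OF xK(2)])
    then show False using xK(1) x(2) by (simp add: K_def)
  qed
  moreover have "u = coefficient ?\<pi> \<xi> \<eta>"
    using \<xi>\<eta> by (simp add: *(5) coefficient_def op_restrict_def)
  ultimately show thesis using that \<xi>\<eta> by blast
qed

lemma continuous_subalgebra: "fs_subalgebra \<tau>G component"
  unfolding fs_subalgebra_def image_action_eq
  using subspace[unfolded image_action_eq] by (auto simp: fs_mult action_mult)

text \<open>The component belonging to \<open>1 - p\<close> consists of the functions that \<open>p\<close> annihilates, and the action of
  \<open>p\<close> is multiplicative.\<close>

lemma complement_ideal: "fs_ideal \<tau>G co_component"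
proof -
  interpret c: central_projection \<tau>G Z_compl by (rule complement)
  have vanish: "fs_action \<tau>G Z_compl u = u \<longleftrightarrow> (\<forall>s. fs_action \<tau>G p u s = 0)"
    if "u \<in> fs_algebra \<tau>G" for u
    using fun_cong[OF action_split[OF that]] by (auto simp: fun_eq_iff)
  show ?thesis
    unfolding fs_ideal_def c.image_action_eq
    using c.subspace[unfolded c.image_action_eq] by (auto simp: fs_mult vanish action_mult)
qed

end

theorem theorem5p5:
  fixes \<tau>G \<tau> :: "'g::group_add topology"
  assumes "unitarizable \<tau>G"
    and "\<tau> \<in> idempotent_topologies \<tau>G"
  shows "fs_B \<tau>G \<tau> = {u \<in> fs_algebra \<tau>G. continuous_map \<tau> euclidean u} \<and>
    fs_I \<tau>G \<tau> = {coefficient \<pi> \<xi> \<eta> | (K :: 'g gns_total set) \<pi> \<xi> \<eta>.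
      unitary_rep \<tau>G K \<pi> \<and> \<xi> \<in> K \<and> \<eta> \<in> K \<and> (\<nexists>L. cont_subrep \<tau> K \<pi> L)} \<and>
    (\<forall>(K :: 'h::complex_hilbert set) \<pi> \<xi> \<eta>.
      unitary_rep \<tau>G K \<pi> \<and> \<xi> \<in> K \<and> \<eta> \<in> K \<and> (\<nexists>L. cont_subrep \<tau> K \<pi> L) \<longrightarrow>
      coefficient \<pi> \<xi> \<eta> \<in> fs_I \<tau>G \<tau>) \<and>
    l1_direct_sum \<tau>G (fs_B \<tau>G \<tau>) (fs_I \<tau>G \<tau>) \<and>
    fs_closed \<tau>G (fs_B \<tau>G \<tau>) \<and> translation_invariant (fs_B \<tau>G \<tau>) \<and> fs_subalgebra \<tau>G (fs_B \<tau>G \<tau>) \<and>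
    fs_closed \<tau>G (fs_I \<tau>G \<tau>) \<and> translation_invariant (fs_I \<tau>G \<tau>) \<and> fs_ideal \<tau>G (fs_I \<tau>G \<tau>)"
proof -
  have gt: "group_topology \<tau>G" using assms(1) by (simp add: unitarizable_def)
  obtain p where "p \<in> central_idempotents \<tau>G" "\<tau> = idempotent_topology \<tau>G p"
    using assms(2) by (auto simp: idempotent_topologies_def)
  with gt interpret central_idempotent \<tau>G p \<tau> by unfold_locales
  interpret c: central_projection \<tau>G Z_compl by (rule complement)
  have B: "fs_B \<tau>G \<tau> = component"
    and I: "fs_I \<tau>G \<tau> = co_component"
    by (simp_all add: fs_B_def fs_I_def topology_idempotent_eq)
  show ?thesis
    unfolding B I
  proof (intro conjI allI impI)
    show "component = {u \<in> fs_algebra \<tau>G. continuous_map \<tau> euclidean u}"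
      unfolding image_action_eq using action_eq_iff_continuous by blast
    show "co_component =
      {coefficient \<pi> \<xi> \<eta> | (K :: 'g gns_total set) \<pi> \<xi> \<eta>.
        unitary_rep \<tau>G K \<pi> \<and> \<xi> \<in> K \<and> \<eta> \<in> K \<and> (\<nexists>L. cont_subrep \<tau> K \<pi> L)}" (is "?I = ?R")
    proof (intro equalityI subsetI)
      fix u assume "u \<in> ?I"
      then show "u \<in> ?R" by (rule complement_coefficient) blast
    next
      fix u assume "u \<in> ?R"
      then show "u \<in> ?I" using no_subrep_coefficient by blast
    qed
    fix K :: "'h set" and \<pi> \<xi> \<eta>
    assume "unitary_rep \<tau>G K \<pi> \<and> \<xi> \<in> K \<and> \<eta> \<in> K \<and> (\<nexists>L. cont_subrep \<tau> K \<pi> L)"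
    then show "coefficient \<pi> \<xi> \<eta> \<in> co_component"
      by (intro no_subrep_coefficient) auto
  qed (rule l1_direct_sum closed translation_invariant continuous_subalgebra
      c.closed c.translation_invariant complement_ideal)+
qed

end
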